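(* The quantum superalgebra $\mathbb{C}_q[S]$ is a trivial quantum principal super bundle on the quantum chiral Minkowski superspace; that is, for the right $\mathbb{C}_q[\mathrm{GL}_2]$-coaction $\delta_q$ on $\mathbb{C}_q[S]$, $\mathbb{C}_q[S]$ is a trivial $\mathbb{C}_q[\mathrm{GL}_2]$-Hopf–Galois extension of $\mathbb{C}_q[\mathbb{M}]=\mathbb{C}_q[S]^{\mathrm{coinv}\,\mathbb{C}_q[\mathrm{GL}_2]}$.
   Context: $\mathbb{C}_q=\mathbb{C}[q,q^{-1}]$. Put $p(i)=0$ for $1\le i\le4$ and $p(5)=p(6)=1$. $\mathbb{C}_q[S]$ is the $\mathbb{C}_q$-superalgebra generated by even $a_{ij}$ ($1\le i\le4$, $j=1,2$), odd $a_{kl}=\alpha_{kl}$ ($k=5,6$, $l=1,2$) and an inverse of $D_{12}$, subject to $\alpha_{kl}^2=0$ and the Manin relations (for rows $i<k$ in $\{1,\dots,6\}$ in the last three families and $j\in\{1,2\}$) $$a_{i1}a_{i2}=(-1)^{p(i)}q^{(-1)^{p(i)+1}}a_{i2}a_{i1},\qquad a_{ij}a_{kj}=(-1)^{p(i)p(k)}q^{-1}a_{kj}a_{ij},$$ $$a_{i2}a_{k1}=(-1)^{p(i)p(k)}a_{k1}a_{i2},\qquad a_{i1}a_{k2}-(-1)^{p(i)p(k)}a_{k2}a_{i1}=(-1)^{p(i)p(k)}(q^{-1}-q)a_{k1}a_{i2},$$ where $D_{rs}=a_{r1}a_{s2}-q^{-1}a_{r2}a_{s1}$ for $1\le r<s\le6$.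 $\mathbb{C}_q[\mathrm{GL}_2]$ is the Hopf algebra generated by $g_{ij}$ ($i,j=1,2$), with the same relations as the $a_{ij}$ with $i,j\in\{1,2\}$, and an inverse of $g_{11}g_{22}-q^{-1}g_{12}g_{21}$, with $\Delta(g_{ij})=\sum_kg_{ik}\otimes g_{kj}$, $\varepsilon(g_{ij})=\delta_{ij}$. The coaction is $\delta_q:\mathbb{C}_q[S]\to\mathbb{C}_q[S]\otimes\mathbb{C}_q[\mathrm{GL}_2]$, $\delta_q(a_{ij})=\sum_{m=1}^2a_{im}\otimes g_{mj}$ ($1\le i\le6$, $j=1,2$). The $N=2$ quantum chiral Minkowski superspace $\mathbb{C}_q[\mathbb{M}]$ is the subsuperalgebra of $\mathbb{C}_q[S]$ generated by $$\tilde u_{i1}=-q^{-1}D_{2i}D_{12}^{-1},\quad \tilde u_{i2}=D_{1i}D_{12}^{-1}\ (i=3,4),\qquad \tilde\nu_{k1}=-q^{-1}D_{2k}D_{12}^{-1},\quad \tilde\nu_{k2}=D_{1k}D_{12}^{-1}\ (k=5,6).$$ Let $H$ be a Hopf superalgebra, $A$ a right $H$-comodule superalgebra with coaction $\delta:A\to A\otimes H$, and $B=A^{\mathrm{coinv}\,H}=\{a\in A\mid\delta(a)=a\otimes1\}$. The extension $B\subset A$ is $H$-Hopf–Galois if the canonical map $\chi=(m_A\otimes\mathrm{id})(\mathrm{id}\otimes_B\delta):A\otimes_BA\to A\otimes H$ is bijective. A quantum principal bundle is a pair $(A,B)$ such that $B\subset A$ is $H$-Hopf–Galois and $A$ is $H$-equivariantly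 projective as a left $B$-supermodule, i.e. there is a left $B$-supermodule and right $H$-comodule morphism $s:A\to B\otimes A$ that is a section of the multiplication $B\otimes A\to A$. The extension is trivial (or cleft) if there is a right $H$-comodule map $j:H\to A$ (a cleaving map) that is convolution invertible, i.e. there is $h:H\to A$ inverse to $j$ for the convolution product $j\star h=m_A\circ(j\otimes h)\circ\Delta$, with unit $f\mapsto\varepsilon(f)\cdot1$; a trivial quantum principal bundle is one given by a trivial extension. *)

theory Defs
  imports Complex_Main "HOL-Library.Poly_Mapping"
begin

section \<open>The ground ring \<open>\<complex>[q, q\<^sup>-\<^sup>1]\<close> and superalgebras over it\<close>

text \<open>\<open>\<complex>[q, q\<^sup>-\<^sup>1]\<close> is the group ring of \<open>\<int>\<close> over \<open>\<complex>\<close>; the exponent is the key.\<close>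

typedef laurent = "UNIV :: (int \<Rightarrow>\<^sub>0 complex) set" ..

setup_lifting type_definition_laurent

instantiation laurent :: comm_ring_1
begin

lift_definition zero_laurent :: laurent is 0 .
lift_definition one_laurent :: laurent is 1 .
lift_definition plus_laurent :: "laurent \<Rightarrow> laurent \<Rightarrow> laurent" is "(+)" .
lift_definition minus_laurent :: "laurent \<Rightarrow> laurent \<Rightarrow> laurent" is "(-)" .
lift_definition uminus_laurent :: "laurent \<Rightarrow> laurent" is uminus .
lift_definition times_laurent :: "laurent \<Rightarrow> laurent \<Rightarrow> laurent" is "(*)" .

instance by standard (transfer; simp add: algebra_simps)+

end

lift_definition qpow :: "int \<Rightarrow> laurent" is "\<lambda>n. Poly_Mapping.single n 1" .

lemma qpow_0 [simp]: "qpow 0 = 1"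
  by transfer simp

lemma qpow_mult [simp]: "qpow m * qpow n = qpow (m + n)"
  by transfer (simp add: mult_single)

lifting_forget laurent.lifting

lemma qpow_mult_left [simp]: "qpow m * (qpow n * c) = qpow (m + n) * c"
  by (simp flip: mult.assoc)

class cq_module = ab_group_add +
  fixes scaleq :: "laurent \<Rightarrow> 'a \<Rightarrow> 'a" (infixr \<open>*q\<close> 75)
  assumes scaleq_add_right: "c *q (x + y) = c *q x + c *q y"
    and scaleq_add_left: "(c + d) *q x = c *q x + d *q x"
    and scaleq_scaleq: "c *q d *q x = (c * d) *q x"
    and scaleq_one: "1 *q x = x"

global_interpretation cq: module "scaleq :: laurent \<Rightarrow> 'a \<Rightarrow> 'a::cq_module"
  by standard (rule scaleq_add_right scaleq_add_left scaleq_scaleq scaleq_one)+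

text \<open>A \<open>\<int>/2\<close>-grading is given by its projection onto the even part.\<close>

class cq_supermodule = cq_module +
  fixes even_part :: "'a \<Rightarrow> 'a"
  assumes even_part_add: "even_part (x + y) = even_part x + even_part y"
    and even_part_scaleq: "even_part (c *q x) = c *q even_part x"
    and even_part_idem [simp]: "even_part (even_part x) = even_part x"

definition odd_part :: "'a::cq_supermodule \<Rightarrow> 'a" where
  "odd_part x = x - even_part x"

text \<open>Not \<open>ring_1\<close>, which would require \<open>0 \<noteq> 1\<close>.\<close>

class cq_algebra = cq_module + ring + monoid_mult +
  assumes scaleq_mult_left: "(c *q x) * y = c *q (x * y)"
    and scaleq_mult_right: "x * (c *q y) = c *q (x * y)"

class cq_superalgebra = cq_algebra + cq_supermodule +
  assumes even_part_one [simp]: "even_part 1 = 1"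
    and even_part_mult: "even_part (x * y)
      = even_part x * even_part y + (x - even_part x) * (y - even_part y)"

instantiation laurent :: cq_superalgebra
begin

definition scaleq_laurent :: "laurent \<Rightarrow> laurent \<Rightarrow> laurent" where
  "scaleq_laurent = (*)"

definition even_part_laurent :: "laurent \<Rightarrow> laurent" where
  "even_part_laurent x = x"

instance
  by standard (simp_all add: scaleq_laurent_def even_part_laurent_def algebra_simps)

end

lemma even_part_0 [simp]: "even_part (0 :: 'a::cq_supermodule) = 0"
  using even_part_scaleq [of 0 "0::'a"] by simp

lemma even_part_minus: "even_part (- x :: 'a::cq_supermodule) = - even_part x"
  using even_part_scaleq [of "- 1" x] by simp

lemma even_part_diff: "even_part (x - y :: 'a::cq_supermodule) = even_part x - even_part y"
  using even_part_add [of x "- y"] by (simp add: even_part_minus)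

lemma odd_part_add: "odd_part (x + y) = odd_part x + odd_part y"
  by (simp add: odd_part_def even_part_add)

lemma odd_part_scaleq: "odd_part (c *q x) = c *q odd_part x"
  by (simp add: odd_part_def even_part_scaleq cq.scale_right_diff_distrib)

lemma even_odd_part [simp]: "even_part (odd_part x) = 0" "odd_part (even_part x) = 0"
    "odd_part (odd_part x) = odd_part x"
  by (simp_all add: odd_part_def even_part_diff)

lemma even_plus_odd: "even_part x + odd_part x = x"
  by (simp add: odd_part_def)

definition superlinear :: "('a::cq_supermodule \<Rightarrow> 'b::cq_supermodule) \<Rightarrow> bool" where
  "superlinear f \<longleftrightarrow> module_hom scaleq scaleq f \<and> (\<forall>x. f (even_part x) = even_part (f x))"

definition superalg_hom :: "('a::cq_superalgebra \<Rightarrow> 'b::cq_superalgebra) \<Rightarrow> bool" where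
  "superalg_hom f \<longleftrightarrow> superlinear f \<and> f 1 = 1 \<and> (\<forall>x y. f (x * y) = f x * f y)"

lemma module_hom_scaleqI:
  assumes "\<And>x y. f (x + y) = f x + f y" "\<And>c x. f (c *q x) = c *q f x"
  shows "module_hom scaleq scaleq f"
  by standard (rule assms)+


section \<open>Linear extension from a basis\<close>

definition pm_scale :: "'c \<Rightarrow> ('k \<Rightarrow>\<^sub>0 'c) \<Rightarrow> ('k \<Rightarrow>\<^sub>0 'c::comm_ring_1)" where
  "pm_scale c = Poly_Mapping.map ((*) c)"

lemma lookup_pm_scale [simp]: "poly_mapping.lookup (pm_scale c x) k = c * poly_mapping.lookup x k"
  unfolding pm_scale_def by transfer (simp add: when_def)

lemma pm_scale_single [simp]: "pm_scale c (Poly_Mapping.single k d) = Poly_Mapping.single k (c * d)"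
  by (rule poly_mapping_eqI) (simp add: lookup_single when_def)

global_interpretation pm: module "pm_scale :: 'c::comm_ring_1 \<Rightarrow> ('k \<Rightarrow>\<^sub>0 'c) \<Rightarrow> _"
  by standard (rule poly_mapping_eqI; simp add: lookup_add algebra_simps)+

lemma pm_induct [case_names single add]:
  assumes "\<And>k c. P (Poly_Mapping.single k c)" "\<And>x y. P x \<Longrightarrow> P y \<Longrightarrow> P (x + y)"
  shows "P (x :: 'k \<Rightarrow>\<^sub>0 'c::comm_monoid_add)"
proof (induction x rule: update_induct)
  case const
  show ?case using assms(1) [of undefined 0] by simp
next
  case (update x k c)
  have "Poly_Mapping.update k c x = x + Poly_Mapping.single k c"
    using update.hyps by (intro poly_mapping_eqI) (auto simp: lookup_add lookup_update lookup_single when_def in_keys_iff)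
  then show ?case using update assms by simp
qed

definition pm_ext :: "('k \<Rightarrow> 'a::cq_module) \<Rightarrow> ('k \<Rightarrow>\<^sub>0 laurent) \<Rightarrow> 'a" where
  "pm_ext f x = (\<Sum>k\<in>Poly_Mapping.keys x. poly_mapping.lookup x k *q f k)"

lemma pm_ext_superset:
  assumes "finite K" "Poly_Mapping.keys x \<subseteq> K"
  shows "pm_ext f x = (\<Sum>k\<in>K. poly_mapping.lookup x k *q f k)"
  unfolding pm_ext_def using assms by (intro sum.mono_neutral_left) (auto simp: in_keys_iff)

lemma pm_ext_add: "pm_ext f (x + y) = pm_ext f x + pm_ext f y"
proof -
  let ?K = "Poly_Mapping.keys x \<union> Poly_Mapping.keys y"
  have "pm_ext f z = (\<Sum>k\<in>?K. poly_mapping.lookup z k *q f k)" if "z = x \<or> z = y \<or> z = x + y" for z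
    using that Poly_Mapping.keys_add [of x y] by (intro pm_ext_superset) auto
  then show ?thesis
    by (simp add: lookup_add cq.scale_left_distrib sum.distrib)
qed

lemma pm_ext_scale: "pm_ext f (pm_scale c x) = c *q pm_ext f x"
proof -
  have "pm_ext f (pm_scale c x) = (\<Sum>k\<in>Poly_Mapping.keys x. poly_mapping.lookup (pm_scale c x) k *q f k)"
    by (intro pm_ext_superset) (auto simp: in_keys_iff)
  then show ?thesis
    by (simp add: pm_ext_def cq.scale_sum_right)
qed

lemma pm_ext_single [simp]: "pm_ext f (Poly_Mapping.single k c) = c *q f k"
  using pm_ext_superset [of "{k}" "Poly_Mapping.single k c" f] by simp

lemma pm_ext_hom: "module_hom pm_scale scaleq (pm_ext f)"
  by standard (simp_all add: pm_ext_add pm_ext_scale)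

lemma pm_ext_diff: "pm_ext f (x - y) = pm_ext f x - pm_ext f y"
  by (rule module_hom.diff [OF pm_ext_hom])


section \<open>Tensor products over \<open>\<complex>[q, q\<^sup>-\<^sup>1]\<close>\<close>

definition tensor_relators ::
    "(('a::cq_module \<times> 'b::cq_module) \<Rightarrow>\<^sub>0 laurent) set" where
  "tensor_relators =
     {Poly_Mapping.single (x + x', y) 1 - Poly_Mapping.single (x, y) 1
        - Poly_Mapping.single (x', y) 1 | x x' y. True}
   \<union> {Poly_Mapping.single (x, y + y') 1 - Poly_Mapping.single (x, y) 1
        - Poly_Mapping.single (x, y') 1 | x y y'. True}
   \<union> {Poly_Mapping.single (c *q x, y) 1 - Poly_Mapping.single (x, y) c | c x y. True}
   \<union> {Poly_Mapping.single (x, c *q y) 1 - Poly_Mapping.single (x, y) c | c x y. True}"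

definition tensor_rel ::
    "(('a::cq_module \<times> 'b::cq_module) \<Rightarrow>\<^sub>0 laurent) \<Rightarrow> (('a \<times> 'b) \<Rightarrow>\<^sub>0 laurent) \<Rightarrow> bool" where
  "tensor_rel u v \<longleftrightarrow> u - v \<in> pm.span tensor_relators"

lemma tensor_rel_equivp:
  "equivp (tensor_rel :: (('a::cq_module \<times> 'b::cq_module) \<Rightarrow>\<^sub>0 laurent) \<Rightarrow> _)"
  (is "equivp ?R")
proof (rule equivpI)
  show "reflp ?R"
    by (simp add: reflp_def tensor_rel_def pm.span_zero)
  show "symp ?R"
    by (metis minus_diff_eq pm.span_neg sympI tensor_rel_def)
  show "transp ?R"
  proof (rule transpI)
    fix u v w :: "('a \<times> 'b) \<Rightarrow>\<^sub>0 laurent"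
    assume "tensor_rel u v" "tensor_rel v w"
    then have "(u - v) + (v - w) \<in> pm.span tensor_relators"
      unfolding tensor_rel_def by (rule pm.span_add)
    then show "tensor_rel u w" by (simp add: tensor_rel_def)
  qed
qed

quotient_type (overloaded) ('a, 'b) tensor =
    "('a::cq_module \<times> 'b::cq_module) \<Rightarrow>\<^sub>0 laurent" / tensor_rel
  by (rule tensor_rel_equivp)

instantiation tensor :: (cq_module, cq_module) cq_module
begin

lift_definition zero_tensor :: "('a, 'b) tensor" is 0 .

lift_definition plus_tensor :: "('a, 'b) tensor \<Rightarrow> ('a, 'b) tensor \<Rightarrow> ('a, 'b) tensor" is "(+)"
  unfolding tensor_rel_def by (metis add_diff_add pm.span_add)

lift_definition minus_tensor :: "('a, 'b) tensor \<Rightarrow> ('a, 'b) tensor \<Rightarrow> ('a, 'b) tensor" is "(-)"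
proof -
  fix u u' v v' :: "('a \<times> 'b) \<Rightarrow>\<^sub>0 laurent"
  assume "tensor_rel u u'" "tensor_rel v v'"
  then have "(u - u') - (v - v') \<in> pm.span tensor_relators"
    unfolding tensor_rel_def by (rule pm.span_diff)
  then show "tensor_rel (u - v) (u' - v')"
    by (simp add: tensor_rel_def algebra_simps)
qed

lift_definition uminus_tensor :: "('a, 'b) tensor \<Rightarrow> ('a, 'b) tensor" is uminus
proof -
  fix u u' :: "('a \<times> 'b) \<Rightarrow>\<^sub>0 laurent"
  assume "tensor_rel u u'"
  then have "- (u - u') \<in> pm.span tensor_relators"
    unfolding tensor_rel_def by (rule pm.span_neg)
  then show "tensor_rel (- u) (- u')"
    by (simp add: tensor_rel_def algebra_simps)
qed

lift_definition scaleq_tensor :: "laurent \<Rightarrow> ('a, 'b) tensor \<Rightarrow> ('a, 'b) tensor" is pm_scale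
  unfolding tensor_rel_def by (metis pm.scale_right_diff_distrib pm.span_scale)

instance
proof
  fix a b c :: "('a, 'b) tensor" and r s :: laurent
  show "a + b + c = a + (b + c)"
    by transfer (simp add: tensor_rel_def add.assoc pm.span_zero)
  show "a + b = b + a"
    by transfer (simp add: tensor_rel_def add.commute pm.span_zero)
  show "0 + a = a"
    by transfer (simp add: tensor_rel_def pm.span_zero)
  show "- a + a = 0"
    by transfer (simp add: tensor_rel_def pm.span_zero)
  show "a - b = a + - b"
    by transfer (simp add: tensor_rel_def pm.span_zero)
  show "r *q (a + b) = r *q a + r *q b"
    by transfer (simp add: tensor_rel_def pm.span_zero pm.scale_right_distrib)
  show "(r + s) *q a = r *q a + s *q a"
    by transfer (simp add: tensor_rel_def pm.span_zero pm.scale_left_distrib)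
  show "r *q s *q a = (r * s) *q a"
    by transfer (simp add: tensor_rel_def pm.span_zero)
  show "1 *q a = a"
    by transfer (simp add: tensor_rel_def pm.span_zero)
qed

end

lift_definition pure_tensor :: "'a::cq_module \<Rightarrow> 'b::cq_module \<Rightarrow> ('a, 'b) tensor"
    (infixl \<open>\<otimes>\<close> 70)
  is "\<lambda>x y. Poly_Mapping.single (x, y) 1" .

lemma tensor_rel_relator: "r \<in> tensor_relators \<Longrightarrow> r = u - v \<Longrightarrow> tensor_rel u v"
  by (simp add: tensor_rel_def pm.span_base)

lemma tensor_add_left: "(x + x') \<otimes> y = x \<otimes> y + x' \<otimes> y"
proof transfer
  fix x x' :: 'a and y :: 'b
  have "Poly_Mapping.single (x + x', y) 1 - Poly_Mapping.single (x, y) 1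
        - Poly_Mapping.single (x', y) 1 \<in> tensor_relators"
    unfolding tensor_relators_def by blast
  then show "tensor_rel (Poly_Mapping.single (x + x', y) 1)
      (Poly_Mapping.single (x, y) 1 + Poly_Mapping.single (x', y) 1)"
    by (rule tensor_rel_relator) simp
qed

lemma tensor_add_right: "x \<otimes> (y + y') = x \<otimes> y + x \<otimes> y'"
proof transfer
  fix x :: 'a and y y' :: 'b
  have "Poly_Mapping.single (x, y + y') 1 - Poly_Mapping.single (x, y) 1
        - Poly_Mapping.single (x, y') 1 \<in> tensor_relators"
    unfolding tensor_relators_def by blast
  then show "tensor_rel (Poly_Mapping.single (x, y + y') 1)
      (Poly_Mapping.single (x, y) 1 + Poly_Mapping.single (x, y') 1)"
    by (rule tensor_rel_relator) simp
qed

lemma tensor_scaleq_left: "(c *q x) \<otimes> y = c *q (x \<otimes> y)"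
  by transfer (rule tensor_rel_relator [OF _ refl], unfold tensor_relators_def pm_scale_single mult_1_right, blast)

lemma tensor_scaleq_right: "x \<otimes> (c *q y) = c *q (x \<otimes> y)"
  by transfer (rule tensor_rel_relator [OF _ refl], unfold tensor_relators_def pm_scale_single mult_1_right, blast)

lemma tensor_0_left [simp]: "0 \<otimes> y = 0"
  using tensor_scaleq_left [of 0 0 y] by simp

lemma tensor_0_right [simp]: "x \<otimes> 0 = 0"
  using tensor_scaleq_right [of x 0 0] by simp

lemma tensor_minus_left: "(- x) \<otimes> y = - (x \<otimes> y)"
  using tensor_scaleq_left [of "- 1" x y] by simp

lemma tensor_minus_right: "x \<otimes> (- y) = - (x \<otimes> y)"
  using tensor_scaleq_right [of x "- 1" y] by simp

lemma tensor_diff_left: "(x - x') \<otimes> y = x \<otimes> y - x' \<otimes> y"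
  using tensor_add_left [of x "- x'" y] by (simp add: tensor_minus_left)

lemma tensor_diff_right: "x \<otimes> (y - y') = x \<otimes> y - x \<otimes> y'"
  using tensor_add_right [of x y "- y'"] by (simp add: tensor_minus_right)

lemma tensor_induct [case_names pure add]:
  assumes pure: "\<And>x y. P (x \<otimes> y)" and add: "\<And>t u. P t \<Longrightarrow> P u \<Longrightarrow> P (t + u)"
  shows "P t"
proof -
  have "P (abs_tensor p)" for p
  proof (induction p rule: pm_induct)
    case (single k c)
    have "abs_tensor (Poly_Mapping.single k c) = (c *q fst k) \<otimes> snd k"
      unfolding tensor_scaleq_left by (simp add: pure_tensor.abs_eq scaleq_tensor.abs_eq)
    then show ?case by (simp add: pure)
  next
    case (add p p')
    then show ?case
      by (metis assms(2) plus_tensor.abs_eq)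
  qed
  then show ?thesis by (induct t rule: tensor.abs_induct)
qed

text \<open>The linear map induced by \<open>f\<close>; it sends \<open>x \<otimes> y\<close> to \<open>f x y\<close> when \<open>f\<close> is bilinear.\<close>

definition tensor_lift ::
    "('a::cq_module \<Rightarrow> 'b::cq_module \<Rightarrow> 'c::cq_module) \<Rightarrow> ('a, 'b) tensor \<Rightarrow> 'c" where
  "tensor_lift f t = pm_ext (\<lambda>(x, y). f x y) (rep_tensor t)"

definition bilinearq ::
    "('a::cq_module \<Rightarrow> 'b::cq_module \<Rightarrow> 'c::cq_module) \<Rightarrow> bool" where
  "bilinearq f \<longleftrightarrow> (\<forall>y. module_hom scaleq scaleq (\<lambda>x. f x y)) \<and> (\<forall>x. module_hom scaleq scaleq (f x))"

lemma bilinearqI: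
  assumes "\<And>x x' y. f (x + x') y = f x y + f x' y" "\<And>x y y'. f x (y + y') = f x y + f x y'"
    "\<And>c x y. f (c *q x) y = c *q f x y" "\<And>c x y. f x (c *q y) = c *q f x y"
  shows "bilinearq f"
  unfolding bilinearq_def using assms by (auto intro!: module_hom_scaleqI)

lemma bilinearqD:
  assumes "bilinearq f"
  shows "f (x + x') y = f x y + f x' y" "f x (y + y') = f x y + f x y'"
    "f (c *q x) y = c *q f x y" "f x (c *q y) = c *q f x y"
  using assms module_hom.add [of scaleq scaleq "\<lambda>x. f x y"] module_hom.add [of scaleq scaleq "f x"]
    module_hom.scale [of scaleq scaleq "\<lambda>x. f x y"] module_hom.scale [of scaleq scaleq "f x"]
  unfolding bilinearq_def by blast+

lemma tensor_lift_abs: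
  assumes f: "bilinearq f"
  shows "tensor_lift f (abs_tensor p) = pm_ext (\<lambda>(x, y). f x y) p"
proof -
  let ?g = "pm_ext (\<lambda>(x, y). f x y)"
  have 0: "?g z = 0" if "z \<in> pm.span tensor_relators" for z
  proof (rule module_hom.eq_0_on_span [OF pm_ext_hom _ that])
    show "?g z = 0" if "z \<in> tensor_relators" for z
      using that
      by (auto simp: tensor_relators_def pm_ext_diff bilinearqD [OF f])
  qed
  have "tensor_rel (rep_tensor (abs_tensor p)) p"
    by (intro Quotient3_rep_abs [OF Quotient3_tensor] equivp_reflp [OF tensor_rel_equivp])
  then have "?g (rep_tensor (abs_tensor p) - p) = 0"
    by (intro 0) (simp add: tensor_rel_def)
  then show ?thesis
    by (simp add: tensor_lift_def pm_ext_diff)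
qed

lemma tensor_lift_pure:
  assumes "bilinearq f"
  shows "tensor_lift f (x \<otimes> y) = f x y"
  by (simp add: pure_tensor.abs_eq tensor_lift_abs [OF assms])

lemma tensor_lift_add:
  assumes "bilinearq f"
  shows "tensor_lift f (t + u) = tensor_lift f t + tensor_lift f u"
  by (induct t rule: tensor.abs_induct; induct u rule: tensor.abs_induct) (simp add: plus_tensor.abs_eq tensor_lift_abs [OF assms] pm_ext_add)

lemma tensor_lift_scaleq:
  assumes "bilinearq f"
  shows "tensor_lift f (c *q t) = c *q tensor_lift f t"
  by (induct t rule: tensor.abs_induct) (simp add: scaleq_tensor.abs_eq tensor_lift_abs [OF assms] pm_ext_scale)


text \<open>The multiplication of \<open>A \<otimes> B\<close> carries the sign
  \<open>(x \<otimes> y) (x' \<otimes> y') = (-1)\<^bsup>|y||x'|\<^esup> x x' \<otimes> y y'\<close> for homogeneous \<open>y\<close>, \<open>x'\<close>.\<close>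

definition tensor_mult ::
    "'a::cq_superalgebra \<Rightarrow> 'b::cq_superalgebra \<Rightarrow> 'a \<Rightarrow> 'b \<Rightarrow> ('a, 'b) tensor" where
  "tensor_mult x y x' y' = (x * x') \<otimes> (even_part y * y')
     + (x * (even_part x' - odd_part x')) \<otimes> (odd_part y * y')"

definition tensor_even :: "'a::cq_supermodule \<Rightarrow> 'b::cq_supermodule \<Rightarrow> ('a, 'b) tensor" where
  "tensor_even x y = even_part x \<otimes> even_part y + odd_part x \<otimes> odd_part y"

lemmas tensor_simps = tensor_add_left tensor_add_right tensor_diff_left tensor_diff_right
  tensor_minus_left tensor_minus_right tensor_scaleq_left tensor_scaleq_right

lemmas part_simps = even_part_add even_part_scaleq even_part_diff even_part_minus
  odd_part_add odd_part_scaleq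

lemma bilinearq_even: "bilinearq tensor_even"
  by (rule bilinearqI) (simp_all add: tensor_even_def tensor_simps part_simps algebra_simps)

lemma bilinearq_mult: "bilinearq (tensor_mult x y)"
  by (rule bilinearqI)
    (simp_all add: tensor_mult_def tensor_simps part_simps scaleq_mult_right algebra_simps)

lemma tensor_mult_bilinear:
  "tensor_mult (x + x') y a b = tensor_mult x y a b + tensor_mult x' y a b"
  "tensor_mult x (y + y') a b = tensor_mult x y a b + tensor_mult x y' a b"
  "tensor_mult (c *q x) y a b = c *q tensor_mult x y a b"
  "tensor_mult x (c *q y) a b = c *q tensor_mult x y a b"
  by (simp_all add: tensor_mult_def tensor_simps part_simps scaleq_mult_left algebra_simps)

lemma bilinearq_mult': "bilinearq (\<lambda>x y. tensor_lift (tensor_mult x y) u)"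
proof (induct u rule: tensor_induct)
  case (pure a b)
  show ?case
    unfolding tensor_lift_pure [OF bilinearq_mult]
    by (rule bilinearqI) (rule tensor_mult_bilinear)+
next
  case (add t u)
  show ?case
    by (rule bilinearqI)
      (simp_all add: tensor_lift_add [OF bilinearq_mult] bilinearqD [OF add(1)] bilinearqD [OF add(2)]
        algebra_simps)
qed

instantiation tensor :: (cq_supermodule, cq_supermodule) cq_supermodule
begin

definition even_part_tensor :: "('a, 'b) tensor \<Rightarrow> ('a, 'b) tensor" where
  "even_part_tensor = tensor_lift tensor_even"

instance
proof
  fix t u :: "('a, 'b) tensor" and c :: laurent
  show add: "even_part (t + u) = even_part t + even_part u" for t u :: "('a, 'b) tensor"
    by (simp add: even_part_tensor_def tensor_lift_add [OF bilinearq_even])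
  show "even_part (c *q t) = c *q even_part t"
    by (simp add: even_part_tensor_def tensor_lift_scaleq [OF bilinearq_even])
  show "even_part (even_part t) = even_part t"
  proof (induct t rule: tensor_induct)
    case (pure x y)
    show ?case
      by (simp add: even_part_tensor_def tensor_lift_pure [OF bilinearq_even]
          tensor_lift_add [OF bilinearq_even] tensor_even_def)
  qed (simp add: add)
qed

end

lemma even_part_pure: "even_part (x \<otimes> y) = even_part x \<otimes> even_part y + odd_part x \<otimes> odd_part y"
  by (simp add: even_part_tensor_def tensor_lift_pure [OF bilinearq_even] tensor_even_def)

definition homogeneous :: "nat \<Rightarrow> 'a::cq_supermodule \<Rightarrow> bool" where
  "homogeneous n x \<longleftrightarrow> even_part x = (if even n then x else 0)"

lemma homogeneous_parts: "homogeneous 0 (even_part x)" "homogeneous 1 (odd_part x)"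
  by (simp_all add: homogeneous_def)

lemma homogeneous_mult:
  fixes x y :: "'a::cq_superalgebra"
  assumes "homogeneous m x" "homogeneous n y"
  shows "homogeneous (m + n) (x * y)"
  using assms by (auto simp: homogeneous_def even_part_mult split: if_splits)

lemma tensor_induct_homogeneous [case_names pure add]:
  assumes pure: "\<And>m n x y. homogeneous m x \<Longrightarrow> homogeneous n y \<Longrightarrow> P (x \<otimes> y)"
    and add: "\<And>t u. P t \<Longrightarrow> P u \<Longrightarrow> P (t + u)"
  shows "P t"
proof (induct t rule: tensor_induct)
  case (pure x y)
  have "x \<otimes> y = (even_part x \<otimes> even_part y + even_part x \<otimes> odd_part y)
      + (odd_part x \<otimes> even_part y + odd_part x \<otimes> odd_part y)"
    by (simp only: even_plus_odd flip: tensor_add_left tensor_add_right)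
  also have "P \<dots>"
    by (intro add assms(1)) (rule homogeneous_parts)+
  finally show ?case .
qed (rule add)

instantiation tensor :: (cq_superalgebra, cq_superalgebra) cq_superalgebra
begin

definition one_tensor :: "('a, 'b) tensor" where
  "one_tensor = 1 \<otimes> 1"

definition times_tensor :: "('a, 'b) tensor \<Rightarrow> ('a, 'b) tensor \<Rightarrow> ('a, 'b) tensor" where
  "times_tensor t u = tensor_lift (\<lambda>x y. tensor_lift (tensor_mult x y) u) t"

lemma times_tensor_pure: "(x \<otimes> y) * (x' \<otimes> y') = tensor_mult x y x' y'"
  for x x' :: 'a and y y' :: 'b
  unfolding times_tensor_def tensor_lift_pure [OF bilinearq_mult']
  by (rule tensor_lift_pure [OF bilinearq_mult])

lemma times_tensor_homogeneous:
  fixes x x' :: 'a and y y' :: 'b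
  assumes "homogeneous m y" "homogeneous n x'"
  shows "(x \<otimes> y) * (x' \<otimes> y') = (-1) ^ (m * n) *q ((x * x') \<otimes> (y * y'))"
  using assms
  by (cases "even m"; cases "even n")
    (simp_all add: times_tensor_pure tensor_mult_def homogeneous_def odd_part_def tensor_minus_left)

instance
proof
  fix t u v :: "('a, 'b) tensor" and c :: laurent
  show distl: "(t + u) * v = t * v + u * v" for t u v :: "('a, 'b) tensor"
    by (simp add: times_tensor_def tensor_lift_add [OF bilinearq_mult'])
  show distr: "t * (u + v) = t * u + t * v" for t u v :: "('a, 'b) tensor"
  proof (induct t rule: tensor_induct)
    case (pure x y)
    show ?case
      unfolding times_tensor_def tensor_lift_pure [OF bilinearq_mult']
      by (rule tensor_lift_add [OF bilinearq_mult])
  qed (simp add: distl algebra_simps)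
  show scl: "(c *q t) * u = c *q (t * u)" for c and t u :: "('a, 'b) tensor"
    by (simp add: times_tensor_def tensor_lift_scaleq [OF bilinearq_mult'])
  show scr: "t * (c *q u) = c *q (t * u)" for c and t u :: "('a, 'b) tensor"
  proof (induct t rule: tensor_induct)
    case (pure x y)
    show ?case
      unfolding times_tensor_def tensor_lift_pure [OF bilinearq_mult']
      by (rule tensor_lift_scaleq [OF bilinearq_mult])
  qed (simp add: distl algebra_simps)
  have zero_mult: "0 * v = 0" "v * 0 = 0" for v :: "('a, 'b) tensor"
    using scl [of 0 0 v] scr [of v 0 0] by simp_all
  show "t * u * v = t * (u * v)"
  proof (induct t rule: tensor_induct_homogeneous)
    case t: (pure m1 n1 x1 y1)
    show ?case
    proof (induct u rule: tensor_induct_homogeneous)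
      case u: (pure m2 n2 x2 y2)
      show ?case
      proof (induct v rule: tensor_induct_homogeneous)
        case v: (pure m3 n3 x3 y3)
        have "(x1 \<otimes> y1) * (x2 \<otimes> y2) * (x3 \<otimes> y3)
          = (-1) ^ (n1 * m2) *q (-1) ^ ((n1 + n2) * m3) *q ((x1 * x2 * x3) \<otimes> (y1 * y2 * y3))"
          using t u v
          by (simp add: times_tensor_homogeneous [of n1 _ m2] scl
              times_tensor_homogeneous [of "n1 + n2" _ m3] homogeneous_mult del: cq.scale_scale)
        moreover have "(x1 \<otimes> y1) * ((x2 \<otimes> y2) * (x3 \<otimes> y3))
          = (-1) ^ (n2 * m3) *q (-1) ^ (n1 * (m2 + m3)) *q ((x1 * x2 * x3) \<otimes> (y1 * y2 * y3))"
          using t u v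
          by (simp add: times_tensor_homogeneous [of n2 _ m3] scr mult.assoc
              times_tensor_homogeneous [of n1 _ "m2 + m3"] homogeneous_mult del: cq.scale_scale)
        ultimately show ?case
          by (simp add: algebra_simps flip: power_add)
      qed (simp add: distr)
    qed (simp add: distl distr)
  qed (simp add: distl)
  show "1 * t = t"
    by (induct t rule: tensor_induct)
      (simp_all add: one_tensor_def times_tensor_pure tensor_mult_def odd_part_def distr)
  show "t * 1 = t"
  proof (induct t rule: tensor_induct)
    case (pure x y)
    show ?case
      by (simp add: one_tensor_def times_tensor_pure tensor_mult_def odd_part_def tensor_diff_right)
  qed (simp add: distl)
  show "even_part (1 :: ('a, 'b) tensor) = 1"
    by (simp add: one_tensor_def even_part_pure odd_part_def)
  show "even_part (t * u) = even_part t * even_part u + (t - even_part t) * (u - even_part u)"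
  proof (induct t rule: tensor_induct_homogeneous)
    case t: (pure m1 n1 x1 y1)
    show ?case
    proof (induct u rule: tensor_induct_homogeneous)
      case u: (pure m2 n2 x2 y2)
      have hom: "even_part (x \<otimes> y) = (if even (m + n) then x \<otimes> y else 0)"
        if "homogeneous m x" "homogeneous n y" for m n and x :: 'a and y :: 'b
        using that
        by (cases "even m"; cases "even n") (simp_all add: even_part_pure homogeneous_def odd_part_def)
      have *: "even_part ((x1 \<otimes> y1) * (x2 \<otimes> y2))
          = (-1) ^ (n1 * m2) *q (if even (m1 + m2 + (n1 + n2)) then (x1 * x2) \<otimes> (y1 * y2) else 0)"
        by (simp only: times_tensor_homogeneous [OF t(2) u(1)] even_part_scaleq
            hom [OF homogeneous_mult [OF t(1) u(1)] homogeneous_mult [OF t(2) u(2)]])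
      show ?case
        using t u unfolding * hom [OF t] hom [OF u]
        by (cases "even (m1 + n1)"; cases "even (m2 + n2)")
          (auto simp: times_tensor_homogeneous [of n1 _ m2] zero_mult)
    qed (simp only: distr even_part_add add_diff_add ac_simps)
  qed (simp only: distl even_part_add add_diff_add ac_simps)
qed

end


section \<open>Superalgebras given by generators and relations\<close>

datatype 'g word = Word (letters: "'g list")

instantiation word :: (type) monoid_add
begin

definition zero_word :: "'a word" where "zero_word = Word []"

definition plus_word :: "'a word \<Rightarrow> 'a word \<Rightarrow> 'a word" where
  "plus_word v w = Word (letters v @ letters w)"

instance by standard (simp_all add: zero_word_def plus_word_def)

end

lemma letters_simps [simp]: "letters 0 = []" "letters (v + w) = letters v @ letters w"
  by (simp_all add: zero_word_def plus_word_def)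

class graded_generators =
  fixes gparity :: "'a \<Rightarrow> nat"

definition wparity :: "'g::graded_generators word \<Rightarrow> nat" where
  "wparity w = sum_list (map gparity (letters w))"

lemma wparity_simps [simp]: "wparity 0 = 0" "wparity (v + w) = wparity v + wparity w"
  by (simp_all add: wparity_def)

lift_definition pm_filter :: "('k \<Rightarrow> bool) \<Rightarrow> ('k \<Rightarrow>\<^sub>0 'c) \<Rightarrow> ('k \<Rightarrow>\<^sub>0 'c::zero)"
  is "\<lambda>P f k. f k when P k"
  by (rule finite_subset) (auto simp: when_def)

lemma pm_filter_simps [simp]:
  "pm_filter P 0 = 0"
  "pm_filter P (Poly_Mapping.single k c) = (if P k then Poly_Mapping.single k c else 0)"
  "pm_filter P (pm_filter P x) = pm_filter P x"
  by (transfer; auto simp: when_def fun_eq_iff)+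

lemma pm_filter_add: "pm_filter P (x + y :: _ \<Rightarrow>\<^sub>0 'c::monoid_add) = pm_filter P x + pm_filter P y"
  by transfer (auto simp: when_def fun_eq_iff)

lemma pm_filter_scale: "pm_filter P (pm_scale c x) = pm_scale c (pm_filter P x)"
  unfolding pm_scale_def by transfer (auto simp: when_def fun_eq_iff)

lemma pm_filter_mult:
  fixes x y :: "'g::graded_generators word \<Rightarrow>\<^sub>0 laurent"
  defines "E \<equiv> pm_filter (\<lambda>w. even (wparity w)) :: ('g word \<Rightarrow>\<^sub>0 laurent) \<Rightarrow> _"
  shows "E (x * y) = E x * E y + (x - E x) * (y - E y)"
proof -
  have E_add: "E (x + y) = E x + E y" for x y
    by (simp add: E_def pm_filter_add)
  show ?thesis
  proof (induct x rule: pm_induct)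
    case (single k c)
    show ?case
    proof (induct y rule: pm_induct)
      case (single l d)
      show ?case by (auto simp: E_def mult_single)
    next
      case (add y y')
      show ?case
        by (simp only: distrib_left add E_add add_diff_add ac_simps)
    qed
  next
    case (add x x')
    show ?case
      by (simp only: distrib_right add E_add add_diff_add ac_simps)
  qed
qed

typedef 'g freealg = "UNIV :: ('g word \<Rightarrow>\<^sub>0 laurent) set" ..

setup_lifting type_definition_freealg

instantiation freealg :: (graded_generators) cq_superalgebra
begin

lift_definition zero_freealg :: "'a freealg" is 0 .
lift_definition one_freealg :: "'a freealg" is 1 .
lift_definition plus_freealg :: "'a freealg \<Rightarrow> 'a freealg \<Rightarrow> 'a freealg" is "(+)" .
lift_definition minus_freealg :: "'a freealg \<Rightarrow> 'a freealg \<Rightarrow> 'a freealg" is "(-)" .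
lift_definition uminus_freealg :: "'a freealg \<Rightarrow> 'a freealg" is uminus .
lift_definition times_freealg :: "'a freealg \<Rightarrow> 'a freealg \<Rightarrow> 'a freealg" is "(*)" .
lift_definition scaleq_freealg :: "laurent \<Rightarrow> 'a freealg \<Rightarrow> 'a freealg" is pm_scale .
lift_definition even_part_freealg :: "'a freealg \<Rightarrow> 'a freealg"
  is "pm_filter (\<lambda>w. even (wparity w))" .

instance
proof
  fix x y z :: "'a freealg" and c d :: laurent
  have scale: "pm_scale c p * r = pm_scale c (p * r)" "p * pm_scale c r = pm_scale c (p * r)"
    for c and p r :: "'a word \<Rightarrow>\<^sub>0 laurent"
  proof -
    show "pm_scale c p * r = pm_scale c (p * r)"
      by (simp add: pm_scale_def mult_map_scale_conv_mult mult.assoc)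
    show "p * pm_scale c r = pm_scale c (p * r)"
    proof (induct p rule: pm_induct)
      case (single k a)
      show ?case
      proof (induct r rule: pm_induct)
        case (single l b)
        show ?case by (simp add: mult_single mult.left_commute)
      qed (simp only: pm.scale_right_distrib distrib_left)
    qed (simp only: distrib_right pm.scale_right_distrib)
  qed
  show "x + y + z = x + (y + z)" "x + y = y + x" "0 + x = x" "- x + x = 0" "x - y = x + - y"
    "x * y * z = x * (y * z)" "1 * x = x" "x * 1 = x"
    "(x + y) * z = x * z + y * z" "x * (y + z) = x * y + x * z"
    by (transfer; simp add: algebra_simps)+
  show "c *q (x + y) = c *q x + c *q y" "(c + d) *q x = c *q x + d *q x"
    "c *q d *q x = (c * d) *q x" "1 *q x = x"
    by (transfer; simp add: algebra_simps)+
  show "(c *q x) * y = c *q (x * y)"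
    by transfer (rule scale)
  show "x * (c *q y) = c *q (x * y)"
    by transfer (rule scale)
  show "even_part (x + y) = even_part x + even_part y" "even_part (c *q x) = c *q even_part x"
    "even_part (even_part x) = even_part x"
    by (transfer; simp add: pm_filter_add pm_filter_scale)+
  have "pm_filter (\<lambda>w. even (wparity w)) (Poly_Mapping.single 0 1 :: 'a word \<Rightarrow>\<^sub>0 laurent)
      = Poly_Mapping.single 0 1"
    by (simp only: pm_filter_simps wparity_simps even_zero if_True)
  then show "even_part (1 :: 'a freealg) = 1"
    by transfer (simp only: single_one)
  show "even_part (x * y) = even_part x * even_part y + (x - even_part x) * (y - even_part y)"
    by transfer (rule pm_filter_mult)
qed

end

definition fgen :: "'g \<Rightarrow> 'g freealg" where
  "fgen g = Abs_freealg (Poly_Mapping.single (Word [g]) 1)"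

lemma Rep_fgen: "Rep_freealg (fgen g) = Poly_Mapping.single (Word [g]) 1"
  by (simp add: fgen_def Abs_freealg_inverse)

definition free_lift :: "('g \<Rightarrow> 'a::cq_superalgebra) \<Rightarrow> 'g freealg \<Rightarrow> 'a" where
  "free_lift \<phi> x = pm_ext (\<lambda>w. prod_list (map \<phi> (letters w))) (Rep_freealg x)"

lemma free_lift_gen [simp]: "free_lift \<phi> (fgen g) = \<phi> g"
  by (simp add: free_lift_def Rep_fgen)

lemma free_lift_simps [simp]:
  fixes x y :: "'g::graded_generators freealg" and \<phi> :: "'g \<Rightarrow> 'a::cq_superalgebra"
  shows "free_lift \<phi> 0 = 0" "free_lift \<phi> 1 = 1"
    "free_lift \<phi> (x + y) = free_lift \<phi> x + free_lift \<phi> y"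
    "free_lift \<phi> (x - y) = free_lift \<phi> x - free_lift \<phi> y"
    "free_lift \<phi> (c *q x) = c *q free_lift \<phi> x"
    "free_lift \<phi> (x * y) = free_lift \<phi> x * free_lift \<phi> y"
proof -
  show "free_lift \<phi> 0 = 0"
    by (simp add: free_lift_def zero_freealg.rep_eq pm_ext_def)
  have "pm_ext (\<lambda>w. prod_list (map \<phi> (letters w))) (Poly_Mapping.single 0 1) = 1"
    by (simp only: pm_ext_single letters_simps list.map prod_list.Nil cq.scale_one)
  then show "free_lift \<phi> 1 = 1"
    by (simp add: free_lift_def one_freealg.rep_eq)
  show "free_lift \<phi> (x + y) = free_lift \<phi> x + free_lift \<phi> y"
    "free_lift \<phi> (x - y) = free_lift \<phi> x - free_lift \<phi> y"
    "free_lift \<phi> (c *q x) = c *q free_lift \<phi> x"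
    by (simp_all add: free_lift_def plus_freealg.rep_eq minus_freealg.rep_eq scaleq_freealg.rep_eq
        pm_ext_add pm_ext_diff pm_ext_scale)
  let ?f = "pm_ext (\<lambda>w. prod_list (map \<phi> (letters w)))"
  have "?f (p * r) = ?f p * ?f r" for p r :: "'g word \<Rightarrow>\<^sub>0 laurent"
  proof (induct p rule: pm_induct)
    case (single k a)
    show ?case
    proof (induct r rule: pm_induct)
      case (single l b)
      show ?case
        by (simp add: mult_single scaleq_mult_left scaleq_mult_right mult.commute)
    qed (simp only: pm_ext_add distrib_left)
  qed (simp only: pm_ext_add distrib_right)
  then show "free_lift \<phi> (x * y) = free_lift \<phi> x * free_lift \<phi> y"
    by (simp add: free_lift_def times_freealg.rep_eq)
qed

lemma homogeneous_prod_list: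
  fixes \<phi> :: "'g::graded_generators \<Rightarrow> 'a::cq_superalgebra"
  assumes "\<And>g. homogeneous (gparity g) (\<phi> g)"
  shows "homogeneous (sum_list (map gparity gs)) (prod_list (map \<phi> gs))"
proof (induct gs)
  case Nil
  show ?case by (simp add: homogeneous_def)
qed (simp add: homogeneous_mult assms)

lemma free_lift_even:
  fixes \<phi> :: "'g::graded_generators \<Rightarrow> 'a::cq_superalgebra"
  assumes "\<And>g. homogeneous (gparity g) (\<phi> g)"
  shows "free_lift \<phi> (even_part x) = even_part (free_lift \<phi> x)"
proof -
  note hom = homogeneous_prod_list [of \<phi>, OF assms]
  let ?f = "pm_ext (\<lambda>w. prod_list (map \<phi> (letters w)))"
  have "?f (pm_filter (\<lambda>w. even (wparity w)) p) = even_part (?f p)" for p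
  proof (induct p rule: pm_induct)
    case (single k c)
    show ?case
      using hom [of "letters k"]
      by (auto simp: even_part_scaleq homogeneous_def wparity_def pm_ext_def [of _ 0] split: if_splits)
  qed (simp add: pm_ext_add pm_filter_add even_part_add)
  then show ?thesis
    by (simp add: free_lift_def even_part_freealg.rep_eq)
qed

inductive_set ideal_hull :: "'r::ring set \<Rightarrow> 'r set" for R where
  zero: "0 \<in> ideal_hull R"
| base: "r \<in> R \<Longrightarrow> r \<in> ideal_hull R"
| add: "x \<in> ideal_hull R \<Longrightarrow> y \<in> ideal_hull R \<Longrightarrow> x + y \<in> ideal_hull R"
| left: "x \<in> ideal_hull R \<Longrightarrow> z * x \<in> ideal_hull R"
| right: "x \<in> ideal_hull R \<Longrightarrow> x * z \<in> ideal_hull R"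

text \<open>A type of generators together with homogeneous relators; \<open>'g presented\<close> is the
  superalgebra it presents.\<close>

class presentation = graded_generators +
  fixes relators :: "'a freealg set"
  assumes relators_monomials: "r \<in> relators \<Longrightarrow>
    \<exists>e. \<forall>w\<in>Poly_Mapping.keys (Rep_freealg r). even (sum_list (map gparity (letters w))) = e"

lemma homogeneous_monomials:
  "(even_part r = r \<or> even_part r = 0) \<longleftrightarrow>
    (\<exists>e. \<forall>w\<in>Poly_Mapping.keys (Rep_freealg r). even (sum_list (map gparity (letters w))) = e)"
  for r :: "'g::graded_generators freealg"
proof -
  have "even_part r = r \<longleftrightarrow> (\<forall>w\<in>Poly_Mapping.keys (Rep_freealg r). even (wparity w))"
    by transfer (transfer, auto simp: when_def fun_eq_iff)
  moreover have "even_part r = 0 \<longleftrightarrow> (\<forall>w\<in>Poly_Mapping.keys (Rep_freealg r). \<not> even (wparity w))"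
    by transfer (transfer, auto simp: when_def fun_eq_iff)
  ultimately show ?thesis
    unfolding wparity_def by (auto 4 4)
qed

lemmas relators_homogeneous =
  relators_monomials [folded homogeneous_monomials]

definition presented_rel ::
    "'g::presentation freealg \<Rightarrow> 'g freealg \<Rightarrow> bool" where
  "presented_rel x y \<longleftrightarrow> x - y \<in> ideal_hull relators"

lemma ideal_hull_uminus:
  fixes R :: "'a::cq_algebra set"
  shows "x \<in> ideal_hull R \<Longrightarrow> - x \<in> ideal_hull R"
  using ideal_hull.left [of x R "- 1"] by simp

lemma ideal_hull_diff:
  fixes R :: "'a::cq_algebra set"
  shows "x \<in> ideal_hull R \<Longrightarrow> y \<in> ideal_hull R \<Longrightarrow> x - y \<in> ideal_hull R"
  using ideal_hull.add [of x R "- y"] ideal_hull_uminus [of y R] by simp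

lemma ideal_hull_scaleq:
  fixes R :: "'a::cq_algebra set"
  shows "x \<in> ideal_hull R \<Longrightarrow> c *q x \<in> ideal_hull R"
  using ideal_hull.left [of x R "c *q 1"] by (simp add: scaleq_mult_left)

lemma ideal_hull_even:
  assumes "x \<in> ideal_hull (relators :: 'g::presentation freealg set)"
  shows "even_part x \<in> ideal_hull relators"
  using assms
proof induct
  case (base r)
  then show ?case
    using relators_homogeneous [OF base] by (auto intro: ideal_hull.intros)
next
  case (left x z)
  then have "even_part z * even_part x + (z - even_part z) * (x - even_part x) \<in> ideal_hull relators"
    by (intro ideal_hull.add ideal_hull.left ideal_hull_diff)
  then show ?case by (simp add: even_part_mult)
next
  case (right x z)
  then have "even_part x * even_part z + (x - even_part x) * (z - even_part z) \<in> ideal_hull relators"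
    by (intro ideal_hull.add ideal_hull.right ideal_hull_diff)
  then show ?case by (simp add: even_part_mult)
qed (simp_all add: even_part_add ideal_hull.intros)

lemma presented_rel_equivp:
  "equivp (presented_rel :: 'g::presentation freealg \<Rightarrow> _)" (is "equivp ?R")
proof (rule equivpI)
  show "reflp ?R"
    by (simp add: reflp_def presented_rel_def ideal_hull.zero)
  show "symp ?R"
    by (metis ideal_hull_uminus minus_diff_eq presented_rel_def sympI)
  show "transp ?R"
  proof (rule transpI)
    fix u v w :: "'g freealg"
    assume "presented_rel u v" "presented_rel v w"
    then have "(u - v) + (v - w) \<in> ideal_hull relators"
      unfolding presented_rel_def by (rule ideal_hull.add)
    then show "presented_rel u w" by (simp add: presented_rel_def)
  qed
qed

quotient_type (overloaded) 'g presented = "'g::presentation freealg" / presented_rel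
  by (rule presented_rel_equivp)

lemma presented_relI: "x = y \<Longrightarrow> presented_rel x y"
  by (simp add: presented_rel_def ideal_hull.zero)

instantiation presented :: (presentation) cq_superalgebra
begin

lift_definition zero_presented :: "'a presented" is 0 .
lift_definition one_presented :: "'a presented" is 1 .

lift_definition plus_presented :: "'a presented \<Rightarrow> 'a presented \<Rightarrow> 'a presented" is "(+)"
  unfolding presented_rel_def by (metis add_diff_add ideal_hull.add)

lift_definition minus_presented :: "'a presented \<Rightarrow> 'a presented \<Rightarrow> 'a presented" is "(-)"
proof -
  fix x x' y y' :: "'a freealg"
  assume "presented_rel x x'" "presented_rel y y'"
  then have "(x - x') - (y - y') \<in> ideal_hull relators"
    unfolding presented_rel_def by (rule ideal_hull_diff)
  then show "presented_rel (x - y) (x' - y')"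
    by (simp add: presented_rel_def algebra_simps)
qed

lift_definition uminus_presented :: "'a presented \<Rightarrow> 'a presented" is uminus
proof -
  fix x x' :: "'a freealg"
  assume "presented_rel x x'"
  then have "- (x - x') \<in> ideal_hull relators"
    unfolding presented_rel_def by (rule ideal_hull_uminus)
  then show "presented_rel (- x) (- x')"
    by (simp add: presented_rel_def algebra_simps)
qed

lift_definition times_presented :: "'a presented \<Rightarrow> 'a presented \<Rightarrow> 'a presented" is "(*)"
proof -
  fix x x' y y' :: "'a freealg"
  assume "presented_rel x x'" "presented_rel y y'"
  then have "(x - x') * y + x' * (y - y') \<in> ideal_hull relators"
    unfolding presented_rel_def by (intro ideal_hull.add ideal_hull.left ideal_hull.right)
  then show "presented_rel (x * y) (x' * y')"
    by (simp add: presented_rel_def algebra_simps)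
qed

lift_definition scaleq_presented :: "laurent \<Rightarrow> 'a presented \<Rightarrow> 'a presented" is scaleq
  unfolding presented_rel_def by (metis cq.scale_right_diff_distrib ideal_hull_scaleq)

lift_definition even_part_presented :: "'a presented \<Rightarrow> 'a presented" is even_part
  unfolding presented_rel_def by (metis even_part_diff ideal_hull_even)

instance
proof
  fix x y z :: "'a presented" and c d :: laurent
  show "x + y + z = x + (y + z)" "x + y = y + x" "0 + x = x" "- x + x = 0" "x - y = x + - y"
    "x * y * z = x * (y * z)" "1 * x = x" "x * 1 = x"
    "(x + y) * z = x * z + y * z" "x * (y + z) = x * y + x * z"
    by (transfer, rule presented_relI, simp add: algebra_simps)+
  show "c *q (x + y) = c *q x + c *q y" "(c + d) *q x = c *q x + d *q x"
    "c *q d *q x = (c * d) *q x" "1 *q x = x"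
    by (transfer, rule presented_relI, simp add: algebra_simps)+
  show "(c *q x) * y = c *q (x * y)" "x * (c *q y) = c *q (x * y)"
    by (transfer, rule presented_relI, simp add: scaleq_mult_left scaleq_mult_right)+
  show "even_part (x + y) = even_part x + even_part y" "even_part (c *q x) = c *q even_part x"
    "even_part (even_part x) = even_part x"
    by (transfer, rule presented_relI, simp add: even_part_add even_part_scaleq)+
  show "even_part (1 :: 'a presented) = 1"
    by (transfer, rule presented_relI, simp)
  show "even_part (x * y) = even_part x * even_part y + (x - even_part x) * (y - even_part y)"
    by (transfer, rule presented_relI, simp add: even_part_mult)
qed

end

definition gen :: "'g::presentation \<Rightarrow> 'g presented" where
  "gen g = abs_presented (fgen g)"

text \<open>The homomorphism with prescribed values on the generators; see \<open>presented_lift_gen\<close> and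
  \<open>presented_lift_hom\<close> for the condition under which it is well defined.\<close>

definition presented_lift ::
    "('g::presentation \<Rightarrow> 'a::cq_superalgebra) \<Rightarrow> 'g presented \<Rightarrow> 'a" where
  "presented_lift \<phi> x = free_lift \<phi> (rep_presented x)"

lemma presented_lift_abs:
  fixes \<phi> :: "'g::presentation \<Rightarrow> 'a::cq_superalgebra"
  assumes "\<And>r. r \<in> relators \<Longrightarrow> free_lift \<phi> r = 0"
  shows "presented_lift \<phi> (abs_presented x) = free_lift \<phi> x"
proof -
  have 0: "free_lift \<phi> z = 0" if "z \<in> ideal_hull relators" for z
    using that by induct (simp_all add: assms)
  have "presented_rel (rep_presented (abs_presented x)) x"
    by (intro Quotient3_rep_abs [OF Quotient3_presented] equivp_reflp [OF presented_rel_equivp])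
  then have "free_lift \<phi> (rep_presented (abs_presented x) - x) = 0"
    unfolding presented_rel_def by (rule 0)
  then show ?thesis
    by (simp add: presented_lift_def)
qed

lemma presented_lift_gen:
  fixes \<phi> :: "'g::presentation \<Rightarrow> 'a::cq_superalgebra"
  assumes "\<And>r. r \<in> relators \<Longrightarrow> free_lift \<phi> r = 0"
  shows "presented_lift \<phi> (gen g) = \<phi> g"
  by (simp add: gen_def presented_lift_abs [OF assms])

lemma presented_lift_hom:
  fixes \<phi> :: "'g::presentation \<Rightarrow> 'a::cq_superalgebra"
  assumes rel: "\<And>r. r \<in> relators \<Longrightarrow> free_lift \<phi> r = 0"
    and hom: "\<And>g. homogeneous (gparity g) (\<phi> g)"
  shows "superalg_hom (presented_lift \<phi>)"
proof -
  note abs = presented_lift_abs [of \<phi>, OF rel]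
  have "presented_lift \<phi> (x + y) = presented_lift \<phi> x + presented_lift \<phi> y" for x y
    by (induct x rule: presented.abs_induct; induct y rule: presented.abs_induct)
      (simp add: abs plus_presented.abs_eq)
  moreover have "presented_lift \<phi> (x * y) = presented_lift \<phi> x * presented_lift \<phi> y" for x y
    by (induct x rule: presented.abs_induct; induct y rule: presented.abs_induct)
      (simp add: abs times_presented.abs_eq)
  moreover have "presented_lift \<phi> (c *q x) = c *q presented_lift \<phi> x" for c x
    by (induct x rule: presented.abs_induct) (simp add: abs scaleq_presented.abs_eq)
  moreover have "presented_lift \<phi> (even_part x) = even_part (presented_lift \<phi> x)" for x
    by (induct x rule: presented.abs_induct)
      (simp add: abs even_part_presented.abs_eq free_lift_even [OF hom])
  moreover have "presented_lift \<phi> 1 = 1"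
    by (simp add: one_presented_def abs)
  ultimately show ?thesis
    unfolding superalg_hom_def superlinear_def by (auto intro!: module_hom_scaleqI)
qed


section \<open>Hopf superalgebras, comodules and principal bundles\<close>

definition tensor_map ::
    "('a::cq_module \<Rightarrow> 'c::cq_module) \<Rightarrow> ('b::cq_module \<Rightarrow> 'd::cq_module)
      \<Rightarrow> ('a, 'b) tensor \<Rightarrow> ('c, 'd) tensor" where
  "tensor_map f g = tensor_lift (\<lambda>x y. f x \<otimes> g y)"

definition tensor_assoc ::
    "(('a::cq_module, 'b::cq_module) tensor, 'c::cq_module) tensor \<Rightarrow> ('a, ('b, 'c) tensor) tensor" where
  "tensor_assoc = tensor_lift (\<lambda>t z. tensor_lift (\<lambda>x y. x \<otimes> (y \<otimes> z)) t)"

definition tensor_assoc' ::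
    "('a::cq_module, ('b::cq_module, 'c::cq_module) tensor) tensor \<Rightarrow> (('a, 'b) tensor, 'c) tensor" where
  "tensor_assoc' = tensor_lift (\<lambda>x. tensor_lift (\<lambda>y z. (x \<otimes> y) \<otimes> z))"

definition super_coalgebra ::
    "('h::cq_supermodule \<Rightarrow> ('h, 'h) tensor) \<Rightarrow> ('h \<Rightarrow> laurent) \<Rightarrow> bool" where
  "super_coalgebra \<Delta> \<epsilon> \<longleftrightarrow> superlinear \<Delta> \<and> superlinear \<epsilon>
    \<and> (\<forall>x. tensor_assoc (tensor_map \<Delta> id (\<Delta> x)) = tensor_map id \<Delta> (\<Delta> x))
    \<and> (\<forall>x. tensor_lift (\<lambda>y z. \<epsilon> y *q z) (\<Delta> x) = x)
    \<and> (\<forall>x. tensor_lift (\<lambda>y z. \<epsilon> z *q y) (\<Delta> x) = x)"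

definition convolution ::
    "('h \<Rightarrow> ('h, 'h) tensor) \<Rightarrow> ('h::cq_supermodule \<Rightarrow> 'a) \<Rightarrow> ('h \<Rightarrow> 'a) \<Rightarrow> 'h \<Rightarrow> 'a::cq_superalgebra" where
  "convolution \<Delta> f g x = tensor_lift (\<lambda>y z. f y * g z) (\<Delta> x)"

definition convolution_unit :: "('h \<Rightarrow> laurent) \<Rightarrow> 'h \<Rightarrow> 'a::cq_superalgebra" where
  "convolution_unit \<epsilon> x = \<epsilon> x *q 1"

definition hopf_superalgebra ::
    "('h::cq_superalgebra \<Rightarrow> ('h, 'h) tensor) \<Rightarrow> ('h \<Rightarrow> laurent) \<Rightarrow> bool" where
  "hopf_superalgebra \<Delta> \<epsilon> \<longleftrightarrow> super_coalgebra \<Delta> \<epsilon> \<and> superalg_hom \<Delta> \<and> superalg_hom \<epsilon>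
    \<and> (\<exists>S. superlinear S \<and> convolution \<Delta> S id = convolution_unit \<epsilon>
          \<and> convolution \<Delta> id S = convolution_unit \<epsilon>)"

definition super_comodule ::
    "('h::cq_supermodule \<Rightarrow> ('h, 'h) tensor) \<Rightarrow> ('h \<Rightarrow> laurent)
      \<Rightarrow> ('m::cq_supermodule \<Rightarrow> ('m, 'h) tensor) \<Rightarrow> bool" where
  "super_comodule \<Delta> \<epsilon> \<delta> \<longleftrightarrow> superlinear \<delta>
    \<and> (\<forall>x. tensor_assoc (tensor_map \<delta> id (\<delta> x)) = tensor_map id \<Delta> (\<delta> x))
    \<and> (\<forall>x. tensor_lift (\<lambda>y h. \<epsilon> h *q y) (\<delta> x) = x)"

definition comodule_map ::
    "('m::cq_supermodule \<Rightarrow> ('m, 'h::cq_supermodule) tensor) \<Rightarrow> ('n::cq_supermodule \<Rightarrow> ('n, 'h) tensor)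
      \<Rightarrow> ('m \<Rightarrow> 'n) \<Rightarrow> bool" where
  "comodule_map \<delta> \<delta>' f \<longleftrightarrow> superlinear f \<and> (\<forall>x. \<delta>' (f x) = tensor_map f id (\<delta> x))"

definition comodule_superalgebra ::
    "('h::cq_superalgebra \<Rightarrow> ('h, 'h) tensor) \<Rightarrow> ('h \<Rightarrow> laurent)
      \<Rightarrow> ('a::cq_superalgebra \<Rightarrow> ('a, 'h) tensor) \<Rightarrow> bool" where
  "comodule_superalgebra \<Delta> \<epsilon> \<delta> \<longleftrightarrow> super_comodule \<Delta> \<epsilon> \<delta> \<and> superalg_hom \<delta>"

definition coinvariants :: "('a::cq_superalgebra \<Rightarrow> ('a, 'h::cq_superalgebra) tensor) \<Rightarrow> 'a set" where
  "coinvariants \<delta> = {x. \<delta> x = x \<otimes> 1}"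

text \<open>An extension \<open>B \<subseteq> A\<close> is represented by its inclusion map \<open>\<iota>\<close>, an injective homomorphism of
  superalgebras.  The elements of \<open>A \<otimes>\<^sub>B A\<close> are the classes of \<open>A \<otimes> A\<close> modulo
  the span of the \<open>a b \<otimes> a' - a \<otimes> b a'\<close>.\<close>

definition balanced_rel ::
    "('b \<Rightarrow> 'a::cq_superalgebra) \<Rightarrow> (('a, 'a) tensor \<times> ('a, 'a) tensor) set" where
  "balanced_rel \<iota> = {(t, u). t - u \<in>
     cq.span {(x * \<iota> b) \<otimes> y - x \<otimes> (\<iota> b * y) | x b y. True}}"

definition balanced_tensor :: "('b \<Rightarrow> 'a::cq_superalgebra) \<Rightarrow> ('a, 'a) tensor set set" where
  "balanced_tensor \<iota> = UNIV // balanced_rel \<iota>"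

text \<open>The map \<open>(m\<^sub>A \<otimes> id) \<circ> (id \<otimes> \<delta>)\<close> on \<open>A \<otimes> A\<close>, and the canonical map it induces on
  the classes in \<open>A \<otimes>\<^sub>B A\<close>; \<open>canonical_map_class\<close> below shows that it is well defined.\<close>

definition canonical_lift ::
    "('a::cq_superalgebra \<Rightarrow> ('a, 'h::cq_superalgebra) tensor) \<Rightarrow> ('a, 'a) tensor \<Rightarrow> ('a, 'h) tensor" where
  "canonical_lift \<delta> = tensor_lift (\<lambda>x y. tensor_lift (\<lambda>z h. (x * z) \<otimes> h) (\<delta> y))"

definition canonical_map ::
    "('a::cq_superalgebra \<Rightarrow> ('a, 'h::cq_superalgebra) tensor) \<Rightarrow> ('a, 'a) tensor set \<Rightarrow> ('a, 'h) tensor" where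
  "canonical_map \<delta> X = the_elem (canonical_lift \<delta> ` X)"

lemma bilinearq_left_mult: "bilinearq (\<lambda>z h. (x * z) \<otimes> h)" for x :: "'a::cq_superalgebra"
  by (rule bilinearqI) (simp_all add: tensor_simps distrib_left scaleq_mult_right)

lemma tensor_lift_left_mult: "tensor_lift (\<lambda>z h. (x * z) \<otimes> h) t = (x \<otimes> 1) * t"
  for t :: "('a::cq_superalgebra, 'h::cq_superalgebra) tensor"
proof (induct t rule: tensor_induct)
  case (pure z h)
  show ?case
    by (simp add: tensor_lift_pure [OF bilinearq_left_mult] times_tensor_pure tensor_mult_def odd_part_def)
qed (simp only: tensor_lift_add [OF bilinearq_left_mult] distrib_left)

lemma bilinearq_canonical:
  assumes "superalg_hom \<delta>"
  shows "bilinearq (\<lambda>x y. tensor_lift (\<lambda>z h. (x * z) \<otimes> h) (\<delta> y))"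
proof -
  have "module_hom scaleq scaleq \<delta>"
    using assms by (simp add: superalg_hom_def superlinear_def)
  then show ?thesis
    unfolding tensor_lift_left_mult
    by (intro bilinearqI)
      (simp_all add: tensor_simps distrib_left distrib_right scaleq_mult_left scaleq_mult_right
        module_hom.add module_hom.scale)
qed

lemma canonical_lift_pure:
  assumes "superalg_hom \<delta>"
  shows "canonical_lift \<delta> (x \<otimes> y) = (x \<otimes> 1) * \<delta> y"
  unfolding canonical_lift_def tensor_lift_pure [OF bilinearq_canonical [OF assms]]
  by (rule tensor_lift_left_mult)

lemma canonical_lift_hom:
  assumes "superalg_hom \<delta>"
  shows "module_hom scaleq scaleq (canonical_lift \<delta>)"
  unfolding canonical_lift_def
  by (intro module_hom_scaleqI tensor_lift_add tensor_lift_scaleq bilinearq_canonical assms)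

lemma canonical_map_class:
  assumes \<delta>: "superalg_hom \<delta>" and \<iota>: "range \<iota> \<subseteq> coinvariants \<delta>"
  shows "canonical_map \<delta> (balanced_rel \<iota> `` {t}) = canonical_lift \<delta> t"
proof -
  have *: "canonical_lift \<delta> z = 0"
    if z: "z \<in> cq.span {(x * \<iota> b) \<otimes> y - x \<otimes> (\<iota> b * y) | x b y. True}" for z
  proof (rule module_hom.eq_0_on_span [OF canonical_lift_hom [OF \<delta>] _ z])
    fix z assume "z \<in> {(x * \<iota> b) \<otimes> y - x \<otimes> (\<iota> b * y) | x b y. True}"
    then obtain x b y where z: "z = (x * \<iota> b) \<otimes> y - x \<otimes> (\<iota> b * y)" by blast
    have "\<delta> (\<iota> b) = \<iota> b \<otimes> 1"
      using \<iota> by (auto simp: coinvariants_def)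
    then have "\<delta> (\<iota> b * y) = (\<iota> b \<otimes> 1) * \<delta> y"
      using \<delta> by (simp add: superalg_hom_def)
    then show "canonical_lift \<delta> z = 0"
      by (simp add: z module_hom.diff [OF canonical_lift_hom [OF \<delta>]] canonical_lift_pure [OF \<delta>]
          times_tensor_pure tensor_mult_def odd_part_def flip: mult.assoc)
  qed
  have "canonical_lift \<delta> u = canonical_lift \<delta> t" if "u \<in> balanced_rel \<iota> `` {t}" for u
    using * [of "t - u"] that
    by (simp add: balanced_rel_def module_hom.diff [OF canonical_lift_hom [OF \<delta>]])
  moreover have "t \<in> balanced_rel \<iota> `` {t}"
    by (simp add: balanced_rel_def cq.span_zero)
  ultimately have "canonical_lift \<delta> ` (balanced_rel \<iota> `` {t}) = {canonical_lift \<delta> t}"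
    by blast
  then show ?thesis
    by (simp add: canonical_map_def)
qed

definition hopf_galois_extension ::
    "('h::cq_superalgebra \<Rightarrow> ('h, 'h) tensor) \<Rightarrow> ('h \<Rightarrow> laurent)
      \<Rightarrow> ('a::cq_superalgebra \<Rightarrow> ('a, 'h) tensor) \<Rightarrow> ('b::cq_superalgebra \<Rightarrow> 'a) \<Rightarrow> bool" where
  "hopf_galois_extension \<Delta> \<epsilon> \<delta> \<iota> \<longleftrightarrow>
     hopf_superalgebra \<Delta> \<epsilon> \<and> comodule_superalgebra \<Delta> \<epsilon> \<delta>
   \<and> superalg_hom \<iota> \<and> inj \<iota> \<and> range \<iota> = coinvariants \<delta>
   \<and> bij_betw (canonical_map \<delta>) (balanced_tensor \<iota>) UNIV"

text \<open>On \<open>B \<otimes> A\<close> the left \<open>B\<close>-action is by multiplication on \<open>B\<close> and the coaction is \<open>id \<otimes> \<delta>\<close>.\<close>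

definition equivariantly_projective ::
    "('a::cq_superalgebra \<Rightarrow> ('a, 'h::cq_superalgebra) tensor) \<Rightarrow> ('b::cq_superalgebra \<Rightarrow> 'a) \<Rightarrow> bool" where
  "equivariantly_projective \<delta> \<iota> \<longleftrightarrow>
    (\<exists>s :: 'a \<Rightarrow> ('b, 'a) tensor.
        comodule_map \<delta> (\<lambda>t. tensor_assoc' (tensor_map id \<delta> t)) s
      \<and> (\<forall>b x. s (\<iota> b * x) = tensor_map ((*) b) id (s x))
      \<and> (\<forall>x. tensor_lift (\<lambda>b y. \<iota> b * y) (s x) = x))"

definition quantum_principal_bundle ::
    "('h::cq_superalgebra \<Rightarrow> ('h, 'h) tensor) \<Rightarrow> ('h \<Rightarrow> laurent)
      \<Rightarrow> ('a::cq_superalgebra \<Rightarrow> ('a, 'h) tensor) \<Rightarrow> ('b::cq_superalgebra \<Rightarrow> 'a) \<Rightarrow> bool" where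
  "quantum_principal_bundle \<Delta> \<epsilon> \<delta> \<iota> \<longleftrightarrow>
     hopf_galois_extension \<Delta> \<epsilon> \<delta> \<iota> \<and> equivariantly_projective \<delta> \<iota>"

definition cleft ::
    "('h::cq_superalgebra \<Rightarrow> ('h, 'h) tensor) \<Rightarrow> ('h \<Rightarrow> laurent)
      \<Rightarrow> ('a::cq_superalgebra \<Rightarrow> ('a, 'h) tensor) \<Rightarrow> bool" where
  "cleft \<Delta> \<epsilon> \<delta> \<longleftrightarrow>
    (\<exists>j h. comodule_map \<Delta> \<delta> j \<and> superlinear h
      \<and> convolution \<Delta> j h = convolution_unit \<epsilon> \<and> convolution \<Delta> h j = convolution_unit \<epsilon>)"

definition trivial_quantum_principal_bundle ::
    "('h::cq_superalgebra \<Rightarrow> ('h, 'h) tensor) \<Rightarrow> ('h \<Rightarrow> laurent)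
      \<Rightarrow> ('a::cq_superalgebra \<Rightarrow> ('a, 'h) tensor) \<Rightarrow> ('b::cq_superalgebra \<Rightarrow> 'a) \<Rightarrow> bool" where
  "trivial_quantum_principal_bundle \<Delta> \<epsilon> \<delta> \<iota> \<longleftrightarrow>
     quantum_principal_bundle \<Delta> \<epsilon> \<delta> \<iota> \<and> cleft \<Delta> \<epsilon> \<delta>"


section \<open>Quantum matrices\<close>

datatype col = C1 | C2
datatype row = R1 | R2 | R3 | R4 | R5 | R6

fun col_no :: "col \<Rightarrow> nat" where
  "col_no C1 = 1" | "col_no C2 = 2"

fun row_no :: "row \<Rightarrow> nat" where
  "row_no R1 = 1" | "row_no R2 = 2" | "row_no R3 = 3"
| "row_no R4 = 4" | "row_no R5 = 5" | "row_no R6 = 6"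

instantiation col :: linorder
begin
definition less_eq_col :: "col \<Rightarrow> col \<Rightarrow> bool" where "x \<le> y \<longleftrightarrow> col_no x \<le> col_no y"
definition less_col :: "col \<Rightarrow> col \<Rightarrow> bool" where "x < y \<longleftrightarrow> col_no x < col_no y"
instance
proof
  fix x y :: col
  show "x \<le> y \<Longrightarrow> y \<le> x \<Longrightarrow> x = y"
    by (cases x; cases y) (simp_all add: less_eq_col_def)
qed (auto simp: less_eq_col_def less_col_def)
end

instantiation row :: linorder
begin
definition less_eq_row :: "row \<Rightarrow> row \<Rightarrow> bool" where "x \<le> y \<longleftrightarrow> row_no x \<le> row_no y"
definition less_row :: "row \<Rightarrow> row \<Rightarrow> bool" where "x < y \<longleftrightarrow> row_no x < row_no y"
instance
proof
  fix x y :: row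
  show "x \<le> y \<Longrightarrow> y \<le> x \<Longrightarrow> x = y"
    by (cases x; cases y) (simp_all add: less_eq_row_def)
qed (auto simp: less_eq_row_def less_row_def)
end

text \<open>The Manin relations for a matrix \<open>a\<close> with two columns whose row \<open>i\<close> has parity \<open>p i\<close>,
  each written as a difference to be set to zero.\<close>

definition manin_relators ::
    "('i::linorder \<Rightarrow> nat) \<Rightarrow> ('i \<Rightarrow> col \<Rightarrow> 'r::cq_algebra) \<Rightarrow> 'r set" where
  "manin_relators p a =
     {a i C1 * a i C2 - ((-1) ^ p i * qpow ((-1) ^ (p i + 1))) *q (a i C2 * a i C1) | i. True}
   \<union> {a i j * a k j - ((-1) ^ (p i * p k) * qpow (-1)) *q (a k j * a i j) | i k j. i < k}
   \<union> {a i C2 * a k C1 - (-1) ^ (p i * p k) *q (a k C1 * a i C2) | i k. i < k}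
   \<union> {a i C1 * a k C2 - (-1) ^ (p i * p k) *q (a k C2 * a i C1)
        - ((-1) ^ (p i * p k) * (qpow (-1) - qpow 1)) *q (a k C1 * a i C2) | i k. i < k}"

definition quantum_minor :: "('i \<Rightarrow> col \<Rightarrow> 'r::cq_algebra) \<Rightarrow> 'i \<Rightarrow> 'i \<Rightarrow> 'r" where
  "quantum_minor a r s = a r C1 * a s C2 - qpow (-1) *q (a r C2 * a s C1)"

lemma manin_relators_cases [consumes 1, case_names row col anti diag]:
  assumes "r \<in> manin_relators p a"
  obtains i where "r = a i C1 * a i C2 - ((-1) ^ p i * qpow ((-1) ^ (p i + 1))) *q (a i C2 * a i C1)"
  | i k j where "i < k" "r = a i j * a k j - ((-1) ^ (p i * p k) * qpow (-1)) *q (a k j * a i j)"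
  | i k where "i < k" "r = a i C2 * a k C1 - (-1) ^ (p i * p k) *q (a k C1 * a i C2)"
  | i k where "i < k" "r = a i C1 * a k C2 - (-1) ^ (p i * p k) *q (a k C2 * a i C1)
        - ((-1) ^ (p i * p k) * (qpow (-1) - qpow 1)) *q (a k C1 * a i C2)"
  using assms unfolding manin_relators_def by blast

lemma manin_relators_intros:
  "a i C1 * a i C2 - ((-1) ^ p i * qpow ((-1) ^ (p i + 1))) *q (a i C2 * a i C1) \<in> manin_relators p a"
  "i < k \<Longrightarrow> a i j * a k j - ((-1) ^ (p i * p k) * qpow (-1)) *q (a k j * a i j) \<in> manin_relators p a"
  "i < k \<Longrightarrow> a i C2 * a k C1 - (-1) ^ (p i * p k) *q (a k C1 * a i C2) \<in> manin_relators p a"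
  "i < k \<Longrightarrow> a i C1 * a k C2 - (-1) ^ (p i * p k) *q (a k C2 * a i C1)
        - ((-1) ^ (p i * p k) * (qpow (-1) - qpow 1)) *q (a k C1 * a i C2) \<in> manin_relators p a"
  unfolding manin_relators_def by blast+

lemma homogeneous_diff: "homogeneous n x \<Longrightarrow> homogeneous n y \<Longrightarrow> homogeneous n (x - y)"
  by (auto simp: homogeneous_def even_part_diff)

lemma homogeneous_add: "homogeneous n x \<Longrightarrow> homogeneous n y \<Longrightarrow> homogeneous n (x + y)"
  by (auto simp: homogeneous_def even_part_add)

lemma homogeneous_scaleq: "homogeneous n x \<Longrightarrow> homogeneous n (c *q x)"
  by (auto simp: homogeneous_def even_part_scaleq)

lemma homogeneous_mult': "homogeneous m x \<Longrightarrow> homogeneous n y \<Longrightarrow> homogeneous (n + m) (x * y)"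
  for x y :: "'r::cq_superalgebra"
  using homogeneous_mult [of m x n y] by (simp add: add.commute)

lemma homogeneous_one: "homogeneous 0 (1 :: 'r::cq_superalgebra)"
  by (simp add: homogeneous_def)

lemma homogeneous_gen: "homogeneous (gparity g) (fgen g)"
proof -
  have "Rep_freealg (even_part (fgen g)) = Rep_freealg (if even (gparity g) then fgen g else 0)"
    by (simp add: even_part_freealg.rep_eq Rep_fgen zero_freealg.rep_eq wparity_def)
  then show ?thesis
    by (simp only: homogeneous_def Rep_freealg_inject)
qed

lemma homogeneous_minor:
  fixes a :: "'i \<Rightarrow> col \<Rightarrow> 'r::cq_superalgebra"
  assumes "\<And>i j. homogeneous (p i) (a i j)"
  shows "homogeneous (p r + p s) (quantum_minor a r s)"
  unfolding quantum_minor_def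
  by (intro homogeneous_diff homogeneous_scaleq homogeneous_mult assms)

lemma homogeneous_manin:
  fixes a :: "'i::linorder \<Rightarrow> col \<Rightarrow> 'r::cq_superalgebra"
  assumes hom: "\<And>i j. homogeneous (p i) (a i j)" and r: "r \<in> manin_relators p a"
  shows "\<exists>n. homogeneous n r"
proof -
  have 1: "homogeneous (p i + p k) (a i j * a k l)" "homogeneous (p i + p k) (a k l * a i j)" for i j k l
    by (intro homogeneous_mult homogeneous_mult' hom)+
  show ?thesis
    using r by (cases rule: manin_relators_cases) (simp_all only:, (rule exI homogeneous_diff homogeneous_scaleq 1)+)
qed

lemma free_lift_manin:
  fixes \<phi> :: "'g::graded_generators \<Rightarrow> 'r::cq_superalgebra"
  assumes "r \<in> manin_relators p a"
  shows "free_lift \<phi> r \<in> manin_relators p (\<lambda>i j. free_lift \<phi> (a i j))"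
  using assms manin_relators_intros [where a = "\<lambda>i j. free_lift \<phi> (a i j)" and p = p]
  by (cases rule: manin_relators_cases) (simp_all only: free_lift_simps)

lemma free_lift_minor:
  "free_lift \<phi> (quantum_minor a r s) = quantum_minor (\<lambda>i j. free_lift \<phi> (a i j)) r s"
  for a :: "_ \<Rightarrow> _ \<Rightarrow> 'g::graded_generators freealg"
  by (simp add: quantum_minor_def)

lemma tensor_mult_even: "homogeneous 0 y \<Longrightarrow> (x \<otimes> y) * (x' \<otimes> y') = (x * x') \<otimes> (y * y')"
  for x x' :: "'a::cq_superalgebra" and y y' :: "'b::cq_superalgebra"
  by (simp add: times_tensor_pure tensor_mult_def homogeneous_def odd_part_def)

text \<open>The matrix product \<open>a \<otimes> g\<close> with entries \<open>\<Sum>m. a i m \<otimes> g m j\<close>.\<close>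

definition matrix_tensor ::
    "('i \<Rightarrow> col \<Rightarrow> 'a::cq_module) \<Rightarrow> (col \<Rightarrow> col \<Rightarrow> 'h::cq_module) \<Rightarrow> 'i \<Rightarrow> col \<Rightarrow> ('a, 'h) tensor" where
  "matrix_tensor a g i j = (\<Sum>m\<in>{C1, C2}. a i m \<otimes> g m j)"

locale quantum_matrix_tensor =
  fixes p :: "'i::linorder \<Rightarrow> nat" and a :: "'i \<Rightarrow> col \<Rightarrow> 'a::cq_superalgebra"
    and g :: "col \<Rightarrow> col \<Rightarrow> 'h::cq_superalgebra"
  assumes a_rel: "manin_relators p a \<subseteq> {0}"
    and a_odd: "\<And>i j. odd (p i) \<Longrightarrow> a i j * a i j = 0"
    and a_hom: "\<And>i j. homogeneous (p i) (a i j)"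
    and g_rel: "manin_relators (\<lambda>_. 0) g \<subseteq> {0}"
    and g_hom: "\<And>i j. homogeneous 0 (g i j)"
begin

lemma g_simps:
  "g C1 C1 * g C1 C2 = qpow (-1) *q (g C1 C2 * g C1 C1)"
  "g C2 C1 * g C2 C2 = qpow (-1) *q (g C2 C2 * g C2 C1)"
  "g C1 j * g C2 j = qpow (-1) *q (g C2 j * g C1 j)"
  "g C1 C2 * g C2 C1 = g C2 C1 * g C1 C2"
  "g C1 C1 * g C2 C2 = g C2 C2 * g C1 C1 + (qpow (-1) - qpow 1) *q (g C2 C1 * g C1 C2)"
proof -
  have less: "C1 < C2" by (simp add: less_col_def)
  have 0: "r = 0" if "r \<in> manin_relators (\<lambda>_. 0) g" for r
    using g_rel that by blast
  note rel = manin_relators_intros [where a = g and p = "\<lambda>_. 0", THEN 0]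
  show "g C1 C1 * g C1 C2 = qpow (-1) *q (g C1 C2 * g C1 C1)"
    "g C2 C1 * g C2 C2 = qpow (-1) *q (g C2 C2 * g C2 C1)"
    using rel(1) [of C1] rel(1) [of C2] by simp_all
  show "g C1 j * g C2 j = qpow (-1) *q (g C2 j * g C1 j)"
    using rel(2) [OF less, of j] by simp
  show "g C1 C2 * g C2 C1 = g C2 C1 * g C1 C2"
    using rel(3) [OF less] by simp
  show "g C1 C1 * g C2 C2 = g C2 C2 * g C1 C1 + (qpow (-1) - qpow 1) *q (g C2 C1 * g C1 C2)"
    using rel(4) [OF less] by (simp add: diff_diff_add)
qed

lemma a_simps:
  shows "a i C1 * a i C2 = ((-1) ^ p i * qpow ((-1) ^ (p i + 1))) *q (a i C2 * a i C1)"
    and "i < k \<Longrightarrow> a i j * a k j = ((-1) ^ (p i * p k) * qpow (-1)) *q (a k j * a i j)"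
    and "i < k \<Longrightarrow> a i C2 * a k C1 = (-1) ^ (p i * p k) *q (a k C1 * a i C2)"
    and "i < k \<Longrightarrow> a i C1 * a k C2 = (-1) ^ (p i * p k) *q (a k C2 * a i C1)
        + ((-1) ^ (p i * p k) * (qpow (-1) - qpow 1)) *q (a k C1 * a i C2)"
proof -
  have 0: "r = 0" if "r \<in> manin_relators p a" for r
    using a_rel that by blast
  note rel = manin_relators_intros [where a = a and p = p, THEN 0]
  show "a i C1 * a i C2 = ((-1) ^ p i * qpow ((-1) ^ (p i + 1))) *q (a i C2 * a i C1)"
    using rel(1) by (simp only: right_minus_eq)
  assume "i < k"
  note rel = rel(2-) [OF this]
  show "a i j * a k j = ((-1) ^ (p i * p k) * qpow (-1)) *q (a k j * a i j)"
    using rel(1) by (simp only: right_minus_eq)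
  show "a i C2 * a k C1 = (-1) ^ (p i * p k) *q (a k C1 * a i C2)"
    using rel(2) by (simp only: right_minus_eq)
  show "a i C1 * a k C2 = (-1) ^ (p i * p k) *q (a k C2 * a i C1)
        + ((-1) ^ (p i * p k) * (qpow (-1) - qpow 1)) *q (a k C1 * a i C2)"
    using rel(3) by (simp only: right_minus_eq diff_diff_add)
qed

abbreviation b :: "'i \<Rightarrow> col \<Rightarrow> ('a, 'h) tensor" where
  "b \<equiv> matrix_tensor a g"

lemma b_hom: "homogeneous (p i) (b i j)"
  using a_hom [of i] g_hom
  by (auto simp: matrix_tensor_def homogeneous_def even_part_add even_part_pure odd_part_def split: if_splits)

lemma b_expand: "b i j * b k l = (\<Sum>m\<in>{C1, C2}. \<Sum>n\<in>{C1, C2}. (a i m * a k n) \<otimes> (g m j * g n l))"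
  by (simp add: matrix_tensor_def distrib_left distrib_right tensor_mult_even g_hom add_ac)

lemmas b_simps = b_expand tensor_simps algebra_simps

lemma inverse_simps:
  assumes "Q = qpow (-1)" "P = qpow 1"
  shows "Q * P = 1" "P * Q = 1" "Q * (P * c) = c" "P * (Q * c) = c"
  by (simp_all add: assms)

lemma b_row: "b i C1 * b i C2 = ((-1) ^ p i * qpow ((-1) ^ (p i + 1))) *q (b i C2 * b i C1)"
proof -
  define Q P where QP: "Q = qpow (-1)" "P = qpow 1"
  note g = g_simps [folded QP] and inv = inverse_simps [OF QP]
  show ?thesis
  proof (cases "even (p i)")
    case True
    then have "(-1) ^ p i * qpow ((-1) ^ (p i + 1)) = Q" by (simp add: QP)
    then show ?thesis
      using a_simps(1) [of i] by (simp add: b_simps g inv)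
  next
    case False
    then have "(-1) ^ p i * qpow ((-1) ^ (p i + 1)) = - P" by (simp add: QP)
    then show ?thesis
      using a_simps(1) [of i] False by (simp add: b_simps g inv a_odd)
  qed
qed

lemma
  assumes "i < k"
  shows b_col: "b i j * b k j = ((-1) ^ (p i * p k) * qpow (-1)) *q (b k j * b i j)"
    and b_anti: "b i C2 * b k C1 = (-1) ^ (p i * p k) *q (b k C1 * b i C2)"
    and b_diag: "b i C1 * b k C2 = (-1) ^ (p i * p k) *q (b k C2 * b i C1)
        + ((-1) ^ (p i * p k) * (qpow (-1) - qpow 1)) *q (b k C1 * b i C2)"
proof -
  define Q P where QP: "Q = qpow (-1)" "P = qpow 1"
  define s :: laurent where "s = (-1) ^ (p i * p k)"
  note rules = g_simps [folded QP] a_simps(2-) [OF assms, folded QP s_def] inverse_simps [OF QP]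
  show "b i j * b k j = ((-1) ^ (p i * p k) * qpow (-1)) *q (b k j * b i j)"
    unfolding QP [symmetric] s_def [symmetric] by (simp add: b_simps rules)
  show "b i C2 * b k C1 = (-1) ^ (p i * p k) *q (b k C1 * b i C2)"
    unfolding QP [symmetric] s_def [symmetric] by (simp add: b_simps rules)
  show "b i C1 * b k C2 = (-1) ^ (p i * p k) *q (b k C2 * b i C1)
        + ((-1) ^ (p i * p k) * (qpow (-1) - qpow 1)) *q (b k C1 * b i C2)"
    unfolding QP [symmetric] s_def [symmetric] by (simp add: b_simps rules)
qed

lemma b_rel: "manin_relators p b \<subseteq> {0}"
proof
  fix r assume "r \<in> manin_relators p b"
  then show "r \<in> {0}"
    by (cases rule: manin_relators_cases) (simp_all add: b_row b_col b_anti b_diag)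
qed

lemma b_odd:
  assumes "odd (p i)"
  shows "b i j * b i j = 0"
proof -
  define Q P where QP: "Q = qpow (-1)" "P = qpow 1"
  note g = g_simps(3) [folded QP] and inv = inverse_simps [OF QP]
  from assms have "(-1) ^ p i * qpow ((-1) ^ (p i + 1)) = - P" by (simp add: QP)
  then show ?thesis
    using a_simps(1) [of i] assms by (simp add: b_simps g inv a_odd)
qed

lemma b_minor:
  assumes "i < k" "even (p i)"
  shows "quantum_minor b i k = quantum_minor a i k \<otimes> quantum_minor g C1 C2"
proof -
  define Q P where QP: "Q = qpow (-1)" "P = qpow 1"
  have s: "(-1) ^ (p i * p k) = (1 :: laurent)" using assms(2) by simp
  note rules = g_simps [folded QP] a_simps(2-) [OF assms(1), unfolded s, folded QP] inverse_simps [OF QP]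
  show ?thesis
    unfolding quantum_minor_def QP [symmetric] by (simp add: b_simps rules)
qed

end


section \<open>The quantum group \<open>GL\<^sub>2\<close>\<close>

text \<open>\<open>Detinv\<close> is the inverse of the quantum determinant.\<close>

datatype gl2_gen = Gent col col | Detinv

instantiation gl2_gen :: graded_generators
begin
definition gparity_gl2_gen :: "gl2_gen \<Rightarrow> nat" where "gparity_gl2_gen x = 0"
instance ..
end

instantiation gl2_gen :: presentation
begin

definition relators_gl2_gen :: "gl2_gen freealg set" where
  "relators_gl2_gen =
     manin_relators (\<lambda>_. 0) (\<lambda>i j. fgen (Gent i j))
   \<union> {quantum_minor (\<lambda>i j. fgen (Gent i j)) C1 C2 * fgen Detinv - 1,
      fgen Detinv * quantum_minor (\<lambda>i j. fgen (Gent i j)) C1 C2 - 1}"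

instance
proof
  fix r :: "gl2_gen freealg"
  assume r: "r \<in> relators"
  have gen: "homogeneous 0 (fgen x)" for x :: gl2_gen
    using homogeneous_gen [of x] by (simp add: gparity_gl2_gen_def)
  have minor: "homogeneous 0 (quantum_minor (\<lambda>i j. fgen (Gent i j)) C1 C2)"
    using homogeneous_minor [of "\<lambda>_. 0" "\<lambda>i j. fgen (Gent i j)" C1 C2] gen by simp
  have "\<exists>n. homogeneous n r"
    using r unfolding relators_gl2_gen_def
  proof (elim UnE insertE emptyE)
    assume "r \<in> manin_relators (\<lambda>_. 0) (\<lambda>i j. fgen (Gent i j))"
    then show ?thesis by (rule homogeneous_manin [rotated]) (rule gen)
  qed (use homogeneous_diff [OF homogeneous_mult [OF minor gen [of Detinv]]]
      homogeneous_diff [OF homogeneous_mult [OF gen [of Detinv] minor]] homogeneous_one in auto)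
  then have "even_part r = r \<or> even_part r = 0"
    unfolding homogeneous_def by metis
  then show "\<exists>e. \<forall>w\<in>Poly_Mapping.keys (Rep_freealg r). even (sum_list (map gparity (letters w))) = e"
    by (rule homogeneous_monomials [THEN iffD1])
qed

end

type_synonym qgl2 = "gl2_gen presented"

definition gl2_entry :: "col \<Rightarrow> col \<Rightarrow> qgl2" where
  "gl2_entry i j = gen (Gent i j)"

definition gl2_comult :: "qgl2 \<Rightarrow> (qgl2, qgl2) tensor" where
  "gl2_comult = presented_lift
     (\<lambda>x. case x of Gent i j \<Rightarrow> matrix_tensor gl2_entry gl2_entry i j
                 | Detinv \<Rightarrow> gen Detinv \<otimes> gen Detinv)"

definition gl2_counit :: "qgl2 \<Rightarrow> laurent" where
  "gl2_counit = presented_lift (\<lambda>x. case x of Gent i j \<Rightarrow> if i = j then 1 else 0 | Detinv \<Rightarrow> 1)"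


section \<open>The quantum superalgebra \<open>\<complex>\<^sub>q[S]\<close> and the chiral Minkowski superspace\<close>

definition row_parity :: "row \<Rightarrow> nat" where
  "row_parity i = (if row_no i \<le> 4 then 0 else 1)"

datatype s_gen = Aent row col | D12inv

instantiation s_gen :: graded_generators
begin
definition gparity_s_gen :: "s_gen \<Rightarrow> nat" where
  "gparity_s_gen x = (case x of Aent i j \<Rightarrow> row_parity i | D12inv \<Rightarrow> 0)"
instance ..
end

instantiation s_gen :: presentation
begin

definition relators_s_gen :: "s_gen freealg set" where
  "relators_s_gen =
     manin_relators row_parity (\<lambda>i j. fgen (Aent i j))
   \<union> {fgen (Aent k l) * fgen (Aent k l) | k l. k \<in> {R5, R6}}
   \<union> {quantum_minor (\<lambda>i j. fgen (Aent i j)) R1 R2 * fgen D12inv - 1,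
      fgen D12inv * quantum_minor (\<lambda>i j. fgen (Aent i j)) R1 R2 - 1}"

instance
proof
  fix r :: "s_gen freealg"
  assume r: "r \<in> relators"
  have gen: "homogeneous (row_parity i) (fgen (Aent i j))" "homogeneous 0 (fgen D12inv)" for i j
    using homogeneous_gen [of "Aent i j"] homogeneous_gen [of D12inv] by (simp_all add: gparity_s_gen_def)
  have minor: "homogeneous 0 (quantum_minor (\<lambda>i j. fgen (Aent i j)) R1 R2)"
    using homogeneous_minor [of row_parity "\<lambda>i j. fgen (Aent i j)" R1 R2] gen by (simp add: row_parity_def)
  have "\<exists>n. homogeneous n r"
    using r unfolding relators_s_gen_def
  proof (elim UnE insertE emptyE)
    assume "r \<in> manin_relators row_parity (\<lambda>i j. fgen (Aent i j))"
    then show ?thesis by (rule homogeneous_manin [rotated]) (rule gen)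
  next
    assume "r \<in> {fgen (Aent k l) * fgen (Aent k l) | k l. k \<in> {R5, R6}}"
    then show ?thesis using homogeneous_mult [OF gen(1) gen(1)] by blast
  qed (use homogeneous_diff [OF homogeneous_mult [OF minor gen(2)]]
      homogeneous_diff [OF homogeneous_mult [OF gen(2) minor]] homogeneous_one in auto)
  then have "even_part r = r \<or> even_part r = 0"
    unfolding homogeneous_def by metis
  then show "\<exists>e. \<forall>w\<in>Poly_Mapping.keys (Rep_freealg r). even (sum_list (map gparity (letters w))) = e"
    by (rule homogeneous_monomials [THEN iffD1])
qed

end

type_synonym qS = "s_gen presented"

definition s_entry :: "row \<Rightarrow> col \<Rightarrow> qS" where
  "s_entry i j = gen (Aent i j)"

text \<open>The value on \<open>D\<^sub>1\<^sub>2\<^sup>-\<^sup>1\<close> is forced by \<open>D\<^sub>1\<^sub>2 \<mapsto> D\<^sub>1\<^sub>2 \<otimes> det\<close>.\<close>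

definition s_coaction :: "qS \<Rightarrow> (qS, qgl2) tensor" where
  "s_coaction = presented_lift
     (\<lambda>x. case x of Aent i j \<Rightarrow> matrix_tensor s_entry gl2_entry i j
                 | D12inv \<Rightarrow> gen D12inv \<otimes> gen Detinv)"

definition chiral_coord :: "row \<Rightarrow> col \<Rightarrow> qS" where
  "chiral_coord i j = (case j of
       C1 \<Rightarrow> (- qpow (-1)) *q (quantum_minor s_entry R2 i * gen D12inv)
     | C2 \<Rightarrow> quantum_minor s_entry R1 i * gen D12inv)"

inductive_set subsuperalgebra :: "'a::cq_superalgebra set \<Rightarrow> 'a set" for X where
  gen: "x \<in> X \<Longrightarrow> x \<in> subsuperalgebra X"
| one: "1 \<in> subsuperalgebra X"
| add: "x \<in> subsuperalgebra X \<Longrightarrow> y \<in> subsuperalgebra X \<Longrightarrow> x + y \<in> subsuperalgebra X"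
| mult: "x \<in> subsuperalgebra X \<Longrightarrow> y \<in> subsuperalgebra X \<Longrightarrow> x * y \<in> subsuperalgebra X"
| scaleq: "x \<in> subsuperalgebra X \<Longrightarrow> c *q x \<in> subsuperalgebra X"
| even_part: "x \<in> subsuperalgebra X \<Longrightarrow> even_part x \<in> subsuperalgebra X"

lemma subsuperalgebra_zero: "0 \<in> subsuperalgebra X"
  using subsuperalgebra.scaleq [OF subsuperalgebra.one, of 0] by simp

lemma subsuperalgebra_uminus: "x \<in> subsuperalgebra X \<Longrightarrow> - x \<in> subsuperalgebra X"
  using subsuperalgebra.scaleq [of x X "- 1"] by simp

lemma subsuperalgebra_diff:
  "x \<in> subsuperalgebra X \<Longrightarrow> y \<in> subsuperalgebra X \<Longrightarrow> x - y \<in> subsuperalgebra X"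
  using subsuperalgebra.add [of x X "- y"] subsuperalgebra_uminus [of y X] by simp

text \<open>Rows \<open>3, 4\<close> give the even coordinates \<open>u\<close>, rows \<open>5, 6\<close> the odd coordinates \<open>\<nu>\<close>.\<close>

definition chiral_subalgebra :: "qS set" where
  "chiral_subalgebra =
     subsuperalgebra ({chiral_coord i j | i j. i \<in> {R3, R4}} \<union> {chiral_coord k j | k j. k \<in> {R5, R6}})"

typedef chiral_minkowski = chiral_subalgebra
  morphisms chiral_incl Abs_chiral_minkowski
  unfolding chiral_subalgebra_def by (blast intro: subsuperalgebra.one)

setup_lifting type_definition_chiral_minkowski

instantiation chiral_minkowski :: cq_superalgebra
begin

lift_definition zero_chiral_minkowski :: chiral_minkowski is 0
  unfolding chiral_subalgebra_def by (rule subsuperalgebra_zero)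
lift_definition one_chiral_minkowski :: chiral_minkowski is 1
  unfolding chiral_subalgebra_def by (rule subsuperalgebra.one)
lift_definition plus_chiral_minkowski ::
  "chiral_minkowski \<Rightarrow> chiral_minkowski \<Rightarrow> chiral_minkowski" is "(+)"
  unfolding chiral_subalgebra_def by (rule subsuperalgebra.add)
lift_definition minus_chiral_minkowski ::
  "chiral_minkowski \<Rightarrow> chiral_minkowski \<Rightarrow> chiral_minkowski" is "(-)"
  unfolding chiral_subalgebra_def by (rule subsuperalgebra_diff)
lift_definition uminus_chiral_minkowski :: "chiral_minkowski \<Rightarrow> chiral_minkowski" is uminus
  unfolding chiral_subalgebra_def by (rule subsuperalgebra_uminus)
lift_definition times_chiral_minkowski ::
  "chiral_minkowski \<Rightarrow> chiral_minkowski \<Rightarrow> chiral_minkowski" is "(*)"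
  unfolding chiral_subalgebra_def by (rule subsuperalgebra.mult)
lift_definition scaleq_chiral_minkowski ::
  "laurent \<Rightarrow> chiral_minkowski \<Rightarrow> chiral_minkowski" is scaleq
  unfolding chiral_subalgebra_def by (rule subsuperalgebra.scaleq)
lift_definition even_part_chiral_minkowski :: "chiral_minkowski \<Rightarrow> chiral_minkowski" is even_part
  unfolding chiral_subalgebra_def by (rule subsuperalgebra.even_part)

instance
proof
  fix x y z :: chiral_minkowski and c d :: laurent
  show "x + y + z = x + (y + z)" by transfer (rule add.assoc)
  show "x + y = y + x" by transfer (rule add.commute)
  show "0 + x = x" by transfer simp
  show "- x + x = 0" by transfer simp
  show "x - y = x + - y" by transfer simp
  show "x * y * z = x * (y * z)" by transfer (rule mult.assoc)
  show "1 * x = x" by transfer simp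
  show "x * 1 = x" by transfer simp
  show "(x + y) * z = x * z + y * z" by transfer (rule distrib_right)
  show "x * (y + z) = x * y + x * z" by transfer (rule distrib_left)
  show "c *q (x + y) = c *q x + c *q y" by transfer (rule scaleq_add_right)
  show "(c + d) *q x = c *q x + d *q x" by transfer (rule scaleq_add_left)
  show "c *q d *q x = (c * d) *q x" by transfer (rule scaleq_scaleq)
  show "1 *q x = x" by transfer (rule scaleq_one)
  show "(c *q x) * y = c *q (x * y)" by transfer (rule scaleq_mult_left)
  show "x * (c *q y) = c *q (x * y)" by transfer (rule scaleq_mult_right)
  show "even_part (x + y) = even_part x + even_part y" by transfer (rule even_part_add)
  show "even_part (c *q x) = c *q even_part x" by transfer (rule even_part_scaleq)
  show "even_part (even_part x) = even_part x" by transfer (rule even_part_idem)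
  show "even_part (1 :: chiral_minkowski) = 1" by transfer (rule even_part_one)
  show "even_part (x * y) = even_part x * even_part y + (x - even_part x) * (y - even_part y)"
    by transfer (rule even_part_mult)
qed

end


section \<open>Well-definedness of the structure maps\<close>

lemma free_lift_fgen: "free_lift gen x = abs_presented x" for x :: "'g::presentation freealg"
proof -
  have word: "prod_list (map gen gs) = abs_presented (Abs_freealg (Poly_Mapping.single (Word gs) 1))"
    for gs :: "'g list"
  proof (induct gs)
    case Nil
    have "Poly_Mapping.single (Word []) 1 = (1 :: 'g word \<Rightarrow>\<^sub>0 laurent)"
      by (simp flip: zero_word_def)
    then show ?case by (simp add: one_presented_def one_freealg_def)
  next
    case (Cons g gs)
    have "Word (g # gs) = Word [g] + Word gs" by (simp add: plus_word_def)
    then have "Poly_Mapping.single (Word (g # gs)) 1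
        = Poly_Mapping.single (Word [g]) 1 * (Poly_Mapping.single (Word gs) 1 :: 'g word \<Rightarrow>\<^sub>0 laurent)"
      by (simp add: mult_single)
    then show ?case
      by (simp add: Cons gen_def [of g] fgen_def [of g] times_presented.abs_eq times_freealg.abs_eq eq_onp_def)
  qed
  have "free_lift gen (Abs_freealg p) = abs_presented (Abs_freealg p)" for p :: "'g word \<Rightarrow>\<^sub>0 laurent"
  proof (induct p rule: pm_induct)
    case (single w c)
    have "Poly_Mapping.single w c = pm_scale c (Poly_Mapping.single w 1)" by simp
    then show ?case
      by (cases w) (simp add: free_lift_def Abs_freealg_inverse word scaleq_presented.abs_eq
          scaleq_freealg.abs_eq eq_onp_def)
  next
    case (add p r)
    have "Abs_freealg (p + r) = Abs_freealg p + Abs_freealg r"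
      by (simp add: plus_freealg.abs_eq eq_onp_def)
    then show ?case by (simp add: add plus_presented.abs_eq)
  qed
  from this [of "Rep_freealg x"] show ?thesis by (simp add: Rep_freealg_inverse)
qed

lemma free_lift_relator: "r \<in> relators \<Longrightarrow> free_lift gen r = 0"
  by (simp add: free_lift_fgen zero_presented_def presented.abs_eq_iff presented_rel_def ideal_hull.base)

lemma homogeneous_gen': "homogeneous (gparity g) (gen g)"
  using homogeneous_gen [of g]
  by (auto simp: homogeneous_def gen_def even_part_presented.abs_eq zero_presented_def)

lemma manin_gen:
  fixes f :: "'i::linorder \<Rightarrow> col \<Rightarrow> 'g::presentation"
  assumes "manin_relators p (\<lambda>i j. fgen (f i j)) \<subseteq> relators"
  shows "manin_relators p (\<lambda>i j. gen (f i j)) \<subseteq> {0}"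
proof
  note rel = manin_relators_intros [where a = "\<lambda>i j. fgen (f i j)" and p = p,
      THEN subsetD [OF assms], THEN free_lift_relator, unfolded free_lift_simps free_lift_gen]
  fix r assume "r \<in> manin_relators p (\<lambda>i j. gen (f i j))"
  then show "r \<in> {0}"
    by (cases rule: manin_relators_cases) (simp_all only: rel singleton_iff)
qed

lemma manin_lift:
  assumes "manin_relators p (\<lambda>i j. \<phi> (f i j)) \<subseteq> {0}"
    and "r \<in> manin_relators p (\<lambda>i j. fgen (f i j))"
  shows "free_lift \<phi> r = 0"
  using free_lift_manin [OF assms(2), of \<phi>] assms(1) by auto

lemma gl2_manin: "manin_relators (\<lambda>_. 0) gl2_entry \<subseteq> {0}"
  unfolding gl2_entry_def by (rule manin_gen) (auto simp: relators_gl2_gen_def)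

lemma gl2_even: "homogeneous 0 (gl2_entry i j)" "homogeneous 0 (gen Detinv)"
  using homogeneous_gen' [of "Gent i j"] homogeneous_gen' [of Detinv]
  by (simp_all add: gl2_entry_def gparity_gl2_gen_def)

lemma gl2_det:
  "quantum_minor gl2_entry C1 C2 * gen Detinv = 1" "gen Detinv * quantum_minor gl2_entry C1 C2 = 1"
  using free_lift_relator [of "quantum_minor (\<lambda>i j. fgen (Gent i j)) C1 C2 * fgen Detinv - 1"]
    free_lift_relator [of "fgen Detinv * quantum_minor (\<lambda>i j. fgen (Gent i j)) C1 C2 - 1"]
  by (simp_all add: relators_gl2_gen_def free_lift_minor gl2_entry_def [abs_def])

lemma s_manin: "manin_relators row_parity s_entry \<subseteq> {0}"
  unfolding s_entry_def by (rule manin_gen) (auto simp: relators_s_gen_def)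

lemma s_parity: "homogeneous (row_parity i) (s_entry i j)" "homogeneous 0 (gen D12inv)"
  using homogeneous_gen' [of "Aent i j"] homogeneous_gen' [of D12inv]
  by (simp_all add: s_entry_def gparity_s_gen_def)

lemma s_odd: "odd (row_parity i) \<Longrightarrow> s_entry i j * s_entry i j = 0"
proof -
  assume "odd (row_parity i)"
  then have "i \<in> {R5, R6}" by (cases i) (simp_all add: row_parity_def)
  then have "fgen (Aent i j) * fgen (Aent i j) \<in> relators" by (auto simp: relators_s_gen_def)
  from free_lift_relator [OF this] show ?thesis by (simp add: s_entry_def)
qed

lemma s_D12:
  "quantum_minor s_entry R1 R2 * gen D12inv = 1" "gen D12inv * quantum_minor s_entry R1 R2 = 1"
  using free_lift_relator [of "quantum_minor (\<lambda>i j. fgen (Aent i j)) R1 R2 * fgen D12inv - 1"]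
    free_lift_relator [of "fgen D12inv * quantum_minor (\<lambda>i j. fgen (Aent i j)) R1 R2 - 1"]
  by (simp_all add: relators_s_gen_def free_lift_minor s_entry_def [abs_def])

interpretation gl2: quantum_matrix_tensor "\<lambda>_. 0" gl2_entry gl2_entry
  by standard (simp_all add: gl2_manin gl2_even)

interpretation s: quantum_matrix_tensor row_parity s_entry gl2_entry
  by standard (simp_all add: gl2_manin gl2_even s_manin s_odd s_parity)

lemma gl2_comult:
  "superalg_hom gl2_comult"
  "gl2_comult (gl2_entry i j) = matrix_tensor gl2_entry gl2_entry i j"
  "gl2_comult (gen Detinv) = gen Detinv \<otimes> gen Detinv"
proof -
  let ?\<phi> = "\<lambda>x. case x of Gent i j \<Rightarrow> matrix_tensor gl2_entry gl2_entry i j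
      | Detinv \<Rightarrow> gen Detinv \<otimes> gen Detinv"
  have minor: "quantum_minor (matrix_tensor gl2_entry gl2_entry) C1 C2
      = quantum_minor gl2_entry C1 C2 \<otimes> quantum_minor gl2_entry C1 C2"
    by (rule gl2.b_minor) (simp_all add: less_col_def)
  have even: "homogeneous 0 (quantum_minor gl2_entry C1 C2)"
    using homogeneous_minor [of "\<lambda>_. 0" gl2_entry C1 C2] gl2_even by simp
  have rel: "free_lift ?\<phi> r = 0" if "r \<in> relators" for r
    using that unfolding relators_gl2_gen_def
  proof (elim UnE insertE emptyE)
    assume "r \<in> manin_relators (\<lambda>_. 0) (\<lambda>i j. fgen (Gent i j))"
    then show ?thesis by (rule manin_lift [rotated]) (simp add: gl2.b_rel)
  qed (simp_all add: free_lift_minor minor tensor_mult_even even gl2_even gl2_det flip: one_tensor_def)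
  have hom: "homogeneous (gparity x) (?\<phi> x)" for x
    using gl2_even gl2.b_hom
    by (cases x) (simp_all add: gparity_gl2_gen_def homogeneous_def even_part_pure odd_part_def)
  show "superalg_hom gl2_comult"
    unfolding gl2_comult_def using rel hom by (rule presented_lift_hom)
  show "gl2_comult (gl2_entry i j) = matrix_tensor gl2_entry gl2_entry i j"
    "gl2_comult (gen Detinv) = gen Detinv \<otimes> gen Detinv"
    using presented_lift_gen [of ?\<phi>, OF rel] by (simp_all add: gl2_comult_def gl2_entry_def)
qed

lemma gl2_counit:
  "superalg_hom gl2_counit"
  "gl2_counit (gl2_entry i j) = (if i = j then 1 else 0)"
  "gl2_counit (gen Detinv) = 1"
proof -
  let ?\<phi> = "\<lambda>x. case x of Gent i j \<Rightarrow> if i = j then 1 else 0 | Detinv \<Rightarrow> (1 :: laurent)"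
  have rel: "free_lift ?\<phi> r = 0" if "r \<in> relators" for r
    using that unfolding relators_gl2_gen_def
  proof (elim UnE insertE emptyE)
    assume r: "r \<in> manin_relators (\<lambda>_. 0) (\<lambda>i j. fgen (Gent i j))"
    have "manin_relators (\<lambda>_. 0) (\<lambda>i j. if i = j then 1 else 0 :: laurent) \<subseteq> {0}"
    proof
      fix r :: laurent
      assume "r \<in> manin_relators (\<lambda>_. 0) (\<lambda>i j. if i = j then 1 else 0 :: laurent)"
      then show "r \<in> {0}"
      proof (cases rule: manin_relators_cases)
        case (row i)
        then show ?thesis by (cases i) simp_all
      next
        case (col i k j)
        then show ?thesis by (cases i; cases k; cases j) simp_all
      next
        case (anti i k)
        then show ?thesis by (cases i; cases k) (simp_all add: less_col_def)
      next
        case (diag i k)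
        then show ?thesis by (cases i; cases k) (simp_all add: less_col_def scaleq_laurent_def)
      qed
    qed
    then show ?thesis by (intro manin_lift [OF _ r]) simp
  qed (simp_all add: free_lift_minor, simp_all add: quantum_minor_def)
  have hom: "homogeneous (gparity x) (?\<phi> x)" for x
    by (simp add: gparity_gl2_gen_def homogeneous_def even_part_laurent_def)
  show "superalg_hom gl2_counit"
    unfolding gl2_counit_def using rel hom by (rule presented_lift_hom)
  show "gl2_counit (gl2_entry i j) = (if i = j then 1 else 0)" "gl2_counit (gen Detinv) = 1"
    using presented_lift_gen [of ?\<phi>, OF rel] by (simp_all add: gl2_counit_def gl2_entry_def)
qed

lemma s_coaction:
  "superalg_hom s_coaction"
  "s_coaction (s_entry i j) = matrix_tensor s_entry gl2_entry i j"
  "s_coaction (gen D12inv) = gen D12inv \<otimes> gen Detinv"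
proof -
  let ?\<phi> = "\<lambda>x. case x of Aent i j \<Rightarrow> matrix_tensor s_entry gl2_entry i j
      | D12inv \<Rightarrow> gen D12inv \<otimes> gen Detinv"
  have minor: "quantum_minor (matrix_tensor s_entry gl2_entry) R1 R2
      = quantum_minor s_entry R1 R2 \<otimes> quantum_minor gl2_entry C1 C2"
    by (rule s.b_minor) (simp_all add: less_row_def row_parity_def)
  have even: "homogeneous 0 (quantum_minor gl2_entry C1 C2)"
    using homogeneous_minor [of "\<lambda>_. 0" gl2_entry C1 C2] gl2_even by simp
  have rel: "free_lift ?\<phi> r = 0" if "r \<in> relators" for r
    using that unfolding relators_s_gen_def
  proof (elim UnE insertE emptyE)
    assume "r \<in> manin_relators row_parity (\<lambda>i j. fgen (Aent i j))"
    then show ?thesis by (rule manin_lift [rotated]) (simp add: s.b_rel)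
  next
    assume "r \<in> {fgen (Aent k l) * fgen (Aent k l) | k l. k \<in> {R5, R6}}"
    then obtain k l where "r = fgen (Aent k l) * fgen (Aent k l)" "k \<in> {R5, R6}" by blast
    then show ?thesis using s.b_odd [of k l] by (auto simp: row_parity_def)
  qed (simp_all add: free_lift_minor minor tensor_mult_even even gl2_even gl2_det s_D12 flip: one_tensor_def)
  have hom: "homogeneous (gparity x) (?\<phi> x)" for x
    using gl2_even s_parity s.b_hom
    by (cases x) (simp_all add: gparity_s_gen_def homogeneous_def even_part_pure odd_part_def)
  show "superalg_hom s_coaction"
    unfolding s_coaction_def using rel hom by (rule presented_lift_hom)
  show "s_coaction (s_entry i j) = matrix_tensor s_entry gl2_entry i j"
    "s_coaction (gen D12inv) = gen D12inv \<otimes> gen Detinv"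
    using presented_lift_gen [of ?\<phi>, OF rel] by (simp_all add: s_coaction_def s_entry_def)
qed

end

theory Submission
  imports Defs
begin

text \<open>The algebra map \<open>j : g\<^sub>i\<^sub>j \<mapsto> a\<^sub>i\<^sub>j\<close> for \<open>i, j \<in> {1, 2}\<close> is a cleaving map with
  convolution inverse \<open>j \<circ> S\<close>.  Let \<open>B\<close> be the chiral Minkowski superspace; its
  generators are coinvariant because minors are multiplied by the quantum determinant.  The rows
  \<open>3, \<dots>, 6\<close> of the generic matrix are combinations of the first two rows with coefficients
  in \<open>B\<close>, and the commutation rules between \<open>j (h)\<close> and these coefficients give
  \<open>A = B \<cdot> j (H)\<close>.  Everything can then be evaluated on products \<open>b j (h)\<close>: the map
  \<open>a \<mapsto> a\<^sub>0 j (S a\<^sub>1)\<close> sends \<open>b j (h)\<close> to \<open>\<epsilon> (h) b\<close>, so coinvariants lie in \<open>B\<close>; the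
  assignment \<open>b j (h) \<mapsto> b \<otimes> j (h)\<close> is a well-defined equivariant section; and
  \<open>x \<otimes> h \<mapsto> x j (S h\<^sub>1) \<otimes> j (h\<^sub>2)\<close> inverts the canonical map.\<close>

section \<open>Linear maps on tensor products\<close>

abbreviation linq :: "('a::cq_module \<Rightarrow> 'b::cq_module) \<Rightarrow> bool" where
  "linq \<equiv> module_hom scaleq scaleq"

lemma linqD:
  assumes "linq f"
  shows "f (x + y) = f x + f y" "f (c *q x) = c *q f x" "f 0 = 0" "f (x - y) = f x - f y" "f (- x) = - f x"
  using assms by (simp_all add: module_hom.add module_hom.scale module_hom.zero module_hom.diff module_hom.neg)

lemma linq_id: "linq (\<lambda>x. x)"
  by (rule module_hom_scaleqI) simp_all

lemma linq_compose: "linq f \<Longrightarrow> linq g \<Longrightarrow> linq (\<lambda>x. g (f x))"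
  by (rule module_hom_scaleqI) (simp_all add: linqD)

lemma linq_scaleq: "linq f \<Longrightarrow> linq (\<lambda>x. c *q f x)"
  by (rule module_hom_scaleqI) (simp_all add: linqD algebra_simps)

lemma linq_mult:
  fixes f :: "'b::cq_module \<Rightarrow> 'a::cq_algebra"
  shows "linq f \<Longrightarrow> linq (\<lambda>x. f x * y)" "linq f \<Longrightarrow> linq (\<lambda>x. y * f x)"
  by (rule module_hom_scaleqI; simp add: linqD algebra_simps scaleq_mult_left scaleq_mult_right)+

lemma linq_pure: "linq f \<Longrightarrow> linq (\<lambda>x. f x \<otimes> y)" "linq f \<Longrightarrow> linq (\<lambda>x. y \<otimes> f x)"
  by (rule module_hom_scaleqI; simp add: linqD tensor_simps)+

lemma linq_scaleq_left: "linq f \<Longrightarrow> linq (\<lambda>x. f x *q y)"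
  by (rule module_hom_scaleqI) (simp_all add: linqD algebra_simps scaleq_laurent_def)

lemma bilinearq_iff: "bilinearq f \<longleftrightarrow> (\<forall>y. linq (\<lambda>x. f x y)) \<and> (\<forall>x. linq (\<lambda>y. f x y))"
  by (simp add: bilinearq_def)

lemma linq_tensor_lift: "bilinearq f \<Longrightarrow> linq g \<Longrightarrow> linq (\<lambda>x. tensor_lift f (g x))"
  by (rule module_hom_scaleqI) (simp_all add: linqD tensor_lift_add tensor_lift_scaleq)

text \<open>Linearity in a parameter of the integrand rather than in the tensor. Together with
  \<open>linq_tensor_lift\<close> it lets \<open>linq_intros\<close> prove linearity of nested
  Sweedler sums.\<close>

lemma linq_tensor_lift_left:
  assumes "\<And>z. bilinearq (F z)" "\<And>x y. linq (\<lambda>z. F z x y)"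
  shows "linq (\<lambda>z. tensor_lift (F z) t)"
proof (induct t rule: tensor_induct)
  case (pure x y)
  show ?case using assms(2) by (simp add: tensor_lift_pure assms(1))
next
  case (add t u)
  show ?case
    by (intro module_hom_scaleqI)
      (simp_all add: tensor_lift_add assms(1) linqD [OF add(1)] linqD [OF add(2)] algebra_simps)
qed

lemmas linq_intros = linq_id linq_scaleq linq_mult linq_pure linq_scaleq_left
  linq_tensor_lift linq_tensor_lift_left

lemma tensor_lift_comp:
  assumes "linq g" "bilinearq f"
  shows "g (tensor_lift f t) = tensor_lift (\<lambda>x y. g (f x y)) t"
proof -
  have "bilinearq (\<lambda>x y. g (f x y))"
    using assms(2) by (auto simp: bilinearq_iff intro: linq_compose [OF _ assms(1)])
  then show ?thesis
    by (induct t rule: tensor_induct) (simp_all add: tensor_lift_pure tensor_lift_add linqD [OF assms(1)] assms(2))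
qed

lemma tensor_ext:
  assumes "linq f" "linq g" "\<And>x y. f (x \<otimes> y) = g (x \<otimes> y)"
  shows "f t = g t"
  by (induct t rule: tensor_induct) (simp_all add: assms linqD [OF assms(1)] linqD [OF assms(2)])

lemma bilinearq_map: "linq f \<Longrightarrow> linq g \<Longrightarrow> bilinearq (\<lambda>x y. f x \<otimes> g y)"
  by (simp add: bilinearq_iff linq_intros)

lemma tensor_map_pure: "linq f \<Longrightarrow> linq g \<Longrightarrow> tensor_map f g (x \<otimes> y) = f x \<otimes> g y"
  by (simp add: tensor_map_def tensor_lift_pure bilinearq_map)

lemma linq_tensor_map: "linq f \<Longrightarrow> linq g \<Longrightarrow> linq (tensor_map f g)"
  by (simp add: tensor_map_def [abs_def] linq_intros bilinearq_map)

lemma linq_id_const: "linq id" by (simp add: id_def linq_id)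

lemma tensor_lift_map:
  assumes "bilinearq F" "linq f" "linq g"
  shows "tensor_lift F (tensor_map f g t) = tensor_lift (\<lambda>x y. F (f x) (g y)) t"
  unfolding tensor_map_def
  by (rule tensor_lift_comp [where g = "tensor_lift F", THEN trans])
    (simp_all add: tensor_lift_pure assms bilinearq_map linq_tensor_lift linq_id)

lemma bilinearq_assoc:
  "bilinearq (\<lambda>x y. x \<otimes> (y \<otimes> z))" "bilinearq (\<lambda>t z. tensor_lift (\<lambda>x y. x \<otimes> (y \<otimes> z)) t)"
proof -
  show *: "bilinearq (\<lambda>x y. x \<otimes> (y \<otimes> z))" for z
    by (simp add: bilinearq_iff linq_intros)
  show "bilinearq (\<lambda>t z. tensor_lift (\<lambda>x y. x \<otimes> (y \<otimes> z)) t)"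
    by (simp add: bilinearq_iff linq_intros *)
qed

lemma tensor_assoc_pure: "tensor_assoc (t \<otimes> z) = tensor_lift (\<lambda>x y. x \<otimes> (y \<otimes> z)) t"
  by (simp add: tensor_assoc_def tensor_lift_pure bilinearq_assoc)

lemma tensor_assoc_pure3: "tensor_assoc ((x \<otimes> y) \<otimes> z) = x \<otimes> (y \<otimes> z)"
  by (simp add: tensor_assoc_pure tensor_lift_pure bilinearq_assoc)

lemma linq_tensor_assoc: "linq tensor_assoc"
  by (simp add: tensor_assoc_def [abs_def] linq_intros bilinearq_assoc)

lemma bilinearq_assoc':
  "bilinearq (\<lambda>y z. (x \<otimes> y) \<otimes> z)" "bilinearq (\<lambda>x. tensor_lift (\<lambda>y z. (x \<otimes> y) \<otimes> z))"
proof -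
  show *: "bilinearq (\<lambda>y z. (x \<otimes> y) \<otimes> z)" for x
    by (simp add: bilinearq_iff linq_intros)
  show "bilinearq (\<lambda>x. tensor_lift (\<lambda>y z. (x \<otimes> y) \<otimes> z))"
    by (simp add: bilinearq_iff linq_intros *)
qed

lemma tensor_assoc'_pure: "tensor_assoc' (x \<otimes> t) = tensor_lift (\<lambda>y z. (x \<otimes> y) \<otimes> z) t"
  by (simp add: tensor_assoc'_def tensor_lift_pure bilinearq_assoc')

lemma linq_tensor_assoc': "linq tensor_assoc'"
  by (simp add: tensor_assoc'_def [abs_def] linq_intros bilinearq_assoc')

lemma coassoc_lift:
  assumes "linq \<Delta>" "linq \<delta>"
    and coassoc: "tensor_assoc (tensor_map \<delta> id (\<delta> a)) = tensor_map id \<Delta> (\<delta> a)"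
    and K: "\<And>p q. linq (\<lambda>x. K x p q)" "\<And>x q. linq (\<lambda>p. K x p q)" "\<And>x p. linq (\<lambda>q. K x p q)"
  shows "tensor_lift (\<lambda>x q. tensor_lift (K x) (\<Delta> q)) (\<delta> a)
    = tensor_lift (\<lambda>x r. tensor_lift (\<lambda>y p. K y p r) (\<delta> x)) (\<delta> a)"
proof -
  have K1: "bilinearq (K x)" for x using K by (simp add: bilinearq_iff)
  have K2: "bilinearq (\<lambda>y p. K y p r)" for r using K by (simp add: bilinearq_iff)
  have G: "bilinearq (\<lambda>x. tensor_lift (K x))"
    using K by (simp add: bilinearq_iff linq_intros K1)
  define G where "G = tensor_lift (\<lambda>x. tensor_lift (K x))"
  have G': "linq G" using G by (simp add: G_def [abs_def] linq_intros)
  have "G (tensor_map id \<Delta> t) = tensor_lift (\<lambda>x q. tensor_lift (K x) (\<Delta> q)) t" for t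
    unfolding G_def using tensor_lift_map [OF G linq_id_const assms(1)] by simp
  moreover have "G (tensor_assoc (tensor_map \<delta> id t)) = tensor_lift (\<lambda>x r. tensor_lift (\<lambda>y p. K y p r) (\<delta> x)) t" for t
  proof (rule tensor_ext)
    show "linq (\<lambda>t. G (tensor_assoc (tensor_map \<delta> id t)))"
      by (intro linq_compose [OF _ G'] linq_compose [OF _ linq_tensor_assoc] linq_tensor_map assms linq_id_const)
    have *: "bilinearq (\<lambda>x r. tensor_lift (\<lambda>y p. K y p r) (\<delta> x))"
      using K K2 assms(2) by (simp add: bilinearq_iff linq_intros)
    then show "linq (tensor_lift (\<lambda>x r. tensor_lift (\<lambda>y p. K y p r) (\<delta> x)))"
      by (simp add: linq_intros)
    show "G (tensor_assoc (tensor_map \<delta> id (x \<otimes> r))) = tensor_lift (\<lambda>x r. tensor_lift (\<lambda>y p. K y p r) (\<delta> x)) (x \<otimes> r)" for x r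
      by (simp add: tensor_map_pure assms linq_id_const tensor_assoc_pure tensor_lift_pure * tensor_lift_comp [OF G'] bilinearq_assoc)
       (simp add: G_def tensor_lift_pure G K1)
  qed
  ultimately show ?thesis
    using coassoc by metis
qed

section \<open>Extensions spanned by the base and a cleaving homomorphism\<close>

lemma superalg_homD:
  assumes "superalg_hom f"
  shows "linq f" "f (x + y) = f x + f y" "f (c *q x) = c *q f x" "f 1 = 1" "f (x * y) = f x * f y"
    "f (even_part x) = even_part (f x)" "f 0 = 0" "f (x - y) = f x - f y" "f (- x) = - f x"
  using assms unfolding superalg_hom_def superlinear_def by (simp_all add: linqD)

lemma pure_one_mult: "(x \<otimes> 1) * (y \<otimes> z) = (x * y) \<otimes> z"
  for x y :: "'a::cq_superalgebra" and z :: "'b::cq_superalgebra"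
  by (simp add: times_tensor_pure tensor_mult_def odd_part_def)

text \<open>The abstract criterion behind the theorem. The base is only assumed to lie in the
  coinvariants, and \<open>spanned\<close> says that b \<otimes> h -> b j(h) maps B \<otimes> H onto
  A; equality with the coinvariants, bijectivity of the canonical map and the section follow. As
  \<open>j\<close> is multiplicative, \<open>j \<circ> S\<close> is its convolution inverse.\<close>

locale split_hopf_galois =
  fixes \<Delta> :: "'h::cq_superalgebra \<Rightarrow> ('h, 'h) tensor" and \<epsilon> :: "'h \<Rightarrow> laurent"
    and \<delta> :: "'a::cq_superalgebra \<Rightarrow> ('a, 'h) tensor" and \<iota> :: "'b::cq_superalgebra \<Rightarrow> 'a"
    and j :: "'h \<Rightarrow> 'a"
  assumes hopf: "hopf_superalgebra \<Delta> \<epsilon>" and comod: "comodule_superalgebra \<Delta> \<epsilon> \<delta>"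
    and \<iota>: "superalg_hom \<iota>" "inj \<iota>" "range \<iota> \<subseteq> coinvariants \<delta>"
    and j: "superalg_hom j" "\<And>y. \<delta> (j y) = tensor_map j id (\<Delta> y)"
    and spanned: "\<And>a. a \<in> cq.span {\<iota> c * j y | c y. True}"
begin

lemma spanned_induct [case_names mult add]:
  assumes "\<And>c y. Q (\<iota> c * j y)" "\<And>x y. Q x \<Longrightarrow> Q y \<Longrightarrow> Q (x + y)"
  shows "Q a"
  using spanned [of a]
proof (induct rule: cq.span_induct_alt)
  case base
  \<comment> \<open>Zero is itself a product, with both factors zero; in the next case the scalar is
    absorbed into the base factor.\<close>
  show ?case using assms(1) [of 0 0] superalg_homD(7) [OF \<iota>(1)] by simp
next
  case (step c x y)
  then obtain b h where "x = \<iota> b * j h" by blast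
  then have "c *q x = \<iota> (c *q b) * j h"
    by (simp add: superalg_homD [OF \<iota>(1)] scaleq_mult_left)
  with step assms show ?case by simp
qed

lemma spanned_ext: "linq f \<Longrightarrow> linq g \<Longrightarrow> (\<And>c y. f (\<iota> c * j y) = g (\<iota> c * j y)) \<Longrightarrow> f a = g a"
  by (induct a rule: spanned_induct) (simp_all add: linqD)

section \<open>The antipode and the convolution inverse of the cleaving map\<close>

definition S :: "'h \<Rightarrow> 'h" where
  "S = (SOME S. superlinear S \<and> convolution \<Delta> S id = convolution_unit \<epsilon>
          \<and> convolution \<Delta> id S = convolution_unit \<epsilon>)"

lemma S: "superlinear S" "tensor_lift (\<lambda>x y. S x * y) (\<Delta> z) = \<epsilon> z *q 1"
  "tensor_lift (\<lambda>x y. x * S y) (\<Delta> z) = \<epsilon> z *q 1"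
proof -
  have "\<exists>S. superlinear S \<and> convolution \<Delta> S id = convolution_unit \<epsilon>
      \<and> convolution \<Delta> id S = convolution_unit \<epsilon>"
    using hopf unfolding hopf_superalgebra_def by blast
  from someI_ex [OF this, folded S_def]
  show "superlinear S" "tensor_lift (\<lambda>x y. S x * y) (\<Delta> z) = \<epsilon> z *q 1"
    "tensor_lift (\<lambda>x y. x * S y) (\<Delta> z) = \<epsilon> z *q 1"
    by (simp_all add: convolution_def convolution_unit_def fun_eq_iff)
qed

lemma coalg:
  "superalg_hom \<Delta>" "superalg_hom \<epsilon>" "tensor_assoc (tensor_map \<Delta> id (\<Delta> x)) = tensor_map id \<Delta> (\<Delta> x)"
  "tensor_lift (\<lambda>y z. \<epsilon> y *q z) (\<Delta> x) = x" "tensor_lift (\<lambda>y z. \<epsilon> z *q y) (\<Delta> x) = x"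
  using hopf by (auto simp: hopf_superalgebra_def super_coalgebra_def)

lemma coact:
  "superalg_hom \<delta>" "tensor_assoc (tensor_map \<delta> id (\<delta> a)) = tensor_map id \<Delta> (\<delta> a)"
  using comod by (auto simp: comodule_superalgebra_def super_comodule_def)

lemma linear: "linq \<Delta>" "linq \<epsilon>" "linq \<delta>" "linq \<iota>" "linq j" "linq S"
  using S(1) superalg_homD(1) [OF coalg(1)] superalg_homD(1) [OF coalg(2)] superalg_homD(1) [OF coact(1)]
    superalg_homD(1) [OF \<iota>(1)] superalg_homD(1) [OF j(1)]
  by (simp_all add: superlinear_def)

lemmas linear_comp = linear [THEN linq_compose [rotated]] linear
lemmas lin = linq_intros linear_comp bilinearq_iff

text \<open>The antipode identity is evaluated at 1, whose comultiplication is 1 \<otimes>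
  1.\<close>

lemma S_one: "S 1 = 1"
  using S(2) [of 1] superalg_homD(4) [OF coalg(1)] superalg_homD(4) [OF coalg(2)]
  by (simp add: one_tensor_def tensor_lift_pure lin)

lemma j_S: "tensor_lift (\<lambda>p q. j (S p) * j q) (\<Delta> y) = \<epsilon> y *q 1"
  "tensor_lift (\<lambda>p q. j p * j (S q)) (\<Delta> y) = \<epsilon> y *q 1"
  using arg_cong [OF S(2) [of y], of j] arg_cong [OF S(3) [of y], of j]
  by (simp_all add: tensor_lift_comp [OF linear(5)] lin superalg_homD [OF j(1)])

lemma cleft: "cleft \<Delta> \<epsilon> \<delta>"
  unfolding cleft_def comodule_map_def convolution_def convolution_unit_def fun_eq_iff
  using j S by (intro exI [of _ j] exI [of _ "\<lambda>x. j (S x)"])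
    (simp add: j_S superlinear_def superalg_hom_def linear linear_comp)

text \<open>By \<open>coact_mult\<close> below, the coaction on a product b j(y) has the form
  treated here with \<open>\<Delta> y\<close> for \<open>t\<close>. The rule thus turns a Sweedler
  sum over that coaction into one over \<open>\<Delta> y\<close>.\<close>

lemma tensor_lift_j:
  assumes "bilinearq F"
  shows "tensor_lift F ((x \<otimes> 1) * tensor_map j id t) = tensor_lift (\<lambda>p q. F (x * j p) q) t"
proof -
  have *: "bilinearq (\<lambda>p q. F (x * j p) q)"
    by (rule bilinearqI)
      (simp_all add: bilinearqD [OF assms] distrib_left scaleq_mult_right superalg_homD [OF j(1)])
  show ?thesis
    by (rule tensor_ext [where t = t and f = "\<lambda>t. tensor_lift F ((x \<otimes> 1) * tensor_map j id t)"])
      (simp_all add: linq_intros linq_tensor_map linear linq_id_const tensor_map_pure pure_one_mult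
        tensor_lift_pure assms *)
qed

lemma coact_mult: "\<delta> (\<iota> c * j y) = (\<iota> c \<otimes> 1) * tensor_map j id (\<Delta> y)"
proof -
  have "\<iota> c \<in> coinvariants \<delta>" using \<iota>(3) by blast
  then show ?thesis by (simp add: superalg_homD [OF coact(1)] j(2) coinvariants_def)
qed

section \<open>The projection onto the base and the coinvariants\<close>

definition P :: "'a \<Rightarrow> 'a" where
  "P a = tensor_lift (\<lambda>x h. x * j (S h)) (\<delta> a)"

lemma linear_P: "linq P"
  unfolding P_def [abs_def] by (simp add: lin)

text \<open>The coaction turns b j(y) into the sum of b j(y_1) \<otimes> y_2, and j(y_1) j(S y_2)
  collapses to the counit.\<close>

lemma P_mult: "P (\<iota> c * j y) = \<iota> (\<epsilon> y *q c)"
proof -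
  have "P (\<iota> c * j y) = \<iota> c * tensor_lift (\<lambda>p q. j p * j (S q)) (\<Delta> y)"
    unfolding P_def coact_mult
    by (subst tensor_lift_j, simp add: lin, subst tensor_lift_comp [where g = "\<lambda>z. \<iota> c * z"])
      (simp_all add: lin mult.assoc)
  then show ?thesis
    by (simp add: j_S scaleq_mult_right superalg_homD [OF \<iota>(1)])
qed

lemma P_range: "P a \<in> range \<iota>"
proof (induct a rule: spanned_induct)
  case (add x y)
  then show ?case by (auto simp: linqD [OF linear_P] simp flip: superalg_homD(2) [OF \<iota>(1)])
qed (simp add: P_mult)

text \<open>This is \<open>P\<close> with its codomain cut down to the base; by
  \<open>P_range\<close>, \<open>inv \<iota>\<close> is only applied to values of
  \<open>\<iota>\<close>.\<close>

definition R :: "'a \<Rightarrow> 'b" where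
  "R a = inv \<iota> (P a)"

lemma \<iota>_R: "\<iota> (R a) = P a"
  using P_range by (simp add: R_def f_inv_into_f)

lemma linear_R: "linq R"
proof (rule module_hom_scaleqI; rule injD [OF \<iota>(2)])
qed (simp_all add: \<iota>_R superalg_homD [OF \<iota>(1)] linqD [OF linear_P])

lemma R_mult: "R (\<iota> c * j y) = \<epsilon> y *q c"
  by (rule injD [OF \<iota>(2)]) (simp add: \<iota>_R P_mult)

text \<open>\<open>P\<close> fixes every coinvariant because \<open>S 1 = 1\<close>, and its values
  lie in the base.\<close>

lemma coinvariants: "range \<iota> = coinvariants \<delta>"
proof (intro equalityI subsetI)
  fix x assume "x \<in> coinvariants \<delta>"
  then have "P x = x"
    by (simp add: P_def coinvariants_def tensor_lift_pure lin S_one superalg_homD [OF j(1)])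
  then show "x \<in> range \<iota>" using P_range [of x] by simp
qed (use \<iota>(3) in blast)

section \<open>The equivariant section\<close>

definition s :: "'a \<Rightarrow> ('b, 'a) tensor" where
  "s a = tensor_lift (\<lambda>x h. R x \<otimes> j h) (\<delta> a)"

lemma linear_s: "linq s"
  unfolding s_def [abs_def] by (simp add: lin linear_R linear_R [THEN linq_compose [rotated]])

text \<open>As \<open>s\<close> is given on all of A by a closed formula, this computation makes b
  j(y) -> b \<otimes> j(y) well defined without any appeal to uniqueness of such representations. It
  reduces to the counit law.\<close>

lemma s_mult: "s (\<iota> c * j y) = c \<otimes> j y"
proof -
  have "s (\<iota> c * j y) = tensor_lift (\<lambda>p q. (\<epsilon> p *q c) \<otimes> j q) (\<Delta> y)"
    unfolding s_def coact_mult
    by (subst tensor_lift_j) (simp_all add: lin linear_R linear_R [THEN linq_compose [rotated]] R_mult)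
  also have "\<dots> = c \<otimes> j (tensor_lift (\<lambda>p q. \<epsilon> p *q q) (\<Delta> y))"
    by (subst tensor_lift_comp [where g = "\<lambda>z. c \<otimes> j z"])
      (simp_all add: lin tensor_simps linqD [OF linear(5)])
  finally show ?thesis by (simp add: coalg)
qed

text \<open>Apart from linearity, every condition is an equation additive in \<open>x\<close>, so it
  is checked on products, where \<open>s_mult\<close> evaluates \<open>s\<close>.\<close>

lemma equivariantly_projective: "equivariantly_projective \<delta> \<iota>"
  unfolding equivariantly_projective_def comodule_map_def superlinear_def
proof (intro exI [of _ s] conjI allI)
  show "linq s" by (rule linear_s)
  fix x
  show "s (even_part x) = even_part (s x)"
  proof (induct x rule: spanned_induct)
    case (mult c y)
    \<comment> \<open>The even part of a product is again a sum of products of base elements and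
      values of \<open>j\<close>, so \<open>s_mult\<close> applies to each summand.\<close>
    have "even_part (\<iota> c * j y) = \<iota> (even_part c) * j (even_part y) + \<iota> (odd_part c) * j (odd_part y)"
      by (simp add: even_part_mult superalg_homD [OF \<iota>(1)] superalg_homD [OF j(1)] odd_part_def)
    then have "s (even_part (\<iota> c * j y)) = even_part c \<otimes> j (even_part y) + odd_part c \<otimes> j (odd_part y)"
      by (simp only: linqD [OF linear_s] s_mult)
    then show ?case
      by (simp add: s_mult even_part_pure superalg_homD [OF j(1)] odd_part_def)
  qed (simp add: linqD [OF linear_s] even_part_add)
  show "tensor_assoc' (tensor_map id \<delta> (s x)) = tensor_map s id (\<delta> x)"
  proof (induct x rule: spanned_induct)
    case (mult c y)
    have "tensor_assoc' (tensor_map id \<delta> (s (\<iota> c * j y)))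
        = tensor_lift (\<lambda>p q. (c \<otimes> j p) \<otimes> q) (\<Delta> y)"
      by (simp add: s_mult tensor_map_pure linq_id_const linear tensor_assoc'_pure j(2) tensor_lift_map bilinearq_assoc')
    also have "\<dots> = tensor_map s id (\<delta> (\<iota> c * j y))"
      unfolding tensor_map_def [of s] coact_mult
      by (subst tensor_lift_j) (simp_all add: lin linear_s linear_s [THEN linq_compose [rotated]] s_mult)
    finally show ?case .
  qed (simp only: linqD [OF linear_s] linqD [OF linear(3)] linqD [OF linq_tensor_assoc']
      linqD [OF linq_tensor_map [OF linq_id_const linear(3)]] linqD [OF linq_tensor_map [OF linear_s linq_id_const]])
  show "s (\<iota> b * x) = tensor_map ((*) b) id (s x)" for b
  proof (induct x rule: spanned_induct)
    case (mult c y)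
    have "\<iota> b * (\<iota> c * j y) = \<iota> (b * c) * j y"
      by (simp add: superalg_homD [OF \<iota>(1)] mult.assoc)
    then show ?case
      by (simp add: s_mult tensor_map_pure lin linq_id_const)
  qed (simp only: distrib_left linqD [OF linear_s]
      linqD [OF linq_tensor_map [OF linq_mult(2) [OF linq_id] linq_id_const]])
  show "tensor_lift (\<lambda>b y. \<iota> b * y) (s x) = x"
  proof (rule spanned_ext [OF _ linq_id])
    show "linq (\<lambda>x. tensor_lift (\<lambda>b y. \<iota> b * y) (s x))" by (simp add: lin linear_s)
  qed (simp add: s_mult tensor_lift_pure lin)
qed

section \<open>The inverse of the canonical map\<close>

definition \<psi> :: "('a, 'h) tensor \<Rightarrow> ('a, 'a) tensor" where
  "\<psi> = tensor_lift (\<lambda>x h. tensor_lift (\<lambda>p q. (x * j (S p)) \<otimes> j q) (\<Delta> h))"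

lemma bilinear_\<psi>: "bilinearq (\<lambda>p q. (x * j (S p)) \<otimes> j q)"
  "bilinearq (\<lambda>x h. tensor_lift (\<lambda>p q. (x * j (S p)) \<otimes> j q) (\<Delta> h))"
  by (simp_all add: lin)

lemma linear_\<psi>: "linq \<psi>"
  unfolding \<psi>_def [abs_def] by (simp add: linq_intros bilinear_\<psi>)

lemma \<psi>_pure: "\<psi> (x \<otimes> h) = tensor_lift (\<lambda>p q. (x * j (S p)) \<otimes> j q) (\<Delta> h)"
  by (simp add: \<psi>_def tensor_lift_pure bilinear_\<psi>)

lemmas linear_canonical = canonical_lift_hom [OF coact(1)]

lemma left_mult_tensor_map: "(x \<otimes> 1) * tensor_map j id t = tensor_lift (\<lambda>p q. (x * j p) \<otimes> q) t"
  by (rule tensor_ext)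
    (simp_all add: lin linq_tensor_map linq_id_const tensor_map_pure pure_one_mult tensor_lift_pure)

text \<open>On x \<otimes> h the left side is x j(S h_1) j(h_2) \<otimes> h_3. Coassociativity
  groups h_1 with h_2, and the antipode law collapses them to the counit.\<close>

lemma canonical_\<psi>: "canonical_lift \<delta> (\<psi> t) = t"
proof (rule tensor_ext)
  fix x h
  have "canonical_lift \<delta> (\<psi> (x \<otimes> h))
      = tensor_lift (\<lambda>p q. tensor_lift (\<lambda>q1 q2. (x * j (S p) * j q1) \<otimes> q2) (\<Delta> q)) (\<Delta> h)"
    by (simp add: \<psi>_pure tensor_lift_comp [OF linear_canonical] bilinear_\<psi> canonical_lift_pure coact j
        left_mult_tensor_map)
  also have "\<dots> = tensor_lift (\<lambda>p r. tensor_lift (\<lambda>p1 p2. (x * j (S p1) * j p2) \<otimes> r) (\<Delta> p)) (\<Delta> h)"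
    by (rule coassoc_lift [OF linear(1) linear(1) coalg(3)]) (simp_all add: lin)
  also have "\<dots> = tensor_lift (\<lambda>p r. x \<otimes> (\<epsilon> p *q r)) (\<Delta> h)"
  proof -
    have *: "tensor_lift (\<lambda>p1 p2. (x * j (S p1) * j p2) \<otimes> r) (\<Delta> p) = x \<otimes> (\<epsilon> p *q r)" for p r
      using arg_cong [OF j_S(1) [of p], of "\<lambda>z. (x * z) \<otimes> r"]
      by (subst (asm) tensor_lift_comp [where g = "\<lambda>z. (x * z) \<otimes> r"])
        (simp_all add: lin mult.assoc scaleq_mult_right tensor_simps)
    show ?thesis by (simp only: *)
  qed
  also have "\<dots> = x \<otimes> h"
    by (subst tensor_lift_comp [where g = "\<lambda>z. x \<otimes> z", symmetric]) (simp_all add: lin coalg)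
  finally show "canonical_lift \<delta> (\<psi> (x \<otimes> h)) = x \<otimes> h" .
qed (simp_all add: linq_compose [OF linear_\<psi> linear_canonical] linq_id)

text \<open>The result differs from the argument by a single balancing relation, which moves
  \<open>\<iota> c\<close> to the left factor. Hence \<open>\<psi>\<close>, which produces
  representatives in A \<otimes> A, is a left inverse of the canonical map on classes.\<close>

lemma \<psi>_canonical: "\<psi> (canonical_lift \<delta> (x \<otimes> (\<iota> c * j y))) = (x * \<iota> c) \<otimes> j y"
proof -
  have "\<psi> (canonical_lift \<delta> (x \<otimes> (\<iota> c * j y))) = \<psi> (tensor_lift (\<lambda>p q. (x * \<iota> c * j p) \<otimes> q) (\<Delta> y))"
    by (simp add: canonical_lift_pure coact coact_mult pure_one_mult flip: mult.assoc left_mult_tensor_map)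
  also have "\<dots> = tensor_lift (\<lambda>p q. tensor_lift (\<lambda>q1 q2. (x * \<iota> c * j p * j (S q1)) \<otimes> j q2) (\<Delta> q)) (\<Delta> y)"
    by (subst tensor_lift_comp [OF linear_\<psi>]) (simp_all add: lin \<psi>_pure)
  also have "\<dots> = tensor_lift (\<lambda>p r. tensor_lift (\<lambda>p1 p2. (x * \<iota> c * j p1 * j (S p2)) \<otimes> j r) (\<Delta> p)) (\<Delta> y)"
    by (rule coassoc_lift [OF linear(1) linear(1) coalg(3)]) (simp_all add: lin)
  also have "\<dots> = tensor_lift (\<lambda>p r. (x * \<iota> c) \<otimes> j (\<epsilon> p *q r)) (\<Delta> y)"
  proof -
    have *: "tensor_lift (\<lambda>p1 p2. (x * \<iota> c * j p1 * j (S p2)) \<otimes> j r) (\<Delta> p) = (x * \<iota> c) \<otimes> j (\<epsilon> p *q r)" for p r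
      using arg_cong [OF j_S(2) [of p], of "\<lambda>z. (x * \<iota> c * z) \<otimes> j r"]
      by (subst (asm) tensor_lift_comp [where g = "\<lambda>z. (x * \<iota> c * z) \<otimes> j r"])
        (simp_all add: lin mult.assoc scaleq_mult_right tensor_simps linqD [OF linear(5)])
    show ?thesis by (simp only: *)
  qed
  also have "\<dots> = (x * \<iota> c) \<otimes> j y"
    by (subst tensor_lift_comp [where g = "\<lambda>z. (x * \<iota> c) \<otimes> j z", symmetric]) (simp_all add: lin coalg)
  finally show ?thesis .
qed

abbreviation "balanced \<equiv> cq.span {(x * \<iota> b) \<otimes> y - x \<otimes> (\<iota> b * y) | x b y. True}"

lemma \<psi>_canonical_balanced: "\<psi> (canonical_lift \<delta> t) - t \<in> balanced"
proof (induct t rule: tensor_induct)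
  case (pure x y)
  show ?case
  proof (induct y rule: spanned_induct)
    case (mult c y)
    show ?case unfolding \<psi>_canonical by (rule cq.span_base) blast
  next
    case (add y z)
    from cq.span_add [OF add] show ?case
      by (simp add: tensor_add_right linqD [OF linear_canonical] linqD [OF linear_\<psi>] algebra_simps)
  qed
next
  case (add t u)
  from cq.span_add [OF add] show ?case
    by (simp add: linqD [OF linear_canonical] linqD [OF linear_\<psi>] algebra_simps)
qed

lemma bij_canonical: "bij_betw (canonical_map \<delta>) (balanced_tensor \<iota>) UNIV"
proof (rule bij_betw_imageI)
  note cls = canonical_map_class [OF coact(1) \<iota>(3)]
  show "inj_on (canonical_map \<delta>) (balanced_tensor \<iota>)"
  proof (rule inj_onI)
    fix X Y assume "X \<in> balanced_tensor \<iota>" "Y \<in> balanced_tensor \<iota>"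
      and eq: "canonical_map \<delta> X = canonical_map \<delta> Y"
    then obtain t u where X: "X = balanced_rel \<iota> `` {t}" and Y: "Y = balanced_rel \<iota> `` {u}"
      by (auto simp: balanced_tensor_def elim!: quotientE)
    with eq have "canonical_lift \<delta> t = canonical_lift \<delta> u" by (simp add: cls)
    \<comment> \<open>The two values of \<open>\<psi>\<close> agree and cancel in the difference,
      leaving \<open>t - u\<close>.\<close>
    with cq.span_diff [OF \<psi>_canonical_balanced [of u] \<psi>_canonical_balanced [of t]]
    have tu: "t - u \<in> balanced" by simp
    have "t - v \<in> balanced \<longleftrightarrow> u - v \<in> balanced" for v
      using cq.span_add [OF tu, of "u - v"] cq.span_diff [OF _ tu, of "t - v"] by auto
    then show "X = Y" by (auto simp: X Y balanced_rel_def)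
  qed
  show "canonical_map \<delta> ` balanced_tensor \<iota> = UNIV"
  proof (intro equalityI subsetI UNIV_I)
    fix t
    have "canonical_map \<delta> (balanced_rel \<iota> `` {\<psi> t}) = t" by (simp add: cls canonical_\<psi>)
    moreover have "balanced_rel \<iota> `` {\<psi> t} \<in> balanced_tensor \<iota>"
      by (simp add: balanced_tensor_def quotientI)
    ultimately show "t \<in> canonical_map \<delta> ` balanced_tensor \<iota>" by (metis imageI)
  qed
qed

theorem trivial_bundle: "trivial_quantum_principal_bundle \<Delta> \<epsilon> \<delta> \<iota>"
  using hopf comod \<iota> coinvariants bij_canonical equivariantly_projective cleft
  unfolding trivial_quantum_principal_bundle_def quantum_principal_bundle_def hopf_galois_extension_def
  by blast

end

section \<open>Homomorphisms of superalgebras\<close>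

lemma superalg_homI:
  assumes "\<And>x y. f (x + y) = f x + f y" "\<And>c x. f (c *q x) = c *q f x" "f 1 = 1"
    "\<And>x y. f (x * y) = f x * f y" "\<And>x. f (even_part x) = even_part (f x)"
  shows "superalg_hom f"
  using assms by (simp add: superalg_hom_def superlinear_def module_hom_scaleqI)

lemma superalg_hom_compose: "superalg_hom f \<Longrightarrow> superalg_hom g \<Longrightarrow> superalg_hom (\<lambda>x. g (f x))"
  by (rule superalg_homI) (simp_all add: superalg_homD)

lemma superalg_hom_id: "superalg_hom id"
  by (rule superalg_homI) simp_all

lemma superalg_hom_odd_part: "superalg_hom f \<Longrightarrow> f (odd_part x) = odd_part (f x)"
  by (simp add: odd_part_def superalg_homD)

text \<open>Multiplicativity is tested on homogeneous pure tensors, where the sign in the product is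
  a single power of -1.\<close>

lemma superalg_hom_tensorI:
  fixes f :: "('a::cq_superalgebra, 'b::cq_superalgebra) tensor \<Rightarrow> 'c::cq_superalgebra"
  assumes f: "linq f" and "f 1 = 1"
    and mult: "\<And>m n m' n' x y x' y'. homogeneous m x \<Longrightarrow> homogeneous n y \<Longrightarrow> homogeneous m' x' \<Longrightarrow>
      homogeneous n' y' \<Longrightarrow> f ((x \<otimes> y) * (x' \<otimes> y')) = f (x \<otimes> y) * f (x' \<otimes> y')"
    and even: "\<And>x y. f (even_part (x \<otimes> y)) = even_part (f (x \<otimes> y))"
  shows "superalg_hom f"
proof (rule superalg_homI)
  fix t u
  show "f (t * u) = f t * f u"
  proof (induct t rule: tensor_induct_homogeneous)
    case t: (pure m n x y)
    show ?case
    proof (induct u rule: tensor_induct_homogeneous)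
      case u: (pure m' n' x' y')
      show ?case by (rule mult [OF t u])
    qed (simp add: linqD [OF f] algebra_simps)
  qed (simp add: linqD [OF f] algebra_simps)
  show "f (even_part t) = even_part (f t)"
    by (induct t rule: tensor_induct) (simp_all add: even linqD [OF f] even_part_add)
qed (simp_all add: assms linqD [OF f])

lemma superalg_hom_tensor_map:
  assumes f: "superalg_hom f" and g: "superalg_hom g"
  shows "superalg_hom (tensor_map f g)"
proof (rule superalg_hom_tensorI)
  note [simp] = superalg_homD [OF f] superalg_homD [OF g] superalg_hom_odd_part [OF f]
    superalg_hom_odd_part [OF g] tensor_map_pure
  note lin = linq_tensor_map [OF superalg_homD(1) [OF f] superalg_homD(1) [OF g]]
  show "linq (tensor_map f g)" by (rule lin)
  show "tensor_map f g 1 = 1" by (simp add: one_tensor_def)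
  show "tensor_map f g ((x \<otimes> y) * (x' \<otimes> y')) = tensor_map f g (x \<otimes> y) * tensor_map f g (x' \<otimes> y')" for x y x' y'
    by (simp add: times_tensor_pure tensor_mult_def linqD [OF lin])
  show "tensor_map f g (even_part (x \<otimes> y)) = even_part (tensor_map f g (x \<otimes> y))" for x y
    by (simp add: even_part_pure linqD [OF lin])
qed

lemma homogeneous_pure:
  assumes "homogeneous m x" "homogeneous n y"
  shows "homogeneous (m + n) (x \<otimes> y)"
  using assms by (auto simp: homogeneous_def even_part_pure odd_part_def)

text \<open>Both bracketings give the same sign on homogeneous triples: the middle factor passes the
  first factor of the second triple, and the last one passes its first two.\<close>

lemma superalg_hom_tensor_assoc:
  "superalg_hom (tensor_assoc :: (('a::cq_superalgebra, 'b::cq_superalgebra) tensor, 'c::cq_superalgebra) tensor \<Rightarrow> _)"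
proof (rule superalg_hom_tensorI [OF linq_tensor_assoc])
  note lin = linqD [OF linq_tensor_assoc]
  show "tensor_assoc 1 = 1" by (simp add: one_tensor_def tensor_assoc_pure3)
  show "tensor_assoc (even_part (t \<otimes> z)) = even_part (tensor_assoc (t \<otimes> z))"
    for t :: "('a, 'b) tensor" and z :: 'c
    by (induct t rule: tensor_induct)
      (simp_all add: even_part_pure even_part_add odd_part_def tensor_simps lin tensor_assoc_pure3)
  fix m n m' n' and t t' :: "('a, 'b) tensor" and z z' :: 'c
  assume z: "homogeneous n z"
  show "tensor_assoc ((t \<otimes> z) * (t' \<otimes> z')) = tensor_assoc (t \<otimes> z) * tensor_assoc (t' \<otimes> z')"
  proof (induct t rule: tensor_induct_homogeneous)
    case t: (pure k l x y)
    show ?case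
    proof (induct t' rule: tensor_induct_homogeneous)
      case t': (pure k' l' x' y')
      note hom = times_tensor_homogeneous [OF z homogeneous_pure [OF t']]
         times_tensor_homogeneous [OF t(2) t'(1)] times_tensor_homogeneous [OF z t'(2)]
         times_tensor_homogeneous [OF homogeneous_pure [OF t(2) z] t'(1)]
      show ?case
        unfolding tensor_assoc_pure3 hom
        by (simp add: lin tensor_simps hom tensor_assoc_pure3 algebra_simps flip: power_add)
    qed (simp_all add: tensor_simps lin distrib_left)
  qed (simp_all add: tensor_simps lin distrib_right)
qed

text \<open>\<open>\<epsilon>\<close> kills odd elements because its target is purely even, so the
  sign in the product of tensors disappears once \<open>\<epsilon>\<close> is applied.\<close>

lemma superalg_hom_counit:
  assumes "superalg_hom \<epsilon>"
  shows "superalg_hom (tensor_lift (\<lambda>x y. \<epsilon> x *q y))" (is "superalg_hom ?l")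
    "superalg_hom (tensor_lift (\<lambda>x y. \<epsilon> y *q x))" (is "superalg_hom ?r")
proof -
  note \<epsilon> = superalg_homD [OF assms] superalg_hom_odd_part [OF assms]
  have "bilinearq (\<lambda>x y. \<epsilon> x *q y)" "bilinearq (\<lambda>x y. \<epsilon> y *q x)"
    by (simp_all add: bilinearq_iff linq_intros \<epsilon>)
  note bil = this
  have lin: "linq ?l" "linq ?r" by (simp_all add: linq_intros bil)
  have parts: "even_part y * z + (y - even_part y) * z = y * z" for y z :: 'b
    by (simp add: algebra_simps)
  note simps = linqD [OF lin(1)] linqD [OF lin(2)] tensor_lift_pure bil one_tensor_def times_tensor_pure
    tensor_mult_def even_part_pure \<epsilon> odd_part_def even_part_laurent_def scaleq_mult_left scaleq_mult_right
    tensor_simps even_part_scaleq cq.scale_right_diff_distrib mult.commute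
  show "superalg_hom ?l"
    by (rule superalg_hom_tensorI [OF lin(1)]) (simp_all add: simps parts flip: scaleq_add_right)
  show "superalg_hom ?r"
    by (rule superalg_hom_tensorI [OF lin(2)]) (simp_all add: simps)
qed

section \<open>Homomorphisms and induction on presented superalgebras\<close>

lemma free_lift_comp:
  fixes \<phi> :: "'g::graded_generators \<Rightarrow> 'a::cq_superalgebra"
  assumes f: "superalg_hom f"
  shows "f (free_lift \<phi> x) = free_lift (\<lambda>g. f (\<phi> g)) x"
proof -
  note hom = superalg_homD [OF f]
  have *: "f (prod_list (map \<phi> gs)) = prod_list (map (\<lambda>g. f (\<phi> g)) gs)" for gs
    by (induct gs) (simp_all add: hom)
  show ?thesis
    by (simp add: free_lift_def pm_ext_def module_hom.sum [OF hom(1)] hom *)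
qed

text \<open>Coassociativity, the counit laws and colinearity below are equalities of homomorphisms,
  which this reduces to generators.\<close>

lemma presented_ext:
  fixes f :: "'g::presentation presented \<Rightarrow> 'a::cq_superalgebra"
  assumes f: "superalg_hom f" and g: "superalg_hom g" and "\<And>x. f (gen x) = g (gen x)"
  shows "f x = g x"
proof (induct x rule: presented.abs_induct)
  case (1 y)
  show ?case
    unfolding free_lift_fgen [symmetric] free_lift_comp [OF f] free_lift_comp [OF g]
    by (simp add: assms)
qed

lemma presented_induct [case_names gen one add mult scaleq]:
  fixes x :: "'g::presentation presented"
  assumes "\<And>g. Q (gen g)" "Q 1" "\<And>x y. Q x \<Longrightarrow> Q y \<Longrightarrow> Q (x + y)"
    "\<And>x y. Q x \<Longrightarrow> Q y \<Longrightarrow> Q (x * y)" "\<And>c x. Q x \<Longrightarrow> Q (c *q x)"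
  shows "Q x"
proof (induct x rule: presented.abs_induct)
  case (1 y)
  have prod: "Q (prod_list (map gen gs))" for gs :: "'g list"
    by (induct gs) (simp_all add: assms)
  \<comment> \<open>The empty sum needs \<open>Q\<close> at 0, which is reached as the zero multiple
    of 1.\<close>
  have zero: "Q (0 *q 1)" by (intro assms)
  have "Q (\<Sum>w\<in>W. c w *q prod_list (map gen (letters w)))" if "finite W" for W c
    using that
  proof (induct W rule: finite_induct)
    case empty
    show ?case using zero by simp
  qed (simp add: assms prod)
  then show ?case
    by (simp add: free_lift_def pm_ext_def flip: free_lift_fgen)
qed

text \<open>There is no sign in this product: it is only needed for the purely even \<open>qgl2\<close>,
  where the antipode is a homomorphism into it.\<close>

typedef 'a opposite = "UNIV :: 'a set" morphisms from_opposite opposite ..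

setup_lifting type_definition_opposite

instantiation opposite :: (cq_superalgebra) cq_superalgebra
begin

lift_definition zero_opposite :: "'a opposite" is 0 .
lift_definition one_opposite :: "'a opposite" is 1 .
lift_definition plus_opposite :: "'a opposite \<Rightarrow> 'a opposite \<Rightarrow> 'a opposite" is "(+)" .
lift_definition minus_opposite :: "'a opposite \<Rightarrow> 'a opposite \<Rightarrow> 'a opposite" is "(-)" .
lift_definition uminus_opposite :: "'a opposite \<Rightarrow> 'a opposite" is uminus .
lift_definition times_opposite :: "'a opposite \<Rightarrow> 'a opposite \<Rightarrow> 'a opposite" is "\<lambda>x y. y * x" .
lift_definition scaleq_opposite :: "laurent \<Rightarrow> 'a opposite \<Rightarrow> 'a opposite" is scaleq .
lift_definition even_part_opposite :: "'a opposite \<Rightarrow> 'a opposite" is even_part .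

instance
  by standard (transfer; simp add: algebra_simps scaleq_mult_left scaleq_mult_right even_part_add
      even_part_scaleq even_part_mult)+

end

section \<open>Quantum matrices with two columns\<close>

text \<open>Naming the powers \<open>Q\<close> and \<open>P\<close> hides them from
  \<open>qpow_mult\<close>; normalisation then treats them as opaque scalars subject to these
  cancellations.\<close>

lemma qpow_inverse:
  assumes "Q = qpow (-1)" "P = qpow 1"
  shows "Q * P = 1" "P * Q = 1" "Q * (P * c) = c" "P * (Q * c) = c"
  by (simp_all add: assms)

text \<open>The Manin relations of an even 2 x 2 matrix, oriented as rewrite rules towards monomials
  ordered as g22, g21, g12, g11. Both \<open>gl2_entry\<close> and its image in \<open>qS\<close>
  are instances.\<close>

locale quantum_matrix2 =
  fixes g :: "col \<Rightarrow> col \<Rightarrow> 'a::cq_algebra"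
  assumes rel:
    "g C1 C1 * g C1 C2 = qpow (-1) *q (g C1 C2 * g C1 C1)"
    "g C2 C1 * g C2 C2 = qpow (-1) *q (g C2 C2 * g C2 C1)"
    "\<And>j. g C1 j * g C2 j = qpow (-1) *q (g C2 j * g C1 j)"
    "g C1 C2 * g C2 C1 = g C2 C1 * g C1 C2"
    "g C1 C1 * g C2 C2 = g C2 C2 * g C1 C1 + (qpow (-1) - qpow 1) *q (g C2 C1 * g C1 C2)"
begin

text \<open>The same rules with a tail \<open>z\<close>, for factors inside a right-associated
  product.\<close>

lemmas rel_assoc = rel [THEN arg_cong [where f = "\<lambda>x. x * z" for z], unfolded mult.assoc distrib_right scaleq_mult_left]

abbreviation det :: 'a where
  "det \<equiv> quantum_minor g C1 C2"

lemma det_central: "det * g i j = g i j * det"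
proof -
  define Q P where QP: "Q = qpow (-1)" "P = qpow 1"
  note rules = rel [folded QP] rel_assoc [folded QP] qpow_inverse [OF QP] scaleq_mult_left scaleq_mult_right
  show ?thesis
    unfolding quantum_minor_def QP [symmetric]
    by (cases i; cases j) (simp_all add: rules algebra_simps)
qed

end


text \<open>Here \<open>x\<close> is one of the rows \<open>i = 3, \<dots>, 6\<close> below the matrix \<open>g\<close> and \<open>T\<close> is
  \<open>D\<^sub>1\<^sub>2\<^sup>-\<^sup>1\<close>; then \<open>m C1\<close>, \<open>m C2\<close> are \<open>D\<^sub>1\<^sub>i\<close>, \<open>D\<^sub>2\<^sub>i\<close>, and \<open>u\<close> is the
  row of chiral coordinates.  As \<open>g\<close> is even and relations inside the row \<open>x\<close> are not
  involved, even and odd rows are treated alike.\<close>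

locale quantum_matrix2_row = quantum_matrix2 +
  fixes x :: "col \<Rightarrow> 'a" and T :: 'a
  assumes row_rel:
    "\<And>k j. g k j * x j = qpow (-1) *q (x j * g k j)"
    "\<And>k. g k C2 * x C1 = x C1 * g k C2"
    "\<And>k. g k C1 * x C2 = x C2 * g k C1 + (qpow (-1) - qpow 1) *q (x C1 * g k C2)"
    and T: "det * T = 1" "T * det = 1"
begin

definition m :: "col \<Rightarrow> 'a" where
  "m k = g k C1 * x C2 - qpow (-1) *q (g k C2 * x C1)"

definition u :: "col \<Rightarrow> 'a" where
  "u k = (case k of C1 \<Rightarrow> (- qpow (-1)) *q (m C2 * T) | C2 \<Rightarrow> m C1 * T)"

lemmas row_rel_assoc = row_rel [THEN arg_cong [where f = "\<lambda>x. x * z" for z], unfolded mult.assoc distrib_right scaleq_mult_left]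

text \<open>The last claim is a quantum Cramer rule: up to \<open>det\<close>, \<open>x\<close> is a
  combination of the rows of \<open>g\<close> with minors as coefficients. All claims follow by
  normal ordering with the entries of \<open>x\<close> moved to the front.\<close>

lemma
  shows m_commute: "g C1 j * m C1 = m C1 * g C1 j" "g C2 j * m C2 = m C2 * g C2 j"
    "g C1 j * m C2 = qpow (-1) *q (m C2 * g C1 j)"
    "g C2 j * m C1 = qpow (-1) *q (m C1 * g C2 j) + (1 - qpow (-1) * qpow (-1)) *q (m C2 * g C1 j)"
    and row_det: "x j * det = m C1 * g C2 j - qpow (-1) *q (m C2 * g C1 j)"
proof -
  define Q P where QP: "Q = qpow (-1)" "P = qpow 1"
  note rules = rel [folded QP] rel_assoc [folded QP] row_rel [folded QP] row_rel_assoc [folded QP]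
    qpow_inverse [OF QP] scaleq_mult_left scaleq_mult_right
  show "g C1 j * m C1 = m C1 * g C1 j"
    unfolding m_def QP [symmetric] by (cases j) (simp_all add: rules algebra_simps)
  show "g C2 j * m C2 = m C2 * g C2 j"
    unfolding m_def QP [symmetric] by (cases j) (simp_all add: rules algebra_simps)
  show "g C1 j * m C2 = qpow (-1) *q (m C2 * g C1 j)"
    unfolding m_def QP [symmetric] by (cases j) (simp_all add: rules algebra_simps)
  show "g C2 j * m C1 = qpow (-1) *q (m C1 * g C2 j) + (1 - qpow (-1) * qpow (-1)) *q (m C2 * g C1 j)"
    unfolding m_def QP [symmetric] by (cases j) (simp_all add: rules algebra_simps)
  show "x j * det = m C1 * g C2 j - qpow (-1) *q (m C2 * g C1 j)"
    unfolding m_def quantum_minor_def QP [symmetric] by (cases j) (simp_all add: rules algebra_simps)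
qed

text \<open>The minor is moved to the front past each factor of \<open>det\<close>. For
  \<open>k = C1\<close> extra terms in \<open>m C2\<close> arise, and they cancel by the relation
  within the first row of \<open>g\<close>.\<close>

lemma det_m: "det * m k = qpow (-1) *q (m k * det)"
proof -
  define Q P where QP: "Q = qpow (-1)" "P = qpow 1"
  note assoc = m_commute [THEN arg_cong [where f = "\<lambda>x. x * z" for z], unfolded mult.assoc distrib_right scaleq_mult_left]
  note rules = rel [folded QP] rel_assoc [folded QP] m_commute [folded QP] assoc [folded QP]
    qpow_inverse [OF QP] scaleq_mult_left scaleq_mult_right
  show ?thesis
    unfolding quantum_minor_def QP [symmetric] by (cases k) (simp_all add: rules algebra_simps)
qed

text \<open>Multiplication by the inverse \<open>T\<close> on both sides turns a commutation rule
  for \<open>det\<close> into one for \<open>T\<close>.\<close>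

lemma inverse_commute:
  assumes "det * y = c *q (z * det)"
  shows "y * T = c *q (T * z)"
proof -
  have "y * T = T * (det * y) * T" by (simp add: T flip: mult.assoc)
  also have "\<dots> = c *q (T * z)" by (simp add: assms mult.assoc T scaleq_mult_left scaleq_mult_right)
  finally show ?thesis .
qed

lemma T_g: "g i j * T = T * g i j"
  using inverse_commute [of "g i j" 1 "g i j"] by (simp add: det_central)

lemma T_m: "T * m k = qpow 1 *q (m k * T)"
  using inverse_commute [OF det_m] by simp

lemma T_u: "T * u l = qpow 1 *q (u l * T)"
  by (simp add: u_def scaleq_mult_left scaleq_mult_right T_m mult.assoc flip: mult.assoc [of T] split: col.split)

text \<open>This is \<open>row_det\<close> divided by \<open>det\<close>; \<open>T\<close> commutes
  with the entries of \<open>g\<close> and is absorbed into the coordinates.\<close>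

lemma row_u: "x j = u C1 * g C1 j + u C2 * g C2 j"
proof -
  have "x j = x j * det * T" by (simp add: T mult.assoc)
  also have "\<dots> = u C1 * g C1 j + u C2 * g C2 j"
    by (simp add: row_det u_def T_g mult.assoc left_diff_distrib scaleq_mult_left)
  finally show ?thesis .
qed

text \<open>An entry passes a coordinate at the cost of coordinates of the same row \<open>x\<close>
  only. With \<open>T_u\<close> these rules are the base case of
  \<open>cleaving_map_coord\<close>.\<close>

lemma g_u:
  "g C1 j * u C2 = u C2 * g C1 j" "g C2 j * u C1 = u C1 * g C2 j"
  "g C1 j * u C1 = qpow (-1) *q (u C1 * g C1 j)"
  "g C2 j * u C2 = qpow (-1) *q (u C2 * g C2 j) + (qpow (-1) - qpow 1) *q (u C1 * g C1 j)"
proof -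
  define Q P where QP: "Q = qpow (-1)" "P = qpow 1"
  note assoc = m_commute [THEN arg_cong [where f = "\<lambda>x. x * z" for z], unfolded mult.assoc distrib_right scaleq_mult_left]
  note rules = assoc [folded QP] qpow_inverse [OF QP] scaleq_mult_left scaleq_mult_right T_g
  show "g C1 j * u C2 = u C2 * g C1 j" "g C2 j * u C1 = u C1 * g C2 j"
    "g C1 j * u C1 = qpow (-1) *q (u C1 * g C1 j)"
    "g C2 j * u C2 = qpow (-1) *q (u C2 * g C2 j) + (qpow (-1) - qpow 1) *q (u C1 * g C1 j)"
    unfolding u_def QP [symmetric] by (simp_all add: rules algebra_simps)
qed

end

section \<open>The Hopf algebra of the quantum group\<close>

lemma superalg_hom_quantum_minor:
  "superalg_hom f \<Longrightarrow> f (quantum_minor a r s) = quantum_minor (\<lambda>i j. f (a i j)) r s"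
  by (simp add: quantum_minor_def superalg_homD)

lemma quantum_matrix2_hom:
  assumes "superalg_hom f" "quantum_matrix2 g"
  shows "quantum_matrix2 (\<lambda>i j. f (g i j))"
  using assms(2)
  by (simp add: quantum_matrix2_def superalg_homD [OF assms(1)]
      flip: superalg_homD(2,3,5) [OF assms(1)])

interpretation gl2q: quantum_matrix2 gl2_entry
  by standard (rule gl2.g_simps)+

lemma gl2_gen_induct [case_names entry det]:
  assumes "\<And>i j. Q (gl2_entry i j)" "Q (gen Detinv)"
  shows "Q (gen x)"
  using assms by (cases x) (simp_all add: gl2_entry_def)

text \<open>All generators are even; this removes every sign caused by tensor factors in
  \<open>qgl2\<close>.\<close>

lemma gl2_even_part: "even_part x = x" for x :: qgl2
proof (induct x rule: presented_induct)
  case (gen g)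
  show ?case
    using gl2_even by (induct g rule: gl2_gen_induct) (simp_all add: homogeneous_def)
qed (simp_all add: even_part_add even_part_mult even_part_scaleq)

lemma Detinv_central: "gl2_entry i j * gen Detinv = gen Detinv * gl2_entry i j"
proof -
  have "gen Detinv * (gl2q.det * gl2_entry i j) * gen Detinv = gen Detinv * (gl2_entry i j * gl2q.det) * gen Detinv"
    by (simp only: gl2q.det_central)
  then show ?thesis
    by (simp only: mult.assoc gl2_det mult_1_right) (simp add: gl2_det flip: mult.assoc)
qed

lemma sum_col: "(\<Sum>m\<in>{C1, C2}. f m) = f C1 + f C2" for f :: "col \<Rightarrow> 'a::comm_monoid_add"
  by simp

lemmas matrix_tensor_expand = matrix_tensor_def [unfolded sum_col]

text \<open>Both sides of each law are homomorphisms, so generators suffice. On entries the laws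
  express associativity of the matrix product and neutrality of the identity matrix.\<close>

lemma gl2_super_coalgebra: "super_coalgebra gl2_comult gl2_counit"
  unfolding super_coalgebra_def
proof (intro conjI allI)
  note hom = superalg_hom_compose [OF gl2_comult(1)] superalg_hom_compose [OF _ superalg_hom_tensor_assoc]
      superalg_hom_tensor_map superalg_hom_counit gl2_comult(1) gl2_counit(1) superalg_hom_id
  note lin = superalg_homD(1) [OF gl2_comult(1)] superalg_homD(1) [OF gl2_counit(1)] linq_id_const
  have bil: "bilinearq (\<lambda>y z. gl2_counit y *q z)" "bilinearq (\<lambda>y z. gl2_counit z *q y)"
    by (simp_all add: bilinearq_iff linq_intros lin)
  note simps = gl2_comult gl2_counit matrix_tensor_expand tensor_map_pure lin
    linq_id linqD [OF linq_tensor_map [OF lin(1) linq_id]] linqD [OF linq_tensor_map [OF linq_id lin(1)]]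
    linqD [OF linq_tensor_assoc] tensor_assoc_pure3 tensor_simps tensor_lift_pure tensor_lift_add bil
  show "superlinear gl2_comult" "superlinear gl2_counit"
    using gl2_comult(1) gl2_counit(1) by (simp_all add: superalg_hom_def)
  fix x
  show "tensor_assoc (tensor_map gl2_comult id (gl2_comult x)) = tensor_map id gl2_comult (gl2_comult x)"
  proof (rule presented_ext [where x = x])
    show "tensor_assoc (tensor_map gl2_comult id (gl2_comult (gen g))) = tensor_map id gl2_comult (gl2_comult (gen g))" for g
      by (induct g rule: gl2_gen_induct) (simp_all add: simps algebra_simps)
  qed (intro hom)+
  show "tensor_lift (\<lambda>y z. gl2_counit y *q z) (gl2_comult x) = x"
  proof (rule presented_ext [where x = x])
    show "tensor_lift (\<lambda>y z. gl2_counit y *q z) (gl2_comult (gen g)) = gen g" for g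
    proof (induct g rule: gl2_gen_induct)
      case (entry i j)
      show ?case by (cases i) (simp_all add: simps)
    qed (simp add: simps)
  qed (intro hom superalg_hom_id [unfolded id_def])+
  show "tensor_lift (\<lambda>y z. gl2_counit z *q y) (gl2_comult x) = x"
  proof (rule presented_ext [where x = x])
    show "tensor_lift (\<lambda>y z. gl2_counit z *q y) (gl2_comult (gen g)) = gen g" for g
    proof (induct g rule: gl2_gen_induct)
      case (entry i j)
      show ?case by (cases j) (simp_all add: simps)
    qed (simp add: simps)
  qed (intro hom superalg_hom_id [unfolded id_def])+
qed

section \<open>The antipode of the quantum group\<close>

definition gl2_cofactor :: "col \<Rightarrow> col \<Rightarrow> qgl2" where
  "gl2_cofactor i j = (case (i, j) of
     (C1, C1) \<Rightarrow> gl2_entry C2 C2 | (C1, C2) \<Rightarrow> (- qpow 1) *q gl2_entry C1 C2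
   | (C2, C1) \<Rightarrow> (- qpow (-1)) *q gl2_entry C2 C1 | (C2, C2) \<Rightarrow> gl2_entry C1 C1)"

definition gl2_antipode :: "qgl2 \<Rightarrow> qgl2" where
  "gl2_antipode x = from_opposite (presented_lift (\<lambda>x. case x of
     Gent i j \<Rightarrow> opposite (gen Detinv * gl2_cofactor i j)
   | Detinv \<Rightarrow> opposite gl2q.det) x)"

lemma opposite_simps: "opposite x * opposite y = opposite (y * x)"
  "c *q opposite x = opposite (c *q x)" "opposite x - opposite y = opposite (x - y)"
  "1 = opposite 1" "0 = opposite 0"
  for x y :: "'a::cq_superalgebra"
  by (simp_all add: times_opposite_def scaleq_opposite_def minus_opposite_def one_opposite_def
      zero_opposite_def opposite_inverse)

text \<open>\<open>gl2_cofactor\<close> is the quantum adjugate: its powers of q make it inverse to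
  the generic matrix up to \<open>det\<close>. Divided by \<open>det\<close>, it satisfies the Manin
  relations in the opposite algebra and has quantum determinant \<open>gen Detinv\<close> there, so
  the presentation yields the map.\<close>

lemma gl2_antipode:
  "linq gl2_antipode" "gl2_antipode 1 = 1"
  "gl2_antipode (x * y) = gl2_antipode y * gl2_antipode x"
  "gl2_antipode (gl2_entry i j) = gen Detinv * gl2_cofactor i j"
  "gl2_antipode (gen Detinv) = gl2q.det"
proof -
  let ?\<phi> = "\<lambda>x. case x of Gent i j \<Rightarrow> opposite (gen Detinv * gl2_cofactor i j) | Detinv \<Rightarrow> opposite gl2q.det"
  define Q P where QP: "Q = qpow (-1)" "P = qpow 1"
  note central = Detinv_central Detinv_central [THEN arg_cong [where f = "\<lambda>x. x * z" for z], unfolded mult.assoc]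
  note rules = gl2_cofactor_def opposite_simps scaleq_mult_left scaleq_mult_right central
    qpow_inverse [OF QP] gl2q.rel [folded QP] gl2q.rel_assoc [folded QP]
  \<comment> \<open>Taken in the opposite order of factors, the quantum determinant of the adjugate
    is \<open>det\<close> itself.\<close>
  have det: "gl2_cofactor C2 C2 * gl2_cofactor C1 C1 - qpow (-1) *q (gl2_cofactor C2 C1 * gl2_cofactor C1 C2) = gl2q.det"
    unfolding quantum_minor_def QP [symmetric] by (simp add: rules QP [symmetric])
  have cofactor_central: "gl2_cofactor i j * gen Detinv = gen Detinv * gl2_cofactor i j" for i j
    by (simp add: gl2_cofactor_def Detinv_central scaleq_mult_left scaleq_mult_right split: col.split)
  have minor: "quantum_minor (\<lambda>i j. opposite (gen Detinv * gl2_cofactor i j)) C1 C2 = opposite (gen Detinv)"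
  proof -
    \<comment> \<open>Both factors \<open>gen Detinv\<close> are moved to the front by centrality,
      and one of them cancels against \<open>det\<close>.\<close>
    have "(gen Detinv * gl2_cofactor C2 C2) * (gen Detinv * gl2_cofactor C1 C1)
        - qpow (-1) *q ((gen Detinv * gl2_cofactor C2 C1) * (gen Detinv * gl2_cofactor C1 C2))
      = gen Detinv * (gen Detinv * (gl2_cofactor C2 C2 * gl2_cofactor C1 C1
        - qpow (-1) *q (gl2_cofactor C2 C1 * gl2_cofactor C1 C2)))"
      by (simp add: mult.assoc right_diff_distrib scaleq_mult_right
          cofactor_central [THEN arg_cong [where f = "\<lambda>x. x * z" for z], unfolded mult.assoc])
    also have "\<dots> = gen Detinv" by (simp only: det gl2_det mult_1_right)
    finally show ?thesis by (simp only: quantum_minor_def opposite_simps)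
  qed
  have rel: "free_lift ?\<phi> r = 0" if "r \<in> relators" for r
    using that unfolding relators_gl2_gen_def
  proof (elim UnE insertE emptyE)
    assume r: "r \<in> manin_relators (\<lambda>_. 0) (\<lambda>i j. fgen (Gent i j))"
    have "manin_relators (\<lambda>_. 0) (\<lambda>i j. opposite (gen Detinv * gl2_cofactor i j)) \<subseteq> {0}"
    proof
      fix r assume "r \<in> manin_relators (\<lambda>_. 0) (\<lambda>i j. opposite (gen Detinv * gl2_cofactor i j))"
      then show "r \<in> {0}"
      proof (cases rule: manin_relators_cases)
        case (row i)
        then show ?thesis by (cases i) (simp_all add: rules QP [symmetric] algebra_simps)
      next
        case (col i k j)
        then show ?thesis by (cases i; cases k; cases j) (simp_all add: less_col_def rules QP [symmetric] algebra_simps)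
      next
        case (anti i k)
        then show ?thesis by (cases i; cases k) (simp_all add: less_col_def rules QP [symmetric] algebra_simps)
      next
        case (diag i k)
        then show ?thesis by (cases i; cases k) (simp_all add: less_col_def rules QP [symmetric] algebra_simps)
      qed
    qed
    then show ?thesis by (intro manin_lift [OF _ r]) simp
  qed (simp_all add: free_lift_minor minor, simp_all add: opposite_simps gl2_det)
  have hom: "homogeneous (gparity x) (?\<phi> x)" for x
    by (simp add: gparity_gl2_gen_def homogeneous_def even_part_opposite_def map_fun_def gl2_even_part from_opposite_inverse)
  have S: "superalg_hom (presented_lift ?\<phi>)"
    using rel hom by (rule presented_lift_hom)
  show "gl2_antipode (gl2_entry i j) = gen Detinv * gl2_cofactor i j"
    "gl2_antipode (gen Detinv) = gl2q.det"
    using presented_lift_gen [of ?\<phi>, OF rel]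
    by (simp_all add: gl2_antipode_def gl2_entry_def opposite_inverse)
  show "linq gl2_antipode"
    by (rule module_hom_scaleqI)
      (simp_all add: gl2_antipode_def superalg_homD [OF S] plus_opposite.rep_eq scaleq_opposite.rep_eq)
  show "gl2_antipode 1 = 1" "gl2_antipode (x * y) = gl2_antipode y * gl2_antipode x"
    by (simp_all add: gl2_antipode_def superalg_homD [OF S] times_opposite.rep_eq one_opposite.rep_eq)
qed


lemma gl2_tensor_mult: "(x \<otimes> y) * (x' \<otimes> y') = (x * x') \<otimes> (y * y')" for y y' :: qgl2
  by (rule tensor_mult_even) (simp add: homogeneous_def gl2_even_part)

text \<open>The antipode laws pass from factors to products, so generators suffice; on entries they
  are the adjugate identities.\<close>

lemma gl2_convolution:
  "convolution gl2_comult gl2_antipode id x = convolution_unit gl2_counit x"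
  "convolution gl2_comult id gl2_antipode x = convolution_unit gl2_counit x"
proof -
  note lin = superalg_homD(1) [OF gl2_comult(1)] superalg_homD(1) [OF gl2_counit(1)] gl2_antipode(1)
  have bil: "bilinearq (\<lambda>y z. gl2_antipode y * z)" "bilinearq (\<lambda>y z. y * gl2_antipode z)"
    by (simp_all add: bilinearq_iff linq_intros lin)
  note simps = tensor_lift_pure tensor_lift_add tensor_lift_scaleq bil gl2_antipode one_tensor_def
    gl2_comult superalg_homD [OF gl2_comult(1)] gl2_counit superalg_homD [OF gl2_counit(1)]
    matrix_tensor_expand scaleq_laurent_def
  \<comment> \<open>The antipode reverses products, so the two parts coming from \<open>t\<close>
    meet in the middle and collapse to the scalar \<open>c\<close>. In \<open>right\<close> it is
    \<open>u\<close> that stands in the middle.\<close>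
  have left: "tensor_lift (\<lambda>y z. gl2_antipode y * z) (t * u) = c *q tensor_lift (\<lambda>y z. gl2_antipode y * z) u"
    if c: "tensor_lift (\<lambda>y z. gl2_antipode y * z) t = c *q 1" for t u c
  proof -
    have "tensor_lift (\<lambda>y z. gl2_antipode y * z) (t * (y \<otimes> z))
        = gl2_antipode y * tensor_lift (\<lambda>y z. gl2_antipode y * z) t * z" for t y z
      by (induct t rule: tensor_induct) (simp_all add: simps gl2_tensor_mult algebra_simps)
    then show ?thesis
      by (induct u rule: tensor_induct)
        (simp_all add: simps c distrib_left scaleq_mult_left scaleq_mult_right scaleq_add_right)
  qed
  have right: "tensor_lift (\<lambda>y z. y * gl2_antipode z) (t * u) = c *q tensor_lift (\<lambda>y z. y * gl2_antipode z) t"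
    if c: "tensor_lift (\<lambda>y z. y * gl2_antipode z) u = c *q 1" for t u c
  proof -
    have "tensor_lift (\<lambda>y z. y * gl2_antipode z) ((y \<otimes> z) * u)
        = y * tensor_lift (\<lambda>y z. y * gl2_antipode z) u * gl2_antipode z" for u y z
      by (induct u rule: tensor_induct) (simp_all add: simps gl2_tensor_mult algebra_simps)
    then show ?thesis
      by (induct t rule: tensor_induct)
        (simp_all add: simps c distrib_right scaleq_mult_left scaleq_mult_right scaleq_add_right)
  qed
  define Q P where QP: "Q = qpow (-1)" "P = qpow 1"
  have central: "gl2_entry i j * (gen Detinv * z) = gen Detinv * (gl2_entry i j * z)" for i j z
    by (simp only: Detinv_central flip: mult.assoc)
  have det: "gen Detinv * (gl2_entry C1 C1 * gl2_entry C2 C2) = 1 + Q *q (gen Detinv * (gl2_entry C1 C2 * gl2_entry C2 C1))"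
    using gl2_det(2) by (simp add: quantum_minor_def right_diff_distrib scaleq_mult_right diff_eq_eq QP)
  \<comment> \<open>The equation for the inverse of \<open>det\<close>, brought to the monomial
    order of \<open>gl2q.rel\<close>.\<close>
  have det': "gen Detinv * (gl2_entry C2 C2 * gl2_entry C1 C1) = 1 + P *q (gen Detinv * (gl2_entry C2 C1 * gl2_entry C1 C2))"
    using det unfolding gl2q.rel(5) gl2q.rel(4)
    by (simp add: QP [symmetric] algebra_simps scaleq_mult_right)
  note rules = gl2_cofactor_def central det' scaleq_mult_left scaleq_mult_right
    qpow_inverse [OF QP] gl2q.rel [folded QP] gl2q.rel_assoc [folded QP]
  have entry: "tensor_lift (\<lambda>y z. gl2_antipode y * z) (gl2_comult (gl2_entry i j)) = gl2_counit (gl2_entry i j) *q 1"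
    "tensor_lift (\<lambda>y z. y * gl2_antipode z) (gl2_comult (gl2_entry i j)) = gl2_counit (gl2_entry i j) *q 1" for i j
    by (cases i; cases j; simp add: simps rules QP [symmetric] algebra_simps)+
  show "convolution gl2_comult gl2_antipode id x = convolution_unit gl2_counit x"
    unfolding convolution_def convolution_unit_def id_def
  proof (induct x rule: presented_induct)
    case (gen g)
    show ?case by (induct g rule: gl2_gen_induct) (simp_all add: entry, simp add: simps gl2_det)
  next
    case (mult x y)
    then show ?case by (simp add: superalg_homD [OF gl2_comult(1)] superalg_homD [OF gl2_counit(1)] left scaleq_laurent_def)
  qed (simp_all add: simps scaleq_add_left)
  show "convolution gl2_comult id gl2_antipode x = convolution_unit gl2_counit x"
    unfolding convolution_def convolution_unit_def id_def
  proof (induct x rule: presented_induct)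
    case (gen g)
    show ?case by (induct g rule: gl2_gen_induct) (simp_all add: entry, simp add: simps gl2_det)
  next
    case (mult x y)
    then show ?case
      by (simp add: superalg_homD [OF gl2_comult(1)] superalg_homD [OF gl2_counit(1)] right mult.commute scaleq_laurent_def)
  qed (simp_all add: simps scaleq_add_left)
qed

lemma gl2_hopf: "hopf_superalgebra gl2_comult gl2_counit"
  unfolding hopf_superalgebra_def
  using gl2_super_coalgebra gl2_comult(1) gl2_counit(1) gl2_antipode(1) gl2_convolution
  by (auto simp: superlinear_def gl2_even_part fun_eq_iff)

section \<open>The cleaving map and the chiral Minkowski superspace\<close>

lemma s_comodule: "comodule_superalgebra gl2_comult gl2_counit s_coaction"
  unfolding comodule_superalgebra_def super_comodule_def
proof (intro conjI allI)
  note hom = superalg_hom_compose [OF s_coaction(1)] superalg_hom_compose [OF _ superalg_hom_tensor_assoc]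
      superalg_hom_tensor_map superalg_hom_counit s_coaction(1) gl2_comult(1) gl2_counit(1) superalg_hom_id
  note lin = superalg_homD(1) [OF s_coaction(1)] superalg_homD(1) [OF gl2_comult(1)]
    superalg_homD(1) [OF gl2_counit(1)]
  have bil: "bilinearq (\<lambda>y z. gl2_counit z *q y)"
    by (simp add: bilinearq_iff linq_intros lin)
  note simps = s_coaction gl2_comult gl2_counit matrix_tensor_expand tensor_map_pure lin
    linq_id_const linqD [OF linq_tensor_map [OF lin(1) linq_id_const]] linqD [OF linq_tensor_map [OF linq_id_const lin(2)]]
    linqD [OF linq_tensor_assoc] tensor_assoc_pure3 tensor_simps tensor_lift_pure tensor_lift_add bil
  show "superalg_hom s_coaction" "superlinear s_coaction"
    using s_coaction(1) by (simp_all add: superalg_hom_def)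
  have gen: "gen g = (case g of Aent i j \<Rightarrow> s_entry i j | D12inv \<Rightarrow> gen D12inv)" for g
    by (simp add: s_entry_def split: s_gen.split)
  fix x
  show "tensor_assoc (tensor_map s_coaction id (s_coaction x)) = tensor_map id gl2_comult (s_coaction x)"
  proof (rule presented_ext [where x = x])
    show "tensor_assoc (tensor_map s_coaction id (s_coaction (gen g))) = tensor_map id gl2_comult (s_coaction (gen g))" for g
      unfolding gen [of g] by (cases g) (simp_all add: simps algebra_simps)
  qed (intro hom)+
  show "tensor_lift (\<lambda>y h. gl2_counit h *q y) (s_coaction x) = x"
  proof (rule presented_ext [where x = x])
    show "tensor_lift (\<lambda>y h. gl2_counit h *q y) (s_coaction (gen g)) = gen g" for g
    proof (cases g)
      case (Aent i j)
      then show ?thesis unfolding gen [of g] by (cases j) (simp_all add: simps)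
    qed (simp add: simps)
  qed (intro hom superalg_hom_id [unfolded id_def])+
qed

section \<open>The cleaving homomorphism\<close>

definition top_row :: "col \<Rightarrow> row" where
  "top_row i = (case i of C1 \<Rightarrow> R1 | C2 \<Rightarrow> R2)"

lemma row_parity_top [simp]: "row_parity (top_row i) = 0"
  by (simp add: top_row_def row_parity_def split: col.split)

text \<open>Monotonicity carries every Manin relator of the quantum group to one between rows 1 and
  2 of the generic matrix, as \<open>cleaving_map\<close> requires to be well defined.\<close>

lemma top_row_less: "i < k \<Longrightarrow> top_row i < top_row k"
  by (cases i; cases k) (simp_all add: top_row_def less_col_def less_row_def)

definition cleaving_map :: "qgl2 \<Rightarrow> qS" where
  "cleaving_map = presented_lift (\<lambda>x. case x of Gent i j \<Rightarrow> s_entry (top_row i) j | Detinv \<Rightarrow> gen D12inv)"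

lemma cleaving_map:
  "superalg_hom cleaving_map"
  "cleaving_map (gl2_entry i j) = s_entry (top_row i) j"
  "cleaving_map (gen Detinv) = gen D12inv"
proof -
  let ?\<phi> = "\<lambda>x. case x of Gent i j \<Rightarrow> s_entry (top_row i) j | Detinv \<Rightarrow> gen D12inv"
  have rel: "free_lift ?\<phi> r = 0" if "r \<in> relators" for r
    using that unfolding relators_gl2_gen_def
  proof (elim UnE insertE emptyE)
    assume r: "r \<in> manin_relators (\<lambda>_. 0) (\<lambda>i j. fgen (Gent i j))"
    have "manin_relators (\<lambda>_. 0) (\<lambda>i j. s_entry (top_row i) j) \<subseteq> manin_relators row_parity s_entry"
    proof
      fix r assume "r \<in> manin_relators (\<lambda>_. 0) (\<lambda>i j. s_entry (top_row i) j)"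
      then show "r \<in> manin_relators row_parity s_entry"
      proof (cases rule: manin_relators_cases)
        case (row i)
        with manin_relators_intros(1) [of s_entry "top_row i" row_parity] show ?thesis by simp
      next
        case (col i k j)
        with manin_relators_intros(2) [OF top_row_less [OF col(1)], of s_entry j row_parity] show ?thesis by simp
      next
        case (anti i k)
        with manin_relators_intros(3) [OF top_row_less [OF anti(1)], of s_entry row_parity] show ?thesis by simp
      next
        case (diag i k)
        with manin_relators_intros(4) [OF top_row_less [OF diag(1)], of s_entry row_parity] show ?thesis by simp
      qed
    qed
    then show ?thesis using s_manin by (intro manin_lift [OF _ r]) auto
  qed (use s_D12 in \<open>simp_all add: free_lift_minor quantum_minor_def top_row_def\<close>)
  have hom: "homogeneous (gparity x) (?\<phi> x)" for x
    using s_parity(1) [of "top_row i" for i] s_parity(2)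
    by (cases x) (simp_all add: gparity_gl2_gen_def)
  show "superalg_hom cleaving_map"
    unfolding cleaving_map_def using rel hom by (rule presented_lift_hom)
  show "cleaving_map (gl2_entry i j) = s_entry (top_row i) j" "cleaving_map (gen Detinv) = gen D12inv"
    using presented_lift_gen [of ?\<phi>, OF rel] by (simp_all add: cleaving_map_def gl2_entry_def)
qed

lemma cleaving_map_colinear: "s_coaction (cleaving_map x) = tensor_map cleaving_map id (gl2_comult x)"
proof (rule presented_ext [where x = x])
  note hom = cleaving_map(1) s_coaction(1) gl2_comult(1) superalg_hom_id
  note lin = linqD [OF linq_tensor_map [OF superalg_homD(1) [OF cleaving_map(1)] linq_id]]
  show "s_coaction (cleaving_map (gen g)) = tensor_map cleaving_map id (gl2_comult (gen g))" for g
    by (induct g rule: gl2_gen_induct)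
      (simp_all add: cleaving_map s_coaction gl2_comult matrix_tensor_expand lin tensor_map_pure linq_id
        superalg_homD(1) [OF cleaving_map(1)])
  show "superalg_hom (\<lambda>x. s_coaction (cleaving_map x))"
    by (intro superalg_hom_compose [OF cleaving_map(1) s_coaction(1)])
  show "superalg_hom (\<lambda>x. tensor_map cleaving_map id (gl2_comult x))"
    by (intro superalg_hom_compose [OF gl2_comult(1)] superalg_hom_tensor_map hom)
qed

section \<open>The inclusion of the base and coinvariance of the chiral coordinates\<close>

lemma chiral_incl_hom: "superalg_hom chiral_incl"
  by (rule superalg_homI)
    (simp_all add: plus_chiral_minkowski.rep_eq scaleq_chiral_minkowski.rep_eq one_chiral_minkowski.rep_eq
      times_chiral_minkowski.rep_eq even_part_chiral_minkowski.rep_eq)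

lemma range_chiral_incl: "range chiral_incl = chiral_subalgebra"
  using type_definition.Rep_range [OF type_definition_chiral_minkowski] .

lemma s_coaction_minor:
  assumes "i < k" "even (row_parity i)"
  shows "s_coaction (quantum_minor s_entry i k) = quantum_minor s_entry i k \<otimes> gl2q.det"
proof -
  have "s_coaction (quantum_minor s_entry i k) = quantum_minor (matrix_tensor s_entry gl2_entry) i k"
    by (simp add: superalg_hom_quantum_minor [OF s_coaction(1)] s_coaction(2))
  then show ?thesis using s.b_minor [OF assms] by simp
qed

text \<open>The factor \<open>det\<close> produced by the minor meets \<open>gen Detinv\<close>
  produced by \<open>gen D12inv\<close> and cancels.\<close>

lemma chiral_coord_coinvariant:
  assumes "i \<in> {R3, R4, R5, R6}"
  shows "chiral_coord i j \<in> coinvariants s_coaction"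
proof -
  have "R1 < i" "R2 < i" using assms by (auto simp: less_row_def)
  then have "s_coaction (quantum_minor s_entry R1 i) = quantum_minor s_entry R1 i \<otimes> gl2q.det"
    "s_coaction (quantum_minor s_entry R2 i) = quantum_minor s_entry R2 i \<otimes> gl2q.det"
    by (simp_all add: s_coaction_minor row_parity_def)
  then show ?thesis
    by (cases j) (simp_all add: chiral_coord_def coinvariants_def superalg_homD [OF s_coaction(1)] s_coaction(3)
      gl2_tensor_mult gl2_det tensor_simps)
qed

lemma chiral_subalgebra_coinvariant: "chiral_subalgebra \<subseteq> coinvariants s_coaction"
proof
  fix x assume "x \<in> chiral_subalgebra"
  then show "x \<in> coinvariants s_coaction"
    unfolding chiral_subalgebra_def
  proof induct
    case (gen x)
    then show ?case by (auto simp: chiral_coord_coinvariant)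
  qed (simp_all add: coinvariants_def superalg_homD [OF s_coaction(1)] one_tensor_def tensor_simps
      pure_one_mult even_part_pure odd_part_def)
qed

lemma s_row:
  assumes "i \<in> {R3, R4, R5, R6}"
  shows "quantum_matrix2_row (\<lambda>k j. s_entry (top_row k) j) (s_entry i) (gen D12inv)"
proof -
  interpret q: quantum_matrix2 "\<lambda>k j. s_entry (top_row k) j"
    using quantum_matrix2_hom [OF cleaving_map(1) gl2q.quantum_matrix2_axioms] by (simp add: cleaving_map)
  have less: "top_row k < i" for k
    using assms by (cases k) (auto simp: top_row_def less_row_def)
  have det: "q.det = quantum_minor s_entry R1 R2"
    by (simp add: quantum_minor_def top_row_def)
  show ?thesis
    by standard (use s.a_simps(2-) [OF less] s_D12 in \<open>simp_all add: det\<close>)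
qed

lemma chiral_coord_u:
  assumes "i \<in> {R3, R4, R5, R6}"
  shows "quantum_matrix2_row.u (\<lambda>k j. s_entry (top_row k) j) (s_entry i) (gen D12inv) = chiral_coord i"
proof -
  interpret q: quantum_matrix2_row "\<lambda>k j. s_entry (top_row k) j" "s_entry i" "gen D12inv"
    using assms by (rule s_row)
  show ?thesis
    unfolding fun_eq_iff q.u_def q.m_def
    by (simp add: chiral_coord_def quantum_minor_def top_row_def split: col.split)
qed

lemma chiral_subalgebra_closed:
  "1 \<in> chiral_subalgebra"
  "x \<in> chiral_subalgebra \<Longrightarrow> y \<in> chiral_subalgebra \<Longrightarrow> x * y \<in> chiral_subalgebra"
  "x \<in> chiral_subalgebra \<Longrightarrow> even_part x \<in> chiral_subalgebra"
  unfolding chiral_subalgebra_def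
  by (rule subsuperalgebra.one subsuperalgebra.mult subsuperalgebra.even_part; assumption?)+

section \<open>Spanning of the whole superalgebra by the base and the cleaving map\<close>

definition chiral_span :: "qS set" where
  "chiral_span = cq.span {chiral_incl c * cleaving_map y | c y. True}"

lemma chiral_spanI: "x \<in> chiral_subalgebra \<Longrightarrow> x * cleaving_map y \<in> chiral_span"
  unfolding chiral_span_def by (rule cq.span_base) (auto simp flip: range_chiral_incl)

lemma chiral_span_closed:
  "a \<in> chiral_span \<Longrightarrow> b \<in> chiral_span \<Longrightarrow> a + b \<in> chiral_span"
  "a \<in> chiral_span \<Longrightarrow> c *q a \<in> chiral_span"
  unfolding chiral_span_def by (rule cq.span_add cq.span_scale; assumption)+

lemma chiral_span_induct [consumes 1, case_names mult add]:
  assumes "a \<in> chiral_span" and mult: "\<And>x y. x \<in> chiral_subalgebra \<Longrightarrow> Q (x * cleaving_map y)"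
    and "\<And>x y. Q x \<Longrightarrow> Q y \<Longrightarrow> Q (x + y)"
  shows "Q a"
  using assms(1) unfolding chiral_span_def
proof (induct rule: cq.span_induct_alt)
  case base
  have "0 \<in> chiral_subalgebra"
    unfolding chiral_subalgebra_def by (rule subsuperalgebra_zero)
  from mult [OF this, of 0] show ?case by simp
next
  case (step c x y)
  then obtain b h where "x = chiral_incl b * cleaving_map h" by blast
  then have "c *q x = chiral_incl (c *q b) * cleaving_map h"
    by (simp add: superalg_homD [OF chiral_incl_hom] scaleq_mult_left)
  then have "Q (c *q x)" using mult chiral_incl by simp
  with step assms(3) show ?case by simp
qed

lemma chiral_span_mult_left: "a \<in> chiral_span \<Longrightarrow> x \<in> chiral_subalgebra \<Longrightarrow> x * a \<in> chiral_span"
  by (induct a rule: chiral_span_induct)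
    (simp_all add: distrib_left chiral_span_closed chiral_spanI chiral_subalgebra_closed flip: mult.assoc)

lemma chiral_span_mult_right: "a \<in> chiral_span \<Longrightarrow> a * cleaving_map h \<in> chiral_span"
  by (induct a rule: chiral_span_induct)
    (simp_all add: distrib_right chiral_span_closed chiral_spanI mult.assoc flip: superalg_homD(5) [OF cleaving_map(1)])

lemma chiral_span_even_part: "a \<in> chiral_span \<Longrightarrow> even_part a \<in> chiral_span"
proof (induct a rule: chiral_span_induct)
  case (mult x y)
  have "even_part (cleaving_map y) = cleaving_map y"
    by (simp add: gl2_even_part flip: superalg_homD(6) [OF cleaving_map(1)])
  with mult show ?case
    by (simp add: even_part_mult chiral_spanI chiral_subalgebra_closed)
qed (simp add: even_part_add chiral_span_closed)

lemma chiral_coord_in: "i \<in> {R3, R4, R5, R6} \<Longrightarrow> chiral_coord i j \<in> chiral_subalgebra"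
  unfolding chiral_subalgebra_def by (rule subsuperalgebra.gen) blast

text \<open>Moving j(y) past a coordinate stays within row \<open>i\<close>. The coefficients come
  from induction on \<open>y\<close>, starting from \<open>g_u\<close> and \<open>T_u\<close>;
  \<open>l\<close> is generalised because the product case meets both coordinates of the
  row.\<close>

lemma cleaving_map_coord:
  assumes i: "i \<in> {R3, R4, R5, R6}"
  shows "\<exists>y1 y2. cleaving_map y * chiral_coord i l
    = chiral_coord i C1 * cleaving_map y1 + chiral_coord i C2 * cleaving_map y2"
proof -
  interpret q: quantum_matrix2_row "\<lambda>k j. s_entry (top_row k) j" "s_entry i" "gen D12inv"
    using assms by (rule s_row)
  note u = q.g_u [unfolded chiral_coord_u [OF i]] q.T_u [unfolded chiral_coord_u [OF i]]
  note hom = superalg_homD [OF cleaving_map(1)]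
  show ?thesis
  proof (induct y arbitrary: l rule: presented_induct)
    case (gen x)
    show ?case
    proof (induct x rule: gl2_gen_induct)
      case (entry k j)
      show ?case
      proof (cases k; cases l)
        assume "k = C1" "l = C1"
        then show ?thesis
          by (intro exI [of _ "qpow (-1) *q gl2_entry k j"] exI [of _ 0])
            (simp add: hom cleaving_map u scaleq_mult_right)
      next
        assume "k = C1" "l = C2"
        then show ?thesis
          by (intro exI [of _ 0] exI [of _ "gl2_entry k j"]) (simp add: hom cleaving_map u)
      next
        assume "k = C2" "l = C1"
        then show ?thesis
          by (intro exI [of _ "gl2_entry k j"] exI [of _ 0]) (simp add: hom cleaving_map u)
      next
        assume "k = C2" "l = C2"
        then show ?thesis
          by (intro exI [of _ "(qpow (-1) - qpow 1) *q gl2_entry C1 j"] exI [of _ "qpow (-1) *q gl2_entry k j"])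
            (simp add: hom cleaving_map u scaleq_mult_right)
      qed
    next
      case det
      show ?case
        by (cases l)
          (intro exI [of _ "qpow 1 *q gen Detinv"] exI [of _ 0], simp add: hom cleaving_map u scaleq_mult_right,
           intro exI [of _ 0] exI [of _ "qpow 1 *q gen Detinv"], simp add: hom cleaving_map u scaleq_mult_right)
    qed
  next
    case one
    show ?case
      by (cases l)
        (intro exI [of _ 1] exI [of _ 0], simp add: hom, intro exI [of _ 0] exI [of _ 1], simp add: hom)
  next
    case (add x y)
    obtain x1 x2 y1 y2 where
      "cleaving_map x * chiral_coord i l = chiral_coord i C1 * cleaving_map x1 + chiral_coord i C2 * cleaving_map x2"
      "cleaving_map y * chiral_coord i l = chiral_coord i C1 * cleaving_map y1 + chiral_coord i C2 * cleaving_map y2"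
      using add by metis
    then show ?case
      by (intro exI [of _ "x1 + y1"] exI [of _ "x2 + y2"]) (simp add: hom algebra_simps)
  next
    case (mult x y)
    obtain y1 y2 where y:
      "cleaving_map y * chiral_coord i l = chiral_coord i C1 * cleaving_map y1 + chiral_coord i C2 * cleaving_map y2"
      using mult(2) by metis
    obtain x1 x2 z1 z2 where x:
      "cleaving_map x * chiral_coord i C1 = chiral_coord i C1 * cleaving_map x1 + chiral_coord i C2 * cleaving_map x2"
      "cleaving_map x * chiral_coord i C2 = chiral_coord i C1 * cleaving_map z1 + chiral_coord i C2 * cleaving_map z2"
      using mult(1) by metis
    have "cleaving_map (x * y) * chiral_coord i l
        = cleaving_map x * chiral_coord i C1 * cleaving_map y1 + cleaving_map x * chiral_coord i C2 * cleaving_map y2"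
      by (simp add: hom y mult.assoc distrib_left)
    \<comment> \<open>The coefficients for a product arise from those of its factors by the rule for
      a matrix acting on a vector.\<close>
    also have "\<dots> = chiral_coord i C1 * cleaving_map (x1 * y1 + z1 * y2)
        + chiral_coord i C2 * cleaving_map (x2 * y1 + z2 * y2)"
      by (simp add: x hom algebra_simps)
    finally show ?case by blast
  next
    case (scaleq c x)
    obtain x1 x2 where
      "cleaving_map x * chiral_coord i l = chiral_coord i C1 * cleaving_map x1 + chiral_coord i C2 * cleaving_map x2"
      using scaleq by metis
    then show ?case
      by (intro exI [of _ "c *q x1"] exI [of _ "c *q x2"])
        (simp add: hom scaleq_mult_left scaleq_mult_right scaleq_add_right)
  qed
qed

lemma cleaving_map_chiral:
  assumes "x \<in> chiral_subalgebra"
  shows "cleaving_map y * x \<in> chiral_span"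
  using assms unfolding chiral_subalgebra_def
proof (induct arbitrary: y)
  case (gen x)
  then obtain i l where i: "i \<in> {R3, R4, R5, R6}" and x: "x = chiral_coord i l" by auto
  obtain y1 y2 where "cleaving_map y * x = chiral_coord i C1 * cleaving_map y1 + chiral_coord i C2 * cleaving_map y2"
    using cleaving_map_coord [OF i] unfolding x by metis
  then show ?case by (simp add: chiral_span_closed chiral_spanI chiral_coord_in [OF i])
next
  case one
  show ?case using chiral_spanI [of 1 y] by (simp add: chiral_subalgebra_closed)
next
  case (add x x')
  then show ?case by (simp add: distrib_left chiral_span_closed)
next
  case (mult x x')
  \<comment> \<open>For a = b j(h) the induction hypothesis puts j(h) \<open>x'\<close> into the
    span, which is closed under multiplication by b from the left.\<close>
  have "a * x' \<in> chiral_span" if "a \<in> chiral_span" for a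
    using that by (induct a rule: chiral_span_induct)
      (simp_all add: mult.assoc mult chiral_span_mult_left distrib_right chiral_span_closed)
  with mult(2) show ?case by (simp flip: mult.assoc)
next
  case (scaleq x c)
  then show ?case by (simp add: scaleq_mult_right chiral_span_closed)
next
  case (even_part x)
  \<comment> \<open>Values of j are even, so multiplication by them commutes with taking even
    parts.\<close>
  have "even_part (cleaving_map y) = cleaving_map y"
    by (simp add: gl2_even_part flip: superalg_homD(6) [OF cleaving_map(1)])
  then have "cleaving_map y * even_part x = even_part (cleaving_map y * x)"
    by (simp add: even_part_mult)
  then show ?case using chiral_span_even_part [OF even_part(2)] by simp
qed

text \<open>In b j(y) b' j(y') the inner pair is reordered by
  \<open>cleaving_map_chiral\<close>.\<close>

lemma chiral_span_mult: "a \<in> chiral_span \<Longrightarrow> b \<in> chiral_span \<Longrightarrow> a * b \<in> chiral_span"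
proof (induct a rule: chiral_span_induct)
  case (mult x y)
  from mult(2) have "cleaving_map y * b \<in> chiral_span"
    by (induct b rule: chiral_span_induct)
      (simp_all add: distrib_left chiral_span_closed cleaving_map_chiral chiral_span_mult_right flip: mult.assoc)
  then show ?case by (simp add: mult.assoc chiral_span_mult_left mult(1))
qed (simp add: distrib_right chiral_span_closed)

text \<open>The span is a subalgebra, so generators suffice: the first two rows and the inverse
  minor are values of j, and the remaining rows are covered by \<open>row_u\<close>.\<close>

lemma chiral_spanned: "a \<in> chiral_span"
proof (induct a rule: presented_induct)
  case (gen g)
  have section_in: "cleaving_map y \<in> chiral_span" for y
    using chiral_spanI [of 1 y] by (simp add: chiral_subalgebra_closed)
  show ?case
  proof (cases g)
    case D12inv
    then show ?thesis using section_in [of "gen Detinv"] by (simp add: cleaving_map)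
  next
    case (Aent i j)
    consider k where "i = top_row k" | "i \<in> {R3, R4, R5, R6}"
      using that(1) [of C1] that(1) [of C2] by (cases i) (simp_all add: top_row_def)
    then show ?thesis
    proof cases
      case (1 k)
      then show ?thesis using section_in [of "gl2_entry k j"]
        by (simp add: Aent cleaving_map s_entry_def)
    next
      case i: 2
      interpret q: quantum_matrix2_row "\<lambda>k j. s_entry (top_row k) j" "s_entry i" "gen D12inv"
        using i by (rule s_row)
      have "gen g = chiral_coord i C1 * cleaving_map (gl2_entry C1 j) + chiral_coord i C2 * cleaving_map (gl2_entry C2 j)"
        using q.row_u [of j, unfolded chiral_coord_u [OF i]]
        by (simp only: Aent cleaving_map flip: s_entry_def)
      then show ?thesis by (simp add: chiral_span_closed chiral_spanI chiral_coord_in [OF i])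
    qed
  qed
next
  case one
  show ?case
    using chiral_spanI [of 1 1] by (simp add: chiral_subalgebra_closed superalg_homD [OF cleaving_map(1)])
qed (simp_all add: chiral_span_closed chiral_span_mult)

theorem theorem7p11:
  shows "chiral_subalgebra = coinvariants s_coaction
    \<and> trivial_quantum_principal_bundle gl2_comult gl2_counit s_coaction chiral_incl"
proof -
  interpret split_hopf_galois gl2_comult gl2_counit s_coaction chiral_incl cleaving_map
  proof
    show "inj chiral_incl" by (simp add: inj_def chiral_incl_inject)
    show "range chiral_incl \<subseteq> coinvariants s_coaction"
      using chiral_subalgebra_coinvariant by (simp add: range_chiral_incl)
  qed (rule gl2_hopf s_comodule chiral_incl_hom cleaving_map(1) cleaving_map_colinear
      chiral_spanned [unfolded chiral_span_def])+
  show ?thesis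
    using coinvariants trivial_bundle by (simp add: range_chiral_incl)
qed

end
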